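(* Let $\chi$ be a Dirichlet character modulo $q\ge 1$, let $t$ be real with $|t|\ge 200$, and put $\mathfrak{q}:=q|t|$. Then \[ |L(1/2+it,\chi)| \le \mathfrak{q}^{1/6} Z(\log \mathfrak{q})+W(\log \mathfrak{q}), \] where \begin{align*} Z(X)&:= 6.6668 \sqrt{\mathrm{cbf}(q)} - 16.0834\, \mathrm{spf}(q) +15.6004\, \mathrm{spf}(q)X\\ &\quad+1.7364\sqrt{\Lambda(D)\, \mathrm{cbf}(q)\,(65.5619 - 17.1704 X - 2.4781 X^2 + 0.6807 X^3)}\\ &\quad+1.7364 \sqrt{\Lambda(D)\, \mathrm{cbf}(q)\, B\, \tau(D/B)\, (-1732.5 - 817.82 X +71.68 X^2 + 47.57 X^3)},\\ W(X)&:= -101.152 - 195.696\, B_1\, \mathrm{sqf}(q)+ 19.092 X + 94.978\, B_1\, \mathrm{sqf}(q)\, X. \end{align*}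
   Context: $L(s,\chi)$ is the Dirichlet $L$-function of $\chi$ and $\tau(n)$ is the number of positive divisors of $n$. Write $q=p_1^{a_1}\cdots p_\omega^{a_\omega}$ with distinct primes $p_j$ and $a_j\ge1$. For a prime power $p^a$ define $C_1(p^a)=p^{\lceil a/2\rceil}$, $D_1(p^a)=p^{a-\lceil a/2\rceil}$, $C(p^a)=p^{\lceil a/3\rceil}$, and $D(p^a)=1$ if $a=1$, $D(p^a)=p^{a-2\lceil a/3\rceil+1}$ if $p=2$ and $a>1$, $D(p^a)=p^{a-2\lceil a/3\rceil}$ if $p\neq 2$ and $a>1$; also $\mathrm{sqf}(p^a)=p^{\lceil a/2\rceil-a/2}$, $\mathrm{cbf}(p^a)=p^{\lceil a/3\rceil-a/3}$, $\mathrm{spf}(p^a)=p^{\lceil a/2\rceil-\lceil a/3\rceil/2-a/6}/\sqrt{D(p^a)}$. All these are extended multiplicatively to $q$, and $C_1:=C_1(q)$, $D_1:=D_1(q)$, $C:=C(q)$, $D:=D(q)$. For a positive integer $m$, $\Lambda(m)$ is the number of $x$ with $0\le x<m$ and $x^2\equiv 1 \pmod m$ (explicitly $2^{\omega(m)-1}$ if $m\equiv 2 \pmod 4$, $2^{\omega(m)+1}$ if $8\mid m$, and $2^{\omega(m)}$ otherwise, $\omega(m)$ being the number of distinct prime factors of $m$). Let $\tilde L$ be an integer such that $\chi(1+C_1x)=e^{2\pi i \tilde L x/D_1}$ for all integers $x$, and put $B_1:=\gcd(\tilde L,D_1)$. Let $L_0,L$ be integers such that $\chi(1+Cx)=e^{4\pi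 i L_0x/(CD)+2\pi i L x^2/D}$ for all integers $x$, and put $B:=\gcd(L,D)$. (Such integers exist.) *)

theory Defs
  imports "HOL-Complex_Analysis.Complex_Analysis" "HOL-Number_Theory.Number_Theory"
begin

definition dirichlet_character :: "nat \<Rightarrow> (int \<Rightarrow> complex) \<Rightarrow> bool" where
  "dirichlet_character q chi \<longleftrightarrow>
     q \<ge> 1 \<and>
     (\<forall>m n. chi (m * n) = chi m * chi n) \<and>
     (\<forall>n. chi (n + int q) = chi n) \<and>
     (\<forall>n. chi n \<noteq> 0 \<longleftrightarrow> coprime n (int q))"

(* f is an analytic continuation to S of the Dirichlet series
   \<Sum>n\<ge>1. chi(n) n^(-s), Re s > 1 *)
definition continues_L_series :: "(int \<Rightarrow> complex) \<Rightarrow> complex set \<Rightarrow> (complex \<Rightarrow> complex) \<Rightarrow> bool" where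
  "continues_L_series chi S f \<longleftrightarrow>
     f holomorphic_on S \<and>
     (\<forall>z. Re z > 1 \<longrightarrow> (\<lambda>n. chi (int (Suc n)) / of_nat (Suc n) powr z) sums f z)"

(* The set insert s (- {1}) is the plane without 1 if s \<noteq> 1, and the whole plane if s = 1.
   So L(1, chi) also has its usual value for non-principal chi; for principal chi, where
   s = 1 is a pole, it is an unspecified number. *)
definition dirichlet_L :: "(int \<Rightarrow> complex) \<Rightarrow> complex \<Rightarrow> complex" where
  "dirichlet_L chi s = (THE l. \<exists>f. continues_L_series chi (insert s (- {1})) f \<and> f s = l)"

lemma dirichlet_L_eqI:
  assumes f: "continues_L_series chi (insert s (- {1})) f"
  shows "dirichlet_L chi s = f s"
proof -
  define S :: "complex set" where "S = insert s (- {1})"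
  let ?H = "{z. Re z > 1}"
  have S: "S = UNIV \<or> S = - {1}" unfolding S_def by (cases "s = 1") auto
  have opS: "open S" using S by (elim disjE) (simp_all add: open_Compl)
  have "connected (- {1 :: complex})" by (rule connected_punctured_universe) simp
  then have cS: "connected S" using S by (elim disjE) (simp_all add: connected_UNIV)
  have HS: "?H \<subseteq> S" unfolding S_def by auto
  have f': "f holomorphic_on S" using f unfolding continues_L_series_def S_def by blast
  have "g s = f s" if g: "continues_L_series chi (insert s (- {1})) g" for g
  proof (rule analytic_continuation_open[where f = g and g = f and s = ?H and s' = S and z = s])
    show "?H \<noteq> {}" by (rule ex_in_conv[THEN iffD1], rule exI[of _ 2]) simp
    show "g z = f z" if "z \<in> ?H" for z
    proof -
      have z: "1 < Re z" using that by blast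
      show ?thesis
        by (rule sums_unique2[of "\<lambda>n. chi (int (Suc n)) / of_nat (Suc n) powr z"])
           (use z f g continues_L_series_def in blast)+
    qed
    show "open ?H" by (rule open_halfspace_Re_gt)
    show "open S" "connected S" "?H \<subseteq> S" "f holomorphic_on S" by fact+
    show "g holomorphic_on S" using g unfolding continues_L_series_def S_def by blast
    show "s \<in> S" unfolding S_def by blast
  qed
  then show ?thesis
    unfolding dirichlet_L_def using f by (intro the_equality) blast+
qed

definition divisor_count :: "nat \<Rightarrow> nat" where
  "divisor_count n = card {d. d dvd n}"

definition sqrt_one_count :: "nat \<Rightarrow> nat" where
  "sqrt_one_count m = card {x. x < m \<and> [x ^ 2 = 1] (mod m)}"

(* f p a is the value at the prime power p ^ a *)
definition mult_extend :: "(nat \<Rightarrow> nat \<Rightarrow> 'a) \<Rightarrow> nat \<Rightarrow> 'a :: comm_monoid_mult" where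
  "mult_extend f q = (\<Prod>p\<in>prime_factors q. f p (multiplicity p q))"

definition C1_pp :: "nat \<Rightarrow> nat \<Rightarrow> nat" where
  "C1_pp p a = p ^ nat \<lceil>real a / 2\<rceil>"

definition D1_pp :: "nat \<Rightarrow> nat \<Rightarrow> nat" where
  "D1_pp p a = p ^ (a - nat \<lceil>real a / 2\<rceil>)"

definition C_pp :: "nat \<Rightarrow> nat \<Rightarrow> nat" where
  "C_pp p a = p ^ nat \<lceil>real a / 3\<rceil>"

(* The subtraction on nat does not truncate, as 2 * \<lceil>a/3\<rceil> \<le> a for a > 1. *)
definition D_pp :: "nat \<Rightarrow> nat \<Rightarrow> nat" where
  "D_pp p a = (if a = 1 then 1
               else if p = 2 then p ^ (a - 2 * nat \<lceil>real a / 3\<rceil> + 1)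
               else p ^ (a - 2 * nat \<lceil>real a / 3\<rceil>))"

definition sqf_pp :: "nat \<Rightarrow> nat \<Rightarrow> real" where
  "sqf_pp p a = real p powr (of_int \<lceil>real a / 2\<rceil> - real a / 2)"

definition cbf_pp :: "nat \<Rightarrow> nat \<Rightarrow> real" where
  "cbf_pp p a = real p powr (of_int \<lceil>real a / 3\<rceil> - real a / 3)"

definition spf_pp :: "nat \<Rightarrow> nat \<Rightarrow> real" where
  "spf_pp p a = real p powr (of_int \<lceil>real a / 2\<rceil> - of_int \<lceil>real a / 3\<rceil> / 2 - real a / 6) / sqrt (real (D_pp p a))"

abbreviation "C1_of \<equiv> mult_extend C1_pp"
abbreviation "D1_of \<equiv> mult_extend D1_pp"
abbreviation "C_of \<equiv> mult_extend C_pp"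
abbreviation "D_of \<equiv> mult_extend D_pp"
abbreviation "sqf \<equiv> mult_extend sqf_pp"
abbreviation "cbf \<equiv> mult_extend cbf_pp"
abbreviation "spf \<equiv> mult_extend spf_pp"

definition Z_fun :: "nat \<Rightarrow> nat \<Rightarrow> real \<Rightarrow> real" where
  "Z_fun q B X =
     6.6668 * sqrt (cbf q) - 16.0834 * spf q + 15.6004 * spf q * X
     + 1.7364 * sqrt (real (sqrt_one_count (D_of q)) * cbf q
         * (65.5619 - 17.1704 * X - 2.4781 * X ^ 2 + 0.6807 * X ^ 3))
     + 1.7364 * sqrt (real (sqrt_one_count (D_of q)) * cbf q
         * real B * real (divisor_count (D_of q div B))
         * (- 1732.5 - 817.82 * X + 71.68 * X ^ 2 + 47.57 * X ^ 3))"

definition W_fun :: "nat \<Rightarrow> nat \<Rightarrow> real \<Rightarrow> real" where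
  "W_fun q B1 X =
     - 101.152 - 195.696 * real B1 * sqf q + 19.092 * X + 94.978 * real B1 * sqf q * X"

end

theory Submission imports Defs begin

text \<open>The value \<open>L(1/2 + it, \<chi>)\<close> is the limit of the partial sums of \<open>\<chi>(n) n\<^sup>-\<^sup>1\<^sup>/\<^sup>2\<^sup>-\<^sup>i\<^sup>t\<close>,
  corrected by a main term if \<open>\<chi>\<close> is principal. With \<open>Q = q t\<close> and \<open>T = t\<^sup>1\<^sup>/\<^sup>3\<close> the sum is cut into ranges.
  Up to \<open>9 C T\<close> it is bounded trivially. Up to about \<open>C D T\<^sup>2\<close> each dyadic block is split into classes modulo \<open>C\<close>,
  on which \<open>\<chi>\<close> is a quadratic phase; Weyl differencing makes it linear, with slope
  \<open>2 L r l\<^sup>-\<^sup>2 / D\<close> for the class of \<open>l\<close> and the shift \<open>r\<close>. Up to \<open>Q\<close> the blocks are split into classes modulo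
  \<open>C\<^sub>1\<close>, on which \<open>\<chi>\<close> is already linear. In both cases the slopes of the different classes are evenly spaced
  fractions, so that the Kuzmin-Landau inequality, and van der Corput's estimate for the few classes whose slope
  comes close to an integer, can be averaged over the classes. Beyond \<open>Q\<close> the drift caused by \<open>n\<^sup>-\<^sup>i\<^sup>t\<close> is smaller
  than this spacing, and Kuzmin-Landau alone suffices.\<close>

section \<open>Exponential sums with slowly varying phase\<close>

text \<open>The cut points come from a balance. Weyl differencing with shifts below R leaves a
  diagonal term N^2 / R on a block at N, so R = N / (C T) makes the block sum of order sqrt (N C T).
  After partial summation every block costs the same sqrt (C T), which is sqrt (cbf q) Q^(1/6);
  there are at most (ln Q) / 2 blocks, which explains the cubic polynomial under the root. The
  differenced phases have denominator D up to a gcd, and their resonances stay below the diagonal as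
  long as 2 R is at most D T, that is up to C D T^2. From there on the linear phases cost C1 sqrt t
  / sqrt N, which at this point is spf(q) Q^(1/6), and sqrt N / (P sqrt t) with P = D1 / B1, which
  at N = Q is B1 sqf(q). The constants leave room because ln Q is at least 21/4.

  The main term needs no case distinction on the character: only the modulus of the mean value of
  chi is carried along. If P > 1, the bounded tail forces it to vanish; if P = 1, the sum is cut
  near q t^2, where the main term and the truncation error are both of order sqrt q.\<close>

definition ee :: "real \<Rightarrow> complex" where "ee x = cis (2 * pi * x)"

lemma norm_ee [simp]: "norm (ee x) = 1"
  by (simp add: ee_def)

lemma ee_add: "ee (x + y) = ee x * ee y"
  by (simp add: ee_def cis_mult algebra_simps)

lemma ee_int [simp]: "ee (of_int m) = 1"
proof -
  have "cos (2 * pi * of_int m) = 1" "sin (2 * pi * of_int m) = 0"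
    using cos_int_2pin[of m] sin_int_2pin[of m] by (simp_all add: mult.commute)
  thus ?thesis by (simp add: ee_def cis.ctr complex_eq_iff)
qed

lemma ee_uminus: "ee (- x) = cnj (ee x)"
  by (simp add: ee_def cis_cnj)

text \<open>Jordan's inequality: by concavity the sine lies above its chord from 0 to
  \<open>pi / 2\<close>.\<close>

lemma sin_pi_mult_ge:
  assumes "0 \<le> y" "y \<le> 1/2"
  shows "2 * y \<le> sin (pi * y)"
proof -
  have "convex_on {0..pi} (\<lambda>x. - sin x)"
    by (rule f''_ge0_imp_convex[where f' = "\<lambda>x. - cos x" and f'' = sin])
       (auto intro!: derivative_eq_intros sin_ge_zero simp: convex_real_interval)
  from convex_onD[OF this, of "2 * y" 0 "pi / 2"] assms show ?thesis
    by (simp add: algebra_simps)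
qed

lemma sin_pi_mult_ge':
  assumes "0 \<le> eps" "eps \<le> d" "d \<le> 1 - eps"
  shows "2 * eps \<le> sin (pi * d)"
proof (cases "d \<le> 1/2")
  case True
  thus ?thesis using sin_pi_mult_ge[of d] assms by linarith
next
  case False
  have "pi * (1 - d) = pi - pi * d" by (simp add: algebra_simps)
  hence "sin (pi * (1 - d)) = sin (pi * d)" by simp
  moreover have "2 * (1 - d) \<le> sin (pi * (1 - d))"
    using assms False by (intro sin_pi_mult_ge) auto
  moreover have "2 * eps \<le> 2 * (1 - d)" using assms by simp
  ultimately show ?thesis by simp
qed

lemma inverse_one_minus_ee:
  assumes "0 < d" "d < 1"
  shows "1 / (1 - ee d) = Complex (1/2) (cot (pi * d) / 2)"
proof -
  have s: "sin (pi * d) \<noteq> 0" using assms sin_gt_zero[of "pi * d"] by simp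
  define a where "a = pi * d"
  have e: "ee d = Complex (1 - 2 * (sin a)\<^sup>2) (2 * sin a * cos a)"
    by (simp add: ee_def a_def complex_eq_iff mult.assoc cos_double_sin[of "pi * d"] sin_double[of "pi * d"])
  have sq: "cos a * cos a = 1 - sin a * sin a"
    using sin_cos_squared_add[of a] unfolding power2_eq_square by linarith
  have "(1 - ee d) * Complex (1/2) (cot a / 2) = 1"
    using s
    by (simp add: e complex_eq_iff cot_def a_def [symmetric] field_simps power2_eq_square,
        use sq in argo)
  hence "(1 - ee d) * Complex (1/2) (cot (pi * d) / 2) = 1" unfolding a_def .
  thus ?thesis by (metis mult_zero_left nonzero_eq_divide_eq mult.commute zero_neq_one)
qed

lemma cot_antimono:
  assumes "0 < x" "x \<le> y" "y < pi"
  shows "cot y \<le> cot x"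
proof -
  have s: "sin x > 0" "sin y > 0" using assms by (auto intro!: sin_gt_zero)
  have "0 \<le> sin (y - x)" using assms by (intro sin_ge_zero) auto
  thus ?thesis using s by (simp add: cot_def field_simps sin_diff)
qed

text \<open>Both bounds come from \<open>sin (pi * d)\<close>, which is at least
  \<open>2 * eps\<close>: the modulus of \<open>1 - ee d\<close> is exactly
  \<open>2 * sin (pi * d)\<close>.\<close>

lemma norm_inverse_one_minus_ee:
  assumes "0 < eps" "eps \<le> d" "d \<le> 1 - eps"
  shows "norm (1 / (1 - ee d)) \<le> 1 / (4 * eps)" "\<bar>cot (pi * d)\<bar> \<le> 1 / (2 * eps)"
proof -
  have s: "2 * eps \<le> sin (pi * d)" using sin_pi_mult_ge' assms by simp
  hence s0: "sin (pi * d) > 0" using assms by linarith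
  have "\<bar>cos (pi * d)\<bar> / sin (pi * d) \<le> 1 / sin (pi * d)"
    using s0 by (intro divide_right_mono) auto
  also have "\<dots> \<le> 1 / (2 * eps)" using s assms by (intro divide_left_mono) auto
  finally show "\<bar>cot (pi * d)\<bar> \<le> 1 / (2 * eps)" using s0 by (simp add: cot_def)
  have sq: "(cos (pi * d))\<^sup>2 = 1 - (sin (pi * d))\<^sup>2"
    using sin_cos_squared_add[of "pi * d"] by linarith
  have "norm (1 / (1 - ee d)) = sqrt (1/4 + (cot (pi * d) / 2)\<^sup>2)"
    using inverse_one_minus_ee[of d] assms by (simp add: complex_norm power2_eq_square)
  also have "1/4 + (cot (pi * d) / 2)\<^sup>2 = (1 / (2 * sin (pi * d)))\<^sup>2"
    using s0 sq by (simp add: cot_def power_divide field_simps)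
  also have "sqrt \<dots> = 1 / (2 * sin (pi * d))" using s0 by simp
  also have "\<dots> \<le> 1 / (4 * eps)" using s assms by (intro divide_left_mono) auto
  finally show "norm (1 / (1 - ee d)) \<le> 1 / (4 * eps)" .
qed

lemma kuzmin_landau_aux:
  fixes phi :: "nat \<Rightarrow> real"
  defines "d \<equiv> \<lambda>x. phi (Suc x) - phi x"
  assumes eps: "0 < eps" "eps \<le> 1/2"
    and mono: "\<And>x y. x \<le> y \<Longrightarrow> y < n \<Longrightarrow> d x \<le> d y"
    and lo: "\<And>x. x < n \<Longrightarrow> eps \<le> d x" and hi: "\<And>x. x < n \<Longrightarrow> d x \<le> 1 - eps"
  shows "norm (\<Sum>x\<le>n. ee (phi x)) \<le> 1 / eps"
proof (cases "n = 0")
  case True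
  thus ?thesis using eps by (simp add: field_simps)
next
  case False
  \<comment> \<open>\<open>ee (phi x)\<close> is \<open>z x\<close> times a difference of consecutive terms, and \<open>z\<close> has constant real part,
    so its total variation is that of the monotone cotangent.\<close>
  define z where "z = (\<lambda>x. 1 / (1 - ee (d x)))"
  have d1: "0 < d x \<and> d x < 1" if "x < n" for x using lo[OF that] hi[OF that] eps by auto
  have zne: "1 - ee (d x) \<noteq> 0" if "x < n" for x
  proof
    assume "1 - ee (d x) = 0"
    with inverse_one_minus_ee[of "d x"] d1[OF that] show False by (simp add: complex_eq_iff)
  qed
  have step: "ee (phi x) + ee (phi (Suc x)) * z x = ee (phi x) * z x" if "x < n" for x
  proof -
    have "ee (phi (Suc x)) = ee (phi x) * ee (d x)" by (simp add: d_def flip: ee_add)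
    thus ?thesis using zne[OF that] by (simp add: z_def field_simps)
  qed
  \<comment> \<open>The boundary term \<open>ee (phi (Suc k)) * z k\<close> stays inside the norm,
    so that a step of the induction adds only a multiple of \<open>z (Suc k) - z k\<close>.\<close>
  have main: "norm ((\<Sum>x\<le>k. ee (phi x)) + ee (phi (Suc k)) * z k)
        \<le> 1 / (4 * eps) + (cot (pi * d 0) - cot (pi * d k)) / 2" if "k < n" for k
    using that
  proof (induction k)
    case 0
    show ?case using step[of 0] 0 norm_inverse_one_minus_ee(1)[of eps "d 0"] lo[of 0] hi[of 0] eps
      by (simp add: z_def norm_mult norm_divide)
  next
    case (Suc k)
    let ?A = "(\<Sum>x\<le>k. ee (phi x)) + ee (phi (Suc k)) * z k"
    have "(\<Sum>x\<le>Suc k. ee (phi x)) + ee (phi (Suc (Suc k))) * z (Suc k)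
        = ?A + ee (phi (Suc k)) * (z (Suc k) - z k)"
      using step[of "Suc k"] Suc.prems by (simp add: algebra_simps)
    also have "norm \<dots> \<le> norm ?A + norm (z (Suc k) - z k)"
      by (rule order_trans[OF norm_triangle_ineq]) (simp add: norm_mult)
    also have "norm (z (Suc k) - z k) = (cot (pi * d k) - cot (pi * d (Suc k))) / 2"
    proof -
      have "z (Suc k) - z k = Complex 0 ((cot (pi * d (Suc k)) - cot (pi * d k)) / 2)"
        using inverse_one_minus_ee[of "d k"] inverse_one_minus_ee[of "d (Suc k)"]
          d1[of k] d1[of "Suc k"] Suc.prems by (simp add: z_def complex_eq_iff field_simps)
      moreover have "cot (pi * d (Suc k)) \<le> cot (pi * d k)"
        using cot_antimono[of "pi * d k" "pi * d (Suc k)"] d1[of k] d1[of "Suc k"] Suc.prems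
          mono[of k "Suc k"] by simp
      ultimately show ?thesis by (simp add: complex_norm)
    qed
    finally show ?case using Suc.IH Suc.prems by (simp add: field_simps)
  qed
  obtain k where k: "n = Suc k" using False by (cases n) auto
  let ?A = "(\<Sum>x\<le>k. ee (phi x)) + ee (phi (Suc k)) * z k"
  have "(\<Sum>x\<le>n. ee (phi x)) = ?A + ee (phi n) * (1 - z k)" unfolding k by (simp add: algebra_simps)
  also have "norm \<dots> \<le> norm ?A + norm (1 - z k)"
    by (rule order_trans[OF norm_triangle_ineq]) (simp add: norm_mult)
  \<comment> \<open>As \<open>z k\<close> has real part 1/2, \<open>1 - z k\<close> is its
    conjugate.\<close>
  also have "norm (1 - z k) = norm (z k)"
    using inverse_one_minus_ee[of "d k"] d1[of k] k
    by (simp add: z_def complex_eq_iff cmod_def)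
  also have "\<dots> \<le> 1 / (4 * eps)"
    using norm_inverse_one_minus_ee(1)[of eps "d k"] lo[of k] hi[of k] eps k by (simp add: z_def)
  \<comment> \<open>The two end points of the telescoped cotangents add \<open>1 / (2 * eps)\<close>
    after halving. The shares 1/4, 1/2 and 1/4 then make up \<open>1 / eps\<close>.\<close>
  also have "norm ?A \<le> 1 / (4 * eps) + (1 / (2 * eps) + 1 / (2 * eps)) / 2"
  proof -
    have "\<bar>cot (pi * d 0)\<bar> \<le> 1 / (2 * eps)" "\<bar>cot (pi * d k)\<bar> \<le> 1 / (2 * eps)"
      using k eps lo hi by (auto intro!: norm_inverse_one_minus_ee(2))
    moreover have "norm ?A \<le> 1 / (4 * eps) + (cot (pi * d 0) - cot (pi * d k)) / 2"
      using main[of k] k by simp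
    moreover have "x \<le> 1 / (4 * eps) + (u - v) / 2 \<Longrightarrow> \<bar>u\<bar> \<le> w \<Longrightarrow> \<bar>v\<bar> \<le> w
        \<Longrightarrow> x \<le> 1 / (4 * eps) + (w + w) / 2" for x u v w by argo
    ultimately show ?thesis by blast
  qed
  finally show ?thesis using eps by (simp add: field_simps)
qed

text \<open>Subtracting \<open>m * i\<close> from the \<open>i\<close>-th phase changes no term of
  the sum and moves increments between \<open>m\<close> and \<open>m + 1\<close> into the unit
  interval.\<close>

lemma kuzmin_landau:
  fixes phi :: "nat \<Rightarrow> real" and m :: int
  defines "d \<equiv> \<lambda>x. phi (Suc x) - phi x"
  assumes eps: "0 < eps" "eps \<le> 1/2"
    and mono: "\<And>x y. a \<le> x \<Longrightarrow> x \<le> y \<Longrightarrow> Suc y < b \<Longrightarrow> d x \<le> d y"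
    and lo: "\<And>x. a \<le> x \<Longrightarrow> Suc x < b \<Longrightarrow> of_int m + eps \<le> d x"
    and hi: "\<And>x. a \<le> x \<Longrightarrow> Suc x < b \<Longrightarrow> d x \<le> of_int m + 1 - eps"
  shows "norm (\<Sum>x\<in>{a..<b}. ee (phi x)) \<le> 1 / eps"
proof (cases "a < b")
  case False
  thus ?thesis using eps by simp
next
  case True
  define n where "n = b - Suc a"
  define psi where "psi = (\<lambda>i. phi (a + i) - of_int m * real i)"
  have ee_psi: "ee (psi i) = ee (phi (a + i))" for i
  proof -
    have "phi (a + i) = psi i + of_int (m * int i)" by (simp add: psi_def)
    thus ?thesis using ee_add[of "psi i" "of_int (m * int i)"] by (simp only: ee_int) simp
  qed
  have dpsi: "psi (Suc i) - psi i = d (a + i) - of_int m" for i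
    by (simp add: psi_def d_def algebra_simps)
  have "(\<Sum>x\<in>{a..<b}. ee (phi x)) = (\<Sum>i\<le>n. ee (psi i))"
    unfolding ee_psi
    by (rule sum.reindex_bij_witness[of _ "\<lambda>i. a + i" "\<lambda>x. x - a"]) (use True in \<open>auto simp: n_def\<close>)
  also have "norm \<dots> \<le> 1 / eps"
  proof (rule kuzmin_landau_aux[OF eps])
    show "psi (Suc x) - psi x \<le> psi (Suc y) - psi y" if "x \<le> y" "y < n" for x y
      unfolding dpsi using mono[of "a + x" "a + y"] that by (simp add: n_def)
    show "eps \<le> psi (Suc x) - psi x" "psi (Suc x) - psi x \<le> 1 - eps" if "x < n" for x
    proof -
      have "Suc (a + x) < b" using that by (simp add: n_def)
      thus "eps \<le> psi (Suc x) - psi x" "psi (Suc x) - psi x \<le> 1 - eps"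
        unfolding dpsi using lo[of "a + x"] hi[of "a + x"] by simp_all
    qed
  qed
  finally show ?thesis .
qed

section \<open>The second derivative test\<close>

lemma finite_convex_nat_set:
  fixes S :: "nat set"
  assumes "finite S" and "\<And>x y z. x \<in> S \<Longrightarrow> z \<in> S \<Longrightarrow> x \<le> y \<Longrightarrow> y \<le> z \<Longrightarrow> y \<in> S"
  shows "\<exists>p q. S = {p..<q}"
proof (cases "S = {}")
  case True
  thus ?thesis by (intro exI[of _ 0]) auto
next
  case False
  have "x \<in> S \<longleftrightarrow> Min S \<le> x \<and> x \<le> Max S" for x
    using assms(2)[OF Min_in[OF assms(1) False] Max_in[OF assms(1) False], of x]
      Min_le[OF assms(1)] Max_ge[OF assms(1)] by blast
  hence "S = {Min S..<Suc (Max S)}" by (simp add: set_eq_iff less_Suc_eq_le)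
  thus ?thesis by blast
qed

text \<open>Increments that grow by at least \<open>lam\<close> per step soon leave any window. This
  disposes of the terms whose increment is too close to an integer for the Kuzmin-Landau
  inequality.\<close>

lemma card_separated_le:
  fixes d :: "nat \<Rightarrow> real"
  assumes "finite S" "0 < lam" "0 \<le> w"
    and sep: "\<And>x y. x \<in> S \<Longrightarrow> y \<in> S \<Longrightarrow> x \<le> y \<Longrightarrow> d x + lam * real (y - x) \<le> d y"
    and rng: "\<And>x. x \<in> S \<Longrightarrow> p \<le> d x \<and> d x \<le> p + w"
  shows "real (card S) \<le> w / lam + 1"
proof (cases "S = {}")
  case True
  thus ?thesis using assms by simp
next
  case False
  have mm: "Min S \<in> S" "Max S \<in> S" using False assms(1) by auto
  have le: "Min S \<le> Max S" using mm assms(1) by simp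
  have "S \<subseteq> {Min S..Max S}" using assms(1) by auto
  hence "card S \<le> card {Min S..Max S}" by (intro card_mono) auto
  hence c: "real (card S) \<le> real (Max S - Min S) + 1" using le by simp
  have "d (Min S) + lam * real (Max S - Min S) \<le> d (Max S)" using mm le by (intro sep)
  hence "lam * real (Max S - Min S) \<le> w" using rng[OF mm(1)] rng[OF mm(2)] by linarith
  hence "real (Max S - Min S) \<le> w / lam" using assms(2) by (simp add: field_simps)
  thus ?thesis using c by linarith
qed

text \<open>The terms are sorted by the integer part of the increment. In each cell the increments
  within \<open>eps\<close> of either end are counted and the middle stretch is left to
  Kuzmin-Landau, at a total cost of \<open>2 * (eps / lam + 1) + 1 / eps\<close>.\<close>

lemma van_der_corput_cell:
  fixes phi :: "nat \<Rightarrow> real"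
  defines "d \<equiv> \<lambda>x. phi (Suc x) - phi x"
  assumes lam: "0 < lam" "lam \<le> 1/2" and al: "al \<le> be"
    and step: "\<And>x. a \<le> x \<Longrightarrow> Suc (Suc x) < b \<Longrightarrow> d x + lam \<le> d (Suc x)"
    and rng: "\<And>x. a \<le> x \<Longrightarrow> Suc x < b \<Longrightarrow> al \<le> d x \<and> d x \<le> be"
  shows "norm (\<Sum>x\<in>{a..<b}. ee (phi x))
    \<le> of_int (\<lfloor>be\<rfloor> - \<lfloor>al\<rfloor> + 1) * (2.83 / sqrt lam + 3)"
proof -
  define B where "B = 2.83 / sqrt lam + 2"
  define N where "N = real_of_int (\<lfloor>be\<rfloor> - \<lfloor>al\<rfloor> + 1)"
  have B0: "B \<ge> 0" using lam by (simp add: B_def)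
  have N1: "N \<ge> 1" using al floor_mono[OF al] by (simp add: N_def)
  have NB: "N * (B + 1) = of_int (\<lfloor>be\<rfloor> - \<lfloor>al\<rfloor> + 1) * (2.83 / sqrt lam + 3)"
    by (simp add: N_def B_def)
  show ?thesis
  proof (cases "a < b")
    case False
    thus ?thesis using NB N1 B0 by (metis atLeastLessThan_empty_iff add_nonneg_nonneg norm_zero
          mult_nonneg_nonneg order_trans sum.empty zero_le_one)
  next
    case ab: True
    \<comment> \<open>The minimizer of \<open>2 * eps / lam + 1 / eps\<close>. The minimum is 2 sqrt
      2 / sqrt lam, whence the constant 2.83.\<close>
    define eps where "eps = sqrt (lam / 2)"
    have eps0: "0 < eps" using lam by (simp add: eps_def)
    have epsh: "eps \<le> 1/2"
    proof -
      have "lam / 2 \<le> (1/2)\<^sup>2" using lam by (simp add: power2_eq_square)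
      thus ?thesis unfolding eps_def by (intro real_le_lsqrt) auto
    qed
    have e2: "eps * eps = lam / 2" using lam by (simp add: eps_def)
    have sep: "d x + lam * real (y - x) \<le> d y" if "a \<le> x" "x \<le> y" "Suc y < b" for x y
      using that(2,3)
    proof (induction y rule: dec_induct)
      case (step n)
      thus ?case using assms(5)[of n] that(1) by (simp add: Suc_diff_le algebra_simps)
    qed simp
    define X where "X = {a..<b - 1}"
    have X: "x \<in> X \<longleftrightarrow> a \<le> x \<and> Suc x < b" for x by (auto simp: X_def)
    have cell: "norm (\<Sum>x\<in>{x\<in>X. \<lfloor>d x\<rfloor> = m}. ee (phi x)) \<le> B" for m
    proof -
      let ?X1 = "{x\<in>X. of_int m \<le> d x \<and> d x < of_int m + eps}"
      let ?X2 = "{x\<in>X. of_int m + eps \<le> d x \<and> d x \<le> of_int m + 1 - eps}"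
      let ?X3 = "{x\<in>X. of_int m + 1 - eps < d x \<and> d x < of_int m + 1}"
      have fin: "finite X" by (simp add: X_def)
      have "{x\<in>X. \<lfloor>d x\<rfloor> = m} = (?X1 \<union> ?X2) \<union> ?X3"
        using eps0 epsh by (auto simp: floor_eq_iff)
      hence "(\<Sum>x\<in>{x\<in>X. \<lfloor>d x\<rfloor> = m}. ee (phi x))
          = (\<Sum>x\<in>?X1. ee (phi x)) + (\<Sum>x\<in>?X2. ee (phi x)) + (\<Sum>x\<in>?X3. ee (phi x))"
        using fin eps0 epsh by (simp only:) (subst sum.union_disjoint, auto)+
      hence split: "norm (\<Sum>x\<in>{x\<in>X. \<lfloor>d x\<rfloor> = m}. ee (phi x))
          \<le> norm (\<Sum>x\<in>?X1. ee (phi x)) + norm (\<Sum>x\<in>?X2. ee (phi x))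
          + norm (\<Sum>x\<in>?X3. ee (phi x))"
        by (simp only:) (rule order_trans[OF norm_triangle_ineq add_right_mono[OF norm_triangle_ineq]])
      have triv: "norm (\<Sum>x\<in>Y. ee (phi x)) \<le> real (card Y)" for Y
        by (rule order_trans[OF norm_sum]) simp
      have f1: "finite ?X1" and f3: "finite ?X3" by (rule finite_subset[OF _ fin], blast)+
      have c1: "real (card ?X1) \<le> eps / lam + 1"
        by (rule card_separated_le[where d = d and p = "of_int m", OF f1])
           (use lam eps0 sep X in auto)
      have c3: "real (card ?X3) \<le> eps / lam + 1"
        by (rule card_separated_le[where d = d and p = "of_int m + 1 - eps", OF f3])
           (use lam eps0 sep X in auto)
      have c2: "norm (\<Sum>x\<in>?X2. ee (phi x)) \<le> 1 / eps"
      proof -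
        have mono: "d x \<le> d y" if "x \<in> X" "y \<in> X" "x \<le> y" for x y
          using sep[of x y] that X lam by (smt (verit) mult_nonneg_nonneg of_nat_0_le_iff)
        have "\<exists>p q. ?X2 = {p..<q}"
        proof (rule finite_convex_nat_set)
          fix x y z assume *: "x \<in> ?X2" "z \<in> ?X2" "x \<le> y" "y \<le> z"
          hence yX: "y \<in> X" using X by auto
          have "d x \<le> d y" "d y \<le> d z" using * yX by (auto intro!: mono)
          thus "y \<in> ?X2" using * yX by auto
        qed (use fin in auto)
        then obtain p q where pq: "?X2 = {p..<q}" by blast
        have in2: "x \<in> ?X2" if "p \<le> x" "Suc x < q" for x using that pq by auto
        show ?thesis unfolding pq
        proof (rule kuzmin_landau[where m = m])
          fix x assume "p \<le> x" "Suc x < q"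
          from in2[OF this] show "of_int m + eps \<le> phi (Suc x) - phi x" 
            "phi (Suc x) - phi x \<le> of_int m + 1 - eps" by (auto simp: d_def)
        next
          fix x y assume "p \<le> x" "x \<le> y" "Suc y < q"
          thus "phi (Suc x) - phi x \<le> phi (Suc y) - phi y"
            using mono[of x y] in2[of x] in2[of y] by (auto simp: d_def)
        qed (use eps0 epsh in auto)
      qed
      have "eps / lam + 1 + 1 / eps + (eps / lam + 1) \<le> B"
      proof -
        have l: "lam = 2 * eps * eps" using e2 by simp
        have "sqrt lam = sqrt 2 * eps" by (simp add: eps_def real_sqrt_divide)
        hence B: "B = 2.83 / (sqrt 2 * eps) + 2" by (simp add: B_def)
        have s2: "sqrt 2 \<le> 1.415" by (rule real_le_lsqrt) (auto simp: power2_eq_square)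
        have "2 / eps \<le> 2.83 / (sqrt 2 * eps)"
          using s2 eps0 by (simp add: field_simps)
        moreover have "eps / lam = 1 / (2 * eps)" using eps0 by (simp add: l)
        ultimately show ?thesis unfolding B using eps0 by (simp add: field_simps)
      qed
      thus ?thesis using split triv[of ?X1] triv[of ?X3] c1 c2 c3 by linarith
    qed
    \<comment> \<open>The last term has no increment inside the range and so belongs to no cell; its
      contribution 1 raises the constant from 2 to 3.\<close>
    have "{a..<b} = insert (b - 1) X" using ab by (auto simp: X_def)
    hence "(\<Sum>x\<in>{a..<b}. ee (phi x)) = ee (phi (b - 1)) + (\<Sum>x\<in>X. ee (phi x))"
      by (simp add: X_def)
    also have "norm \<dots> \<le> 1 + norm (\<Sum>x\<in>X. ee (phi x))"
      by (rule order_trans[OF norm_triangle_ineq]) simp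
    also have "(\<Sum>x\<in>X. ee (phi x))
        = (\<Sum>m\<in>{\<lfloor>al\<rfloor>..\<lfloor>be\<rfloor>}. \<Sum>x\<in>{x\<in>X. \<lfloor>d x\<rfloor> = m}. ee (phi x))"
    proof (rule sum.group [symmetric])
      show "(\<lambda>x. \<lfloor>d x\<rfloor>) ` X \<subseteq> {\<lfloor>al\<rfloor>..\<lfloor>be\<rfloor>}"
        using rng X by (auto intro!: floor_mono)
    qed (auto simp: X_def)
    also have "norm \<dots> \<le> (\<Sum>m\<in>{\<lfloor>al\<rfloor>..\<lfloor>be\<rfloor>}. B)"
      by (rule order_trans[OF norm_sum]) (intro sum_mono cell)
    also have "\<dots> = N * B" using N1 by (simp add: N_def)
    also have "1 + N * B \<le> N * (B + 1)" using N1 by (simp add: algebra_simps)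
    finally show ?thesis using NB by simp
  qed
qed

section \<open>Averaging over residue classes\<close>

lemma sum_inverse_le_ln:
  assumes "n \<ge> 1"
  shows "(\<Sum>j=1..n. 1 / real j) \<le> 1 + ln (real n)"
  using assms
proof (induction n rule: nat_induct_at_least)
  case base
  show ?case by simp
next
  case (Suc n)
  have "ln (real n / real (Suc n)) \<le> real n / real (Suc n) - 1"
    using Suc.hyps by (intro ln_le_minus_one) simp
  also have "\<dots> = - 1 / real (Suc n)" by (simp add: field_simps)
  finally have "1 / real (Suc n) \<le> ln (real (Suc n)) - ln (real n)"
    using Suc.hyps by (simp add: ln_div)
  thus ?case using Suc.IH by simp
qed

text \<open>\<open>T l\<close> stands for a sum whose increments run through an interval of length
  \<open>V\<close> that starts at \<open>u l / P + al\<close>. The distance of this interval to the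
  integers depends only on the residue of \<open>u l\<close> modulo \<open>P\<close>, and each
  residue occurs at most \<open>M\<close> times. Residues whose interval comes near an integer are
  charged by \<open>H2\<close>, the others by \<open>H1\<close>; the reciprocals of their distances
  are dominated by two harmonic sums.\<close>

lemma residue_average:
  fixes u :: "'a \<Rightarrow> int" and P :: nat and T :: "'a \<Rightarrow> real"
  assumes fin: "finite I" and P: "P \<ge> 1" and A: "A \<ge> 0" and V: "V \<ge> 0"
    and mult: "\<And>c. real (card {l\<in>I. [u l = c] (mod int P)}) \<le> M"
    and H1: "\<And>l m eps. l \<in> I \<Longrightarrow> 0 < eps \<Longrightarrow> eps \<le> 1/2 \<Longrightarrow>
        of_int m + eps \<le> of_int (u l) / real P + al \<Longrightarrow>
        of_int (u l) / real P + al + V \<le> of_int m + 1 - eps \<Longrightarrow> T l \<le> 1 / eps"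
    and H2: "\<And>l. l \<in> I \<Longrightarrow> T l \<le> of_int (\<lfloor>of_int (u l) / real P + al + V\<rfloor>
        - \<lfloor>of_int (u l) / real P + al\<rfloor> + 1) * A"
  shows "(\<Sum>l\<in>I. T l) \<le> M * (A * (3 * V * real P + 6) + 2 * real P * (1 + ln (real P)))"
proof -
  \<comment> \<open>The offset \<open>al\<close> is rounded down to the grid of multiples of
    \<open>1 / P\<close>, with remainder \<open>rho / P\<close>. Modulo 1, the grid position of the
    starting point is then \<open>J l\<close>, and \<open>y (J l)\<close> is the starting point
    itself.\<close>
  define k0 where "k0 = \<lfloor>al * real P\<rfloor>"
  define rho where "rho = al * real P - of_int k0"
  have rho: "0 \<le> rho" "rho < 1" unfolding rho_def k0_def by linarith+
  define J where "J = (\<lambda>l. nat ((u l + k0) mod int P))"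
  \<comment> \<open>\<open>(z - real j) / real P\<close> is the distance from the end of the
    interval to the next integer. Bad positions are those at 0 and those with less than one grid
    step left.\<close>
  define z where "z = real P - V * real P - rho"
  define y where "y = (\<lambda>j::nat. (real j + rho) / real P)"
  define bad where "bad = (\<lambda>j::nat. j = 0 \<or> z - real j < 1)"
  define G where "G = (\<lambda>j. if bad j then of_int (\<lfloor>y j + V\<rfloor> + 1) * A
     else real P / real j + real P / of_int \<lfloor>z - real j\<rfloor>)"
  have P0: "real P > 0" using P by simp
  have y0: "y j \<ge> 0" for j using rho P0 by (simp add: y_def)
  have y1: "y j < 1" if "j < P" for j
  proof -
    have "real j + 1 \<le> real P" using that by linarith
    thus ?thesis using rho P0 by (simp add: y_def field_simps)
  qed
  have G0: "G j \<ge> 0" for j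
  proof -
    have "\<lfloor>y j + V\<rfloor> \<ge> 0" using y0[of j] V by simp
    moreover have "\<lfloor>z - real j\<rfloor> \<ge> 0" if "\<not> bad j" using that by (simp add: bad_def) 
    ultimately show ?thesis using A P0 by (simp add: G_def)
  qed
  have JP: "J l < P" for l using P unfolding J_def by (simp add: nat_less_iff)
  have uJ: "of_int (u l) / real P + al = of_int ((u l + k0) div int P) + y (J l)" for l
  proof -
    have "u l + k0 = int P * ((u l + k0) div int P) + int (J l)"
      using P by (simp add: J_def)
    hence "real_of_int (u l) + of_int k0 = real P * of_int ((u l + k0) div int P) + real (J l)"
      by (metis of_int_add of_int_mult of_int_of_nat_eq)
    thus ?thesis using P0 by (simp add: y_def rho_def field_simps)
  qed
  have TG: "T l \<le> G (J l)" if l: "l \<in> I" for l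
  proof (cases "bad (J l)")
    case True
    define w where "w = (u l + k0) div int P"
    have u: "of_int (u l) / real P + al = of_int w + y (J l)" using uJ[of l] by (simp add: w_def)
    have "\<lfloor>of_int w + (y (J l) + V)\<rfloor> = w + \<lfloor>y (J l) + V\<rfloor>" by simp
    moreover have "\<lfloor>of_int w + y (J l)\<rfloor> = w"
      using y0[of "J l"] y1[OF JP, of l] by (simp add: floor_eq_iff)
    ultimately have "\<lfloor>of_int (u l) / real P + al + V\<rfloor> - \<lfloor>of_int (u l) / real P + al\<rfloor> = \<lfloor>y (J l) + V\<rfloor>"
      unfolding u add.assoc by simp
    thus ?thesis using H2[OF l] True by (simp add: G_def)
  next
    case False
    let ?j = "J l"
    have j0: "real ?j > 0" using False by (simp add: bad_def)
    have yj: "real ?j / real P \<le> y ?j" using rho P0 by (simp add: y_def divide_right_mono)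
    have yp: "y ?j > 0" using yj j0 P0 by (smt (verit) divide_pos_pos)
    have z1: "1 - y ?j - V = (z - real ?j) / real P" using P0 by (simp add: z_def y_def field_simps)
    have zj: "z - real ?j \<ge> 1" using False by (simp add: bad_def)
    have fl: "1 \<le> \<lfloor>z - real ?j\<rfloor>" "of_int \<lfloor>z - real ?j\<rfloor> \<le> z - real ?j" using zj by (auto simp: le_floor_iff)
    have fl0: "0 < real_of_int \<lfloor>z - real ?j\<rfloor>" using fl(1) by linarith
    have zp: "1 - y ?j - V > 0" unfolding z1 using zj P0 by simp
    define eps where "eps = min (y ?j) (1 - y ?j - V)"
    have "T l \<le> 1 / eps"
      by (rule H1[OF l, of _ "(u l + k0) div int P"]) (use uJ[of l] yp zp V in \<open>auto simp: eps_def min_def\<close>)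
    also have "\<dots> \<le> 1 / y ?j + 1 / (1 - y ?j - V)"
      using yp zp by (auto simp: eps_def min_def)
    also have "1 / y ?j \<le> 1 / (real ?j / real P)"
      using yj yp j0 P0 by (intro divide_left_mono mult_pos_pos) auto
    also have "1 / (1 - y ?j - V) \<le> real P / of_int \<lfloor>z - real ?j\<rfloor>"
    proof -
      have "1 / (1 - y ?j - V) = real P / (z - real ?j)" by (simp add: z1)
      also have "\<dots> \<le> real P / of_int \<lfloor>z - real ?j\<rfloor>"
        using fl fl0 zj P0 by (intro divide_left_mono mult_pos_pos) auto
      finally show ?thesis .
    qed
    finally show ?thesis using False by (simp add: G_def)
  qed
  have M0: "M \<ge> 0" using mult[of 0] by (smt (verit) of_nat_0_le_iff)
  have "(\<Sum>l\<in>I. T l) \<le> (\<Sum>l\<in>I. G (J l))" by (intro sum_mono TG)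
  also have "\<dots> = (\<Sum>j<P. \<Sum>l\<in>{l\<in>I. J l = j}. G (J l))"
    by (rule sum.group [symmetric]) (use fin JP in auto)
  also have "\<dots> = (\<Sum>j<P. real (card {l\<in>I. J l = j}) * G j)"
    by (intro sum.cong refl) simp
  also have "\<dots> \<le> (\<Sum>j<P. M * G j)"
  proof (intro sum_mono mult_right_mono G0)
    fix j assume "j \<in> {..<P}"
    have "{l\<in>I. J l = j} \<subseteq> {l\<in>I. [u l = int j - k0] (mod int P)}"
    proof safe
      fix l
      have "[u l + k0 = int (J l)] (mod int P)" using P by (simp add: J_def cong_def)
      from cong_diff[OF this cong_refl[of k0]] show "[u l = int (J l) - k0] (mod int P)" by simp
    qed
    hence "card {l\<in>I. J l = j} \<le> card {l\<in>I. [u l = int j - k0] (mod int P)}"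
      using fin by (intro card_mono) auto
    thus "real (card {l\<in>I. J l = j}) \<le> M" using mult[of "int j - k0"] by linarith
  qed
  also have "\<dots> = M * (\<Sum>j<P. G j)" by (simp add: sum_distrib_left)
  also have "(\<Sum>j<P. G j) = (\<Sum>j\<in>{j\<in>{..<P}. bad j}. G j) + (\<Sum>j\<in>{j\<in>{..<P}. \<not> bad j}. G j)"
    by (subst sum.union_disjoint [symmetric]) (auto intro!: sum.cong)
  \<comment> \<open>If \<open>V\<close> is at least 1, all \<open>P\<close> positions may be bad,
    but each meets at most \<open>V + 2\<close> and so at most \<open>3 * V\<close> cells. Otherwise
    there are at most \<open>V * P + 3\<close> bad positions, with two cells each.\<close>
  also have "(\<Sum>j\<in>{j\<in>{..<P}. bad j}. G j) \<le> A * (3 * V * real P + 6)"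
  proof (cases "V \<ge> 1")
    case True
    have "(\<Sum>j\<in>{j\<in>{..<P}. bad j}. G j) \<le> (\<Sum>j\<in>{j\<in>{..<P}. bad j}. 3 * V * A)"
    proof (intro sum_mono)
      fix j assume j: "j \<in> {j\<in>{..<P}. bad j}"
      have "real_of_int (\<lfloor>y j + V\<rfloor> + 1) \<le> 3 * V" using y1[of j] j True by simp linarith
      thus "G j \<le> 3 * V * A" using j A by (simp add: G_def mult_right_mono)
    qed
    also have "\<dots> = real (card {j\<in>{..<P}. bad j}) * (3 * V * A)" by simp
    also have "\<dots> \<le> real P * (3 * V * A)"
    proof (intro mult_right_mono)
      have "card {j\<in>{..<P}. bad j} \<le> card {..<P}" by (intro card_mono) auto
      thus "real (card {j\<in>{..<P}. bad j}) \<le> real P" by simp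
    qed (use A V in auto)
    also have "\<dots> \<le> A * (3 * V * real P + 6)" using A by (simp add: algebra_simps)
    finally show ?thesis .
  next
    case False
    have "(\<Sum>j\<in>{j\<in>{..<P}. bad j}. G j) \<le> (\<Sum>j\<in>{j\<in>{..<P}. bad j}. 2 * A)"
    proof (intro sum_mono)
      fix j assume j: "j \<in> {j\<in>{..<P}. bad j}"
      have "real_of_int (\<lfloor>y j + V\<rfloor> + 1) \<le> 2" using y1[of j] j False by simp
      thus "G j \<le> 2 * A" using j A by (simp add: G_def mult_right_mono)
    qed
    also have "\<dots> = real (card {j\<in>{..<P}. bad j}) * (2 * A)" by simp
    also have "\<dots> \<le> (V * real P + 3) * (2 * A)"
    proof (intro mult_right_mono)
      have "{j\<in>{..<P}. bad j} \<subseteq> insert 0 {nat (\<lfloor>z - 1\<rfloor> + 1)..<P}"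
      proof
        fix j assume j: "j \<in> {j\<in>{..<P}. bad j}"
        show "j \<in> insert 0 {nat (\<lfloor>z - 1\<rfloor> + 1)..<P}"
        proof (cases "j = 0")
          case nz: False
          hence "z - 1 < real j" using j by (auto simp: bad_def)
          hence "\<lfloor>z - 1\<rfloor> < int j" by linarith
          thus ?thesis using j by auto
        qed simp
      qed
      hence "card {j\<in>{..<P}. bad j} \<le> card (insert 0 {nat (\<lfloor>z - 1\<rfloor> + 1)..<P})"
        by (intro card_mono) auto
      also have "\<dots> \<le> Suc (P - nat (\<lfloor>z - 1\<rfloor> + 1))"
        by (simp add: card_insert_if)
      finally have "real (card {j\<in>{..<P}. bad j}) \<le> 1 + real (P - nat (\<lfloor>z - 1\<rfloor> + 1))" by linarith
      also have "real (P - nat (\<lfloor>z - 1\<rfloor> + 1)) \<le> real P - (z - 1)"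
      proof -
        have "V * real P \<ge> 0" using V by simp
        hence zz: "z - 1 \<le> real P" using rho by (simp add: z_def)
        show ?thesis using zz by linarith
      qed
      also have "1 + (real P - (z - 1)) \<le> V * real P + 3" using rho by (simp add: z_def)
      finally show "real (card {j\<in>{..<P}. bad j}) \<le> V * real P + 3" by simp
    qed (use A in auto)
    also have "\<dots> \<le> A * (3 * V * real P + 6)"
      using A V P0 by (simp add: algebra_simps)
    finally show ?thesis .
  qed
  also have "(\<Sum>j\<in>{j\<in>{..<P}. \<not> bad j}. G j) \<le> 2 * real P * (1 + ln (real P))"
  proof -
    let ?S = "{j\<in>{..<P}. \<not> bad j}"
    have "(\<Sum>j\<in>?S. G j) = real P * (\<Sum>j\<in>?S. 1 / real j) + real P * (\<Sum>j\<in>?S. 1 / of_int \<lfloor>z - real j\<rfloor>)"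
      by (simp add: G_def sum.distrib sum_distrib_left)
    also have "(\<Sum>j\<in>?S. 1 / real j) \<le> (\<Sum>j=1..P. 1 / real j)"
      by (intro sum_mono2) (auto simp: bad_def Suc_le_eq intro!: Nat.gr0I)
    \<comment> \<open>The floors of the gaps \<open>z - real j\<close> are distinct integers from 1
      to \<open>P\<close>, which gives the second harmonic sum.\<close>
    also have "(\<Sum>j\<in>?S. 1 / real_of_int \<lfloor>z - real j\<rfloor>) = (\<Sum>i\<in>(\<lambda>j. nat (\<lfloor>z\<rfloor> - int j)) ` ?S. 1 / real i)"
    proof (subst sum.reindex)
      have fz: "\<lfloor>z - real j\<rfloor> = \<lfloor>z\<rfloor> - int j" for j
        using floor_diff_of_int[of z "int j"] by simp
      have pos: "\<lfloor>z\<rfloor> - int j \<ge> 1" if "j \<in> ?S" for j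
        using that unfolding bad_def fz[symmetric] by (auto simp: le_floor_iff)
      show "inj_on (\<lambda>j. nat (\<lfloor>z\<rfloor> - int j)) ?S"
      proof (rule inj_onI)
        fix i j assume "i \<in> ?S" "j \<in> ?S" and eq: "nat (\<lfloor>z\<rfloor> - int i) = nat (\<lfloor>z\<rfloor> - int j)"
        with pos[of i] pos[of j] show "i = j" by simp
      qed
      show "(\<Sum>j\<in>?S. 1 / real_of_int \<lfloor>z - real j\<rfloor>)
          = sum ((\<lambda>i. 1 / real i) \<circ> (\<lambda>j. nat (\<lfloor>z\<rfloor> - int j))) ?S"
      proof (intro sum.cong refl)
        fix j assume "j \<in> ?S"
        from pos[OF this] show "1 / real_of_int \<lfloor>z - real j\<rfloor> 
            = ((\<lambda>i. 1 / real i) \<circ> (\<lambda>j. nat (\<lfloor>z\<rfloor> - int j))) j"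
          unfolding fz by simp
      qed
    qed
    also have "\<dots> \<le> (\<Sum>j=1..P. 1 / real j)"
    proof (intro sum_mono2)
      show "(\<lambda>j. nat (\<lfloor>z\<rfloor> - int j)) ` ?S \<subseteq> {1..P}"
      proof safe
        fix j assume j: "\<not> bad j"
        hence "z - real j \<ge> 1" by (simp add: bad_def)
        hence 1: "\<lfloor>z\<rfloor> \<ge> int j + 1" by (simp add: le_floor_iff)
        have "V * real P \<ge> 0" using V by simp
        hence "z \<le> real P" using rho by (simp add: z_def)
        hence "\<lfloor>z\<rfloor> \<le> int P" by linarith
        thus "nat (\<lfloor>z\<rfloor> - int j) \<in> {1..P}" using 1 by auto
      qed
    qed auto
    also have "real P * (\<Sum>j=1..P. 1 / real j) + real P * (\<Sum>j=1..P. 1 / real j)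
        \<le> real P * (1 + ln (real P)) + real P * (1 + ln (real P))"
      using sum_inverse_le_ln[OF P] by (intro add_mono mult_left_mono) auto
    finally show ?thesis using P0 by (simp add: mult_left_mono)
  qed
  finally show ?thesis using M0 by (simp add: mult_left_mono)
qed

section \<open>Weyl differencing\<close>

text \<open>Van der Corput's inequality: the sum is the average of \<open>R\<close> shifted copies
  of itself, Cauchy-Schwarz is applied over the window of length \<open>K + R\<close>, and the
  correlation of two copies depends only on the distance of their shifts.\<close>

lemma weyl_differencing:
  fixes z :: "nat \<Rightarrow> complex"
  assumes R: "R \<ge> 1" and z1: "\<And>x. x < K \<Longrightarrow> norm (z x) \<le> 1"
  shows "(norm (\<Sum>x<K. z x))\<^sup>2 \<le> (real K + real R) / real R *
      (real K + 2 * (\<Sum>r=1..<R. norm (\<Sum>x<K - r. z (x + r) * cnj (z x))))"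
proof -
  define h where "h = (\<lambda>j y. if j \<le> y \<and> y - j < K then z (y - j) else 0)"
  define w where "w = (\<lambda>y. \<Sum>j<R. h j y)"
  define g where "g = (\<lambda>r. norm (\<Sum>x<K - r. z (x + r) * cnj (z x)))"
  define c where "c = (\<lambda>i j. \<Sum>y<K + R. h i y * cnj (h j y))"
  have sumh: "(\<Sum>y<K + R. h j y) = (\<Sum>x<K. z x)" if "j < R" for j
  proof -
    have "(\<Sum>y<K + R. h j y) = (\<Sum>y\<in>{j..<K + j}. h j y)"
      by (intro sum.mono_neutral_right) (use that in \<open>auto simp: h_def\<close>)
    also have "\<dots> = (\<Sum>x<K. z x)"
      by (rule sum.reindex_bij_witness[of _ "\<lambda>x. x + j" "\<lambda>y. y - j"]) (auto simp: h_def)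
    finally show ?thesis .
  qed
  have corr: "c i j = (\<Sum>x<K - (j - i). z (x + (j - i)) * cnj (z x))" if "i \<le> j" "j < R" for i j
  proof -
    have "c i j = (\<Sum>y\<in>{j..<j + (K - (j - i))}. h i y * cnj (h j y))"
      unfolding c_def by (intro sum.mono_neutral_right) (use that in \<open>auto simp: h_def\<close>)
    also have "\<dots> = (\<Sum>x<K - (j - i). z (x + (j - i)) * cnj (z x))"
      by (rule sum.reindex_bij_witness[of _ "\<lambda>x. x + j" "\<lambda>y. y - j"])
         (use that in \<open>auto simp: h_def add.commute\<close>)
    finally show ?thesis .
  qed
  have cnj_c: "c j i = cnj (c i j)" for i j by (simp add: c_def mult.commute)
  have g0: "g r \<ge> 0" for r by (simp add: g_def)
  have gK: "g 0 \<le> real K"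
  proof -
    have "g 0 \<le> (\<Sum>x<K. norm (z x * cnj (z x)))" unfolding g_def by (simp add: norm_sum)
    also have "\<dots> \<le> (\<Sum>x<K. 1)"
      using z1 by (intro sum_mono) (simp add: norm_mult mult_le_one)
    finally show ?thesis by simp
  qed
  have normc: "norm (c i j) = (if i \<le> j then g (j - i) else g (i - j))" if "i < R" "j < R" for i j
  proof (cases "i \<le> j")
    case True
    thus ?thesis using corr[OF True that(2)] by (simp add: g_def)
  next
    case False
    have "norm (c i j) = norm (c j i)" by (subst cnj_c) simp
    thus ?thesis using corr[of j i] False that by (simp add: g_def)
  qed
  \<comment> \<open>A fixed copy meets each lag at most once on either side. Extending both sides to
    all lags below \<open>R\<close> replaces the usual triangular weights by 1.\<close>
  have row: "(\<Sum>j<R. norm (c i j)) \<le> real K + 2 * (\<Sum>r=1..<R. g r)" if i: "i < R" for i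
  proof -
    have "{..<R} = {..<i} \<union> insert i {i<..<R}" using i by auto
    hence "(\<Sum>j<R. norm (c i j)) = (\<Sum>j\<in>{..<i} \<union> insert i {i<..<R}. norm (c i j))"
      by (rule arg_cong)
    also have "\<dots> = (\<Sum>j\<in>{..<i}. norm (c i j)) + (\<Sum>j\<in>insert i {i<..<R}. norm (c i j))"
      by (rule sum.union_disjoint) auto
    also have "\<dots> = (\<Sum>j\<in>{..<i}. norm (c i j)) + norm (c i i) + (\<Sum>j\<in>{i<..<R}. norm (c i j))"
      by simp
    also have "(\<Sum>j\<in>{..<i}. norm (c i j)) = (\<Sum>r\<in>{1..i}. g r)"
      by (rule sum.reindex_bij_witness[of _ "\<lambda>r. i - r" "\<lambda>j. i - j"]) (use i normc in auto)
    also have "\<dots> \<le> (\<Sum>r=1..<R. g r)" using i g0 by (intro sum_mono2) auto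
    also have "(\<Sum>j\<in>{i<..<R}. norm (c i j)) = (\<Sum>r\<in>{1..<R - i}. g r)"
      by (rule sum.reindex_bij_witness[of _ "\<lambda>r. i + r" "\<lambda>j. j - i"]) (use i normc in auto)
    also have "\<dots> \<le> (\<Sum>r=1..<R. g r)" using i g0 by (intro sum_mono2) auto
    also have "norm (c i i) \<le> real K" using normc[OF i i] gK by simp
    finally show ?thesis by simp
  qed
  have "of_real (\<Sum>y<K + R. (norm (w y))\<^sup>2) = (\<Sum>y<K + R. w y * cnj (w y))"
    by (simp only: of_real_sum complex_norm_square)
  also have "\<dots> = (\<Sum>y<K + R. \<Sum>i<R. \<Sum>j<R. h i y * cnj (h j y))"
    by (simp add: w_def sum_product)
  also have "\<dots> = (\<Sum>i<R. \<Sum>y<K + R. \<Sum>j<R. h i y * cnj (h j y))" by (rule sum.swap)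
  also have "\<dots> = (\<Sum>i<R. \<Sum>j<R. c i j)"
    unfolding c_def by (intro sum.cong refl sum.swap)
  finally have eq: "of_real (\<Sum>y<K + R. (norm (w y))\<^sup>2) = (\<Sum>i<R. \<Sum>j<R. c i j)" .
  have "(\<Sum>y<K + R. (norm (w y))\<^sup>2) = norm (of_real (\<Sum>y<K + R. (norm (w y))\<^sup>2) :: complex)"
    by (simp add: sum_nonneg del: of_real_sum)
  also have "\<dots> \<le> (\<Sum>i<R. \<Sum>j<R. norm (c i j))"
    unfolding eq by (intro order_trans[OF norm_sum] sum_mono norm_sum)
  also have "\<dots> \<le> (\<Sum>i<R. real K + 2 * (\<Sum>r=1..<R. g r))" by (intro sum_mono row) simp
  finally have sq: "(\<Sum>y<K + R. (norm (w y))\<^sup>2) \<le> real R * (real K + 2 * (\<Sum>r=1..<R. g r))" by simp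
  have "(\<Sum>y<K + R. w y) = (\<Sum>j<R. \<Sum>y<K + R. h j y)" unfolding w_def by (rule sum.swap)
  also have "\<dots> = of_nat R * (\<Sum>x<K. z x)" using sumh by simp
  finally have "real R * norm (\<Sum>x<K. z x) = norm (\<Sum>y<K + R. w y)" by (simp add: norm_mult)
  also have "\<dots> \<le> (\<Sum>y<K + R. 1 * norm (w y))" by (simp add: norm_sum)
  finally have "(real R * norm (\<Sum>x<K. z x))\<^sup>2 \<le> (\<Sum>y<K + R. 1 * norm (w y))\<^sup>2"
    by (intro power_mono) auto
  also have "\<dots> \<le> (\<Sum>y<K + R. 1\<^sup>2) * (\<Sum>y<K + R. (norm (w y))\<^sup>2)"
    by (rule Cauchy_Schwarz_ineq_sum)
  also have "\<dots> \<le> (real K + real R) * (real R * (real K + 2 * (\<Sum>r=1..<R. g r)))"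
    using sq by (simp add: mult_left_mono)
  finally have "real R * (real R * (norm (\<Sum>x<K. z x))\<^sup>2)
      \<le> real R * ((real K + real R) * (real K + 2 * (\<Sum>r=1..<R. g r)))"
    by (simp add: power_mult_distrib power2_eq_square algebra_simps)
  hence "real R * (norm (\<Sum>x<K. z x))\<^sup>2 \<le> (real K + real R) * (real K + 2 * (\<Sum>r=1..<R. g r))"
    using R by (simp add: mult_le_cancel_left)
  thus ?thesis using R unfolding g_def by (simp add: field_simps)
qed

section \<open>Continuation of periodic Dirichlet series\<close>

lemma holomorphic_on_suminf:
  fixes f :: "nat \<Rightarrow> complex \<Rightarrow> complex"
  assumes S: "open S" and hol: "\<And>n. f n holomorphic_on S"
    and bd: "\<And>z. z \<in> S \<Longrightarrow> \<exists>d>0. \<exists>M. cball z d \<subseteq> S \<and> summable M \<and> (\<forall>n. \<forall>w\<in>cball z d. norm (f n w) \<le> M n)"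
  shows "(\<lambda>z. \<Sum>n. f n z) holomorphic_on S" "\<And>z. z \<in> S \<Longrightarrow> summable (\<lambda>n. f n z)"
proof -
  show "(\<lambda>z. \<Sum>n. f n z) holomorphic_on S"
  proof (rule holomorphic_uniform_sequence[OF S, of "\<lambda>N z. \<Sum>n<N. f n z"])
    show "(\<lambda>z. \<Sum>n<N. f n z) holomorphic_on S" for N
      by (intro holomorphic_intros hol)
    show "\<exists>d>0. cball z d \<subseteq> S \<and> uniform_limit (cball z d) (\<lambda>N z. \<Sum>n<N. f n z) (\<lambda>z. \<Sum>n. f n z) sequentially"
      if z: "z \<in> S" for z
    proof -
      obtain d M where "d > 0" "cball z d \<subseteq> S" "summable M" "\<forall>n. \<forall>w\<in>cball z d. norm (f n w) \<le> M n"
        using bd[OF z] by blast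
      thus ?thesis by (intro exI[of _ d] conjI Weierstrass_m_test[of _ _ M]) auto
    qed
  qed
  show "summable (\<lambda>n. f n z)" if z: "z \<in> S" for z
  proof -
    obtain d M where d: "d > 0" "summable M" "\<forall>n. \<forall>w\<in>cball z d. norm (f n w) \<le> M n"
      using bd[OF z] by blast
    have "z \<in> cball z d" using d(1) by simp
    hence "norm (f n z) \<le> M n" for n using d(3) by blast
    thus ?thesis by (intro summable_comparison_test'[OF d(2), of 0])
  qed
qed

lemma periodic_mod:
  fixes b :: "nat \<Rightarrow> 'a"
  assumes "\<And>n. b (n + q) = b n"
  shows "b (n mod q) = b n"
proof -
  have "b (m + k * q) = b m" for k m
  proof (induction k)
    case (Suc k)
    thus ?case using assms[of "m + k * q"] by (simp add: algebra_simps)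
  qed simp
  from this[of "n mod q" "n div q"] show ?thesis by (metis mod_mult_div_eq mult.commute mod_div_mult_eq)
qed

lemma periodic_bounded:
  fixes b :: "nat \<Rightarrow> complex"
  assumes "q \<ge> 1" "\<And>n. b (n + q) = b n"
  shows "\<exists>K\<ge>0. \<forall>n. norm (b n) \<le> K"
proof -
  have "norm (b n) \<le> (\<Sum>i<q. norm (b i))" for n
  proof -
    have "norm (b (n mod q)) \<le> (\<Sum>i<q. norm (b i))"
      using assms by (intro member_le_sum) auto
    thus ?thesis using periodic_mod[of b q, OF assms(2)] by simp
  qed
  thus ?thesis by (meson order_trans norm_ge_zero)
qed

fun powr_diff_iter :: "nat \<Rightarrow> complex \<Rightarrow> complex \<Rightarrow> complex" where
  "powr_diff_iter 0 w z = w powr (- z)"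
| "powr_diff_iter (Suc k) w z = powr_diff_iter k (w + 1) z - powr_diff_iter k w z"

lemma has_field_derivative_powr_diff_iter:
  assumes "Re w > 0"
  shows "((\<lambda>w. powr_diff_iter k w z) has_field_derivative (- z * powr_diff_iter k w (z + 1))) (at w)"
  using assms
proof (induction k arbitrary: w)
  case 0
  have "w \<notin> \<real>\<^sub>\<le>\<^sub>0" using 0 by (auto simp: complex_nonpos_Reals_iff)
  from has_field_derivative_powr[OF this, of "- z"] show ?case
    by (simp add: minus_diff_commute)
next
  case (Suc k)
  have "((\<lambda>w. powr_diff_iter k (w + 1) z) has_field_derivative (- z * powr_diff_iter k (w + 1) (z + 1))) (at w)"
    using Suc.IH[of "w + 1"] Suc.prems
    by (intro iffD1[OF DERIV_shift, of "\<lambda>w. powr_diff_iter k w z" _ w 1]) simp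
  from DERIV_diff[OF this Suc.IH[OF Suc.prems]] show ?case by (simp add: algebra_simps)
qed

lemma holomorphic_powr_diff_iter:
  assumes "Re w > 0"
  shows "(\<lambda>z. powr_diff_iter k w z) holomorphic_on S"
  using assms
proof (induction k arbitrary: w)
  case 0
  thus ?case by (auto intro!: holomorphic_intros)
next
  case (Suc k)
  thus ?case by (auto intro!: holomorphic_intros)
qed

lemma in_closed_segment_of_real:
  assumes "w \<in> closed_segment (complex_of_real a) (of_real b)" "a \<le> b"
  shows "\<exists>y. w = of_real y \<and> a \<le> y \<and> y \<le> b"
proof -
  have "w \<in> of_real ` closed_segment a b" using assms(1) by (simp only: closed_segment_of_real)
  thus ?thesis using assms(2) by (auto simp: closed_segment_eq_real_ivl)
qed

text \<open>A difference is bounded by the derivative, and the derivative in \<open>w\<close>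
  replaces \<open>z\<close> by \<open>z + 1\<close> at the price of a factor \<open>z\<close>.
  Iteration yields the rising factorial of \<open>z\<close> and one power of decay per difference.
  The hypothesis on \<open>Re z + real k\<close> makes the occurring powers decreasing, so that the
  left end of each segment is the worst point.\<close>

lemma norm_powr_diff_iter_le:
  assumes "x > 0" "Re z + real k \<ge> 0"
  shows "norm (powr_diff_iter k (of_real x) z) \<le> (\<Prod>i<k. norm (z + of_nat i)) * x powr (- Re z - real k)"
  using assms
proof (induction k arbitrary: z x)
  case 0
  thus ?case by (simp add: norm_powr_real_powr)
next
  case (Suc k)
  define B where "B = (\<Prod>i<Suc k. norm (z + of_nat i)) * x powr (- Re z - real (Suc k))"
  let ?S = "closed_segment (complex_of_real x) (of_real (x + 1))"
  have "norm (powr_diff_iter k (of_real (x + 1)) z - powr_diff_iter k (of_real x) z)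
      \<le> B * norm (complex_of_real (x + 1) - of_real x)"
  proof (rule field_differentiable_bound[where S = ?S])
    show "((\<lambda>w. powr_diff_iter k w z) has_field_derivative (- z * powr_diff_iter k w (z + 1))) (at w within ?S)"
      if w: "w \<in> ?S" for w
    proof -
      obtain y where "w = of_real y" "x \<le> y" using in_closed_segment_of_real[of w x "x + 1"] w by auto
      thus ?thesis using Suc.prems
        by (intro has_field_derivative_at_within[OF has_field_derivative_powr_diff_iter]) simp
    qed
    show "norm (- z * powr_diff_iter k w (z + 1)) \<le> B" if w: "w \<in> ?S" for w
    proof -
      obtain y where y: "w = of_real y" "x \<le> y"
        using in_closed_segment_of_real[of w x "x + 1"] w by auto
      have "norm (powr_diff_iter k w (z + 1))
          \<le> (\<Prod>i<k. norm (z + 1 + of_nat i)) * y powr (- Re (z + 1) - real k)"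
        unfolding y(1) using Suc.prems y by (intro Suc.IH) auto
      also have "\<dots> \<le> (\<Prod>i<k. norm (z + 1 + of_nat i)) * x powr (- Re (z + 1) - real k)"
        using Suc.prems y by (intro mult_left_mono powr_mono2' prod_nonneg) auto
      finally have "norm z * norm (powr_diff_iter k w (z + 1))
          \<le> norm z * ((\<Prod>i<k. norm (z + 1 + of_nat i)) * x powr (- Re (z + 1) - real k))"
        by (intro mult_left_mono) auto
      also have "\<dots> = B"
      proof -
        have e: "- Re (z + 1) - real k = - Re z - real (Suc k)" by simp
        show ?thesis unfolding B_def e by (subst prod.lessThan_Suc_shift) (simp add: algebra_simps)
      qed
      finally show ?thesis by (simp add: norm_mult)
    qed
  qed (auto)
  thus ?case by (simp add: B_def)
qed

lemma summable_Suc_powr: "s > 1 \<Longrightarrow> summable (\<lambda>n. real (Suc n) powr (- s))"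
  using summable_Suc_iff[of "\<lambda>n. real n powr (- s)"] summable_real_powr_iff[of "- s"] by simp

lemma powr_diff_iter_tendsto_0:
  assumes "Re z > 1"
  shows "(\<lambda>n. powr_diff_iter k (of_nat (Suc n)) z) \<longlonglongrightarrow> 0"
proof (rule tendsto_norm_zero_cancel, rule tendsto_sandwich[of "\<lambda>_. 0"])
  have "(\<lambda>n. real (Suc n) powr (- (Re z + real k))) \<longlonglongrightarrow> 0"
    using assms by (intro summable_LIMSEQ_zero summable_Suc_powr) simp
  from tendsto_mult_left[OF this, of "\<Prod>i<k. norm (z + of_nat i)"]
  show "(\<lambda>n. (\<Prod>i<k. norm (z + of_nat i)) * real (Suc n) powr (- Re z - real k)) \<longlonglongrightarrow> 0" by simp
  show "\<forall>\<^sub>F n in sequentially. norm (powr_diff_iter k (of_nat (Suc n)) z)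
      \<le> (\<Prod>i<k. norm (z + of_nat i)) * real (Suc n) powr (- Re z - real k)"
  proof (intro always_eventually allI)
    fix n
    have "norm (powr_diff_iter k (of_real (real (Suc n))) z)
        \<le> (\<Prod>i<k. norm (z + of_nat i)) * real (Suc n) powr (- Re z - real k)"
      using assms by (intro norm_powr_diff_iter_le) auto
    thus "norm (powr_diff_iter k (of_nat (Suc n)) z)
        \<le> (\<Prod>i<k. norm (z + of_nat i)) * real (Suc n) powr (- Re z - real k)"
      by (simp only: of_real_of_nat_eq)
  qed
  show "\<forall>\<^sub>F n in sequentially. 0 \<le> norm (powr_diff_iter k (of_nat (Suc n)) z)"
    by (intro always_eventually allI norm_ge_zero)
  show "(\<lambda>n. 0 :: real) \<longlonglongrightarrow> 0" by (rule tendsto_const)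
qed

text \<open>The \<open>k\<close>-th differences decay like the power \<open>- Re z - k\<close>, so
  the series has a summable majorant on a small disc around each point of the half plane.\<close>

lemma powr_diff_series_base:
  assumes "q \<ge> 1" and per: "\<And>n. b (n + q) = (b n :: complex)"
  shows "\<exists>f. f holomorphic_on {z. Re z > 1 - real k} \<and>
    (\<forall>z. Re z > 1 - real k \<longrightarrow> (\<lambda>n. b n * powr_diff_iter k (of_nat (Suc n)) z) sums f z)"
proof -
  obtain K where K: "K \<ge> 0" "\<And>n. norm (b n) \<le> K" using periodic_bounded[of q b] assms by blast
  let ?S = "{z. Re z > 1 - real k}"
  let ?f = "\<lambda>n z. b n * powr_diff_iter k (of_nat (Suc n)) z"
  have bd: "\<exists>d>0. \<exists>M. cball z d \<subseteq> ?S \<and> summable M \<and> (\<forall>n. \<forall>w\<in>cball z d. norm (?f n w) \<le> M n)"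
    if "z \<in> ?S" for z
  proof -
    define d where "d = (Re z - (1 - real k)) / 2"
    define sg where "sg = Re z - d"
    have d0: "d > 0" using that by (simp add: d_def)
    have sg: "sg > 1 - real k" using that by (simp add: sg_def d_def field_simps)
    have Re: "Re w \<ge> sg" if "w \<in> cball z d" for w
    proof -
      have "\<bar>Re (z - w)\<bar> \<le> d" using that abs_Re_le_cmod[of "z - w"] by (simp add: dist_norm)
      thus ?thesis by (simp add: sg_def)
    qed
    define M where "M = (\<lambda>n. K * ((\<Prod>i<k. (norm z + d + real i)) * real (Suc n) powr (- (sg + real k))))"
    have "summable M" unfolding M_def using sg by (intro summable_mult summable_Suc_powr) simp
    moreover have "cball z d \<subseteq> ?S" using Re sg by fastforce
    moreover have "norm (?f n w) \<le> M n" if w: "w \<in> cball z d" for n w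
    proof -
      have nw: "norm w \<le> norm z + d"
        using w norm_triangle_sub[of w z] by (simp add: dist_norm norm_minus_commute)
      have "norm (powr_diff_iter k (of_real (real (Suc n))) w)
          \<le> (\<Prod>i<k. norm (w + of_nat i)) * real (Suc n) powr (- Re w - real k)"
        using Re[OF w] sg by (intro norm_powr_diff_iter_le) auto
      also have "\<dots> \<le> (\<Prod>i<k. (norm z + d + real i)) * real (Suc n) powr (- (sg + real k))"
      proof (intro mult_mono prod_mono powr_mono conjI)
        fix i show "norm (w + of_nat i) \<le> norm z + d + real i"
          using norm_triangle_ineq[of w "of_nat i"] nw by simp
      qed (use Re[OF w] d0 in \<open>auto intro!: prod_nonneg\<close>)
      finally have "norm (powr_diff_iter k (of_nat (Suc n)) w) \<le> \<dots>" by (simp only: of_real_of_nat_eq)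
      thus ?thesis unfolding M_def norm_mult using K by (intro mult_mono) auto
    qed
    ultimately show ?thesis using d0 by blast
  qed
  have hol: "?f n holomorphic_on ?S" for n
    by (intro holomorphic_intros holomorphic_powr_diff_iter) simp
  have op: "open ?S" by (rule open_halfspace_Re_gt)
  show ?thesis
    using holomorphic_on_suminf[of ?S ?f, OF op hol bd] by (intro exI[of _ "\<lambda>z. \<Sum>n. ?f n z"]) (auto intro: summable_sums)
qed

text \<open>Summation by parts trades the coefficients, minus their mean, for one more difference of \<open>n\<^sup>-\<^sup>z\<close>,
  which improves the decay by one power; the mean contributes a telescoping sum.\<close>

lemma powr_diff_series_continuation:
  assumes "q \<ge> 1" "i \<le> k" and per: "\<And>n. b (n + q) = (b n :: complex)"
    and mean: "i < k \<or> (\<Sum>n<q. b n) = 0"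
  shows "\<exists>f. f holomorphic_on {z. Re z > 1 - real k} \<and>
    (\<forall>z. Re z > 1 \<longrightarrow> (\<lambda>n. b n * powr_diff_iter (k - i) (of_nat (Suc n)) z) sums f z)"
  using assms(2-)
proof (induction i arbitrary: b)
  case 0
  show ?case using powr_diff_series_base[of q b k] assms(1) 0(2) by auto
next
  case (Suc i)
  define j where "j = k - Suc i"
  have kj: "k - i = Suc j" using Suc.prems by (simp add: j_def)
  define mu where "mu = (\<Sum>n<q. b n) / of_nat q"
  \<comment> \<open>Removing the mean makes the partial sums periodic again, so that the induction
    hypothesis applies to them.\<close>
  define B where "B = (\<lambda>n. \<Sum>i<n. (b i - mu))"
  note b_per = Suc.prems(2)
  have Bper: "B (n + q) = B n" for n
  proof (induction n)
    case 0
    show ?case using assms(1) by (simp add: B_def sum_subtractf mu_def)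
  next
    case (Suc n)
    thus ?case using b_per[of n] by (simp add: B_def)
  qed
  have "\<exists>f. f holomorphic_on {z. Re z > 1 - real k} \<and>
    (\<forall>z. Re z > 1 \<longrightarrow> (\<lambda>n. B (Suc n) * powr_diff_iter (k - i) (of_nat (Suc n)) z) sums f z)"
    using Suc.prems Bper[of "Suc _"] by (intro Suc.IH) auto
  then obtain g where g: "g holomorphic_on {z. Re z > 1 - real k}"
    "\<And>z. Re z > 1 \<Longrightarrow> (\<lambda>n. B (Suc n) * powr_diff_iter (Suc j) (of_nat (Suc n)) z) sums g z"
    unfolding kj by blast
  obtain K where K: "K \<ge> 0" "\<And>n. norm (B n) \<le> K" using periodic_bounded[of q B] assms(1) Bper by blast
  define f where "f = (\<lambda>z. - g z - (if j = 0 then 0 else mu * powr_diff_iter (j - 1) 1 z))"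
  have "f holomorphic_on {z. Re z > 1 - real k}"
    unfolding f_def by (cases "j = 0") (auto intro!: holomorphic_intros g(1) holomorphic_powr_diff_iter)
  moreover have "(\<lambda>n. b n * powr_diff_iter j (of_nat (Suc n)) z) sums f z" if z: "Re z > 1" for z
  proof -
    let ?H = "\<lambda>j n. powr_diff_iter j (of_nat (Suc n)) z"
    have HS: "?H (Suc j) n = ?H j (Suc n) - ?H j n" for j n by (simp add: add.commute)
    have parts: "(\<Sum>n<N. (b n - mu) * ?H j n) = B N * ?H j N - (\<Sum>n<N. B (Suc n) * ?H (Suc j) n)" for N
    proof (induction N)
      case 0
      show ?case by (simp add: B_def)
    next
      case (Suc N)
      have BS: "B (Suc N) = B N + (b N - mu)" by (simp add: B_def)
      show ?case unfolding sum.lessThan_Suc Suc.IH HS by (simp only: BS) (simp add: algebra_simps)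
    qed
    have "(\<lambda>N. B N * ?H j N) \<longlonglongrightarrow> 0"
    proof (rule tendsto_norm_zero_cancel, rule tendsto_sandwich[of "\<lambda>_. 0"])
      show "(\<lambda>N. K * norm (?H j N)) \<longlonglongrightarrow> 0"
        using tendsto_mult_left[OF tendsto_norm_zero[OF powr_diff_iter_tendsto_0[OF z, of j]], of K] by simp
      show "\<forall>\<^sub>F N in sequentially. norm (B N * ?H j N) \<le> K * norm (?H j N)"
        using K by (intro always_eventually allI) (auto simp: norm_mult intro!: mult_right_mono)
      show "\<forall>\<^sub>F n in sequentially. 0 \<le> norm (B n * ?H j n)"
        by (intro always_eventually allI norm_ge_zero)
      show "(\<lambda>n. 0 :: real) \<longlonglongrightarrow> 0" by (rule tendsto_const)
    qed
    from tendsto_diff[OF this g(2)[OF z, unfolded sums_def]]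
    have 1: "(\<lambda>N. \<Sum>n<N. (b n - mu) * ?H j n) \<longlonglongrightarrow> - g z"
      unfolding parts by simp
    \<comment> \<open>For positive \<open>j\<close> the differences telescope to a difference of
      lower order. For \<open>j = 0\<close> there is none; this is where the vanishing of the mean
      is used.\<close>
    have 2: "(\<lambda>N. \<Sum>n<N. mu * ?H j n) \<longlonglongrightarrow> - (if j = 0 then 0 else mu * powr_diff_iter (j - 1) 1 z)"
    proof (cases j)
      case 0
      hence "mu = 0" using Suc.prems(1,3) by (auto simp: mu_def j_def)
      thus ?thesis using 0 by simp
    next
      case (Suc j')
      have tel: "(\<Sum>n<N. ?H j n) = ?H j' N - powr_diff_iter j' 1 z" for N
      proof (induction N)
        case (Suc N)
        thus ?case unfolding sum.lessThan_Suc \<open>j = Suc j'\<close> HS by simp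
      qed simp
      have "(\<lambda>N. mu * (?H j' N - powr_diff_iter j' 1 z)) \<longlonglongrightarrow> mu * (0 - powr_diff_iter j' 1 z)"
        by (intro tendsto_intros powr_diff_iter_tendsto_0[OF z])
      thus ?thesis unfolding sum_distrib_left [symmetric] tel using Suc by simp
    qed
    from tendsto_add[OF 1 2] show ?thesis
      by (simp add: sums_def f_def sum.distrib [symmetric] algebra_simps)
  qed
  ultimately show ?case unfolding j_def by blast
qed

text \<open>The continuations to the half planes \<open>Re z > 1 - real k\<close> agree on overlaps
  by the identity theorem. Choosing for each point a half plane that contains it therefore gives an
  entire function.\<close>

lemma periodic_series_entire:
  assumes "q \<ge> 1" and per: "\<And>n. b (n + q) = (b n :: complex)" and mean: "(\<Sum>n<q. b n) = 0"
  shows "\<exists>F. F holomorphic_on UNIV \<and>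
    (\<forall>z. Re z > 1 \<longrightarrow> (\<lambda>n. b n / of_nat (Suc n) powr z) sums F z)"
proof -
  have "\<exists>f. f holomorphic_on {z. Re z > 1 - real k} \<and>
    (\<forall>z. Re z > 1 \<longrightarrow> (\<lambda>n. b n / of_nat (Suc n) powr z) sums f z)" for k
    using powr_diff_series_continuation[of q k k b] assms(1) per mean
    by (simp add: powr_minus divide_inverse)
  then obtain f where f: "\<And>k. f k holomorphic_on {z. Re z > 1 - real k}"
    "\<And>k z. Re z > 1 \<Longrightarrow> (\<lambda>n. b n / of_nat (Suc n) powr z) sums f k z" by metis
  have eq: "f k z = f m z" if "k \<le> m" "Re z > 1 - real k" for k m z
  proof (rule analytic_continuation_open[where f = "f k" and g = "f m" and z = z and s = "{z. Re z > 1}" and s' = "{z. Re z > 1 - real k}"])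
    show "f k holomorphic_on {z. Re z > 1 - real k}" by (rule f)
    show "f m holomorphic_on {z. Re z > 1 - real k}"
      by (rule holomorphic_on_subset[OF f(1)]) (use that in auto)
    show "f k w = f m w" if "w \<in> {z. Re z > 1}" for w
      using f(2)[of w k] f(2)[of w m] that sums_unique2 by blast
    show "connected {z. Re z > 1 - real k}" by (intro convex_connected convex_halfspace_Re_gt)
    show "{z. Re z > 1} \<noteq> {}" by (rule ex_in_conv[THEN iffD1], rule exI[of _ 2]) simp
  qed (use that in \<open>auto simp: open_halfspace_Re_gt\<close>)
  define F where "F = (\<lambda>z. f (nat \<lceil>norm z + 2\<rceil>) z)"
  have Ff: "F z = f k z" if "Re z > 1 - real k" for k z
  proof -
    let ?m = "nat \<lceil>norm z + 2\<rceil>"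
    have "real ?m \<ge> norm z + 2" by linarith
    hence m: "Re z > 1 - real ?m" using abs_Re_le_cmod[of z] by linarith
    show ?thesis unfolding F_def
    proof (cases "k \<le> ?m")
      case True
      show "f ?m z = f k z" by (rule eq[OF True that, symmetric])
    next
      case False
      show "f ?m z = f k z" by (rule eq[OF _ m]) (use False in simp)
    qed
  qed
  have "F holomorphic_on UNIV"
  proof -
    have "F field_differentiable at z" for z
    proof -
      define k where "k = nat \<lceil>norm z + 2\<rceil>"
      have "real k \<ge> norm z + 2" unfolding k_def by linarith
      hence z: "Re z > 1 - real k" using abs_Re_le_cmod[of z] by linarith
      have "f k field_differentiable at z"
        using f(1)[of k] z by (simp add: holomorphic_on_open open_halfspace_Re_gt field_differentiable_def)
      then obtain D where "(f k has_field_derivative D) (at z)"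
        by (auto simp: field_differentiable_def)
      hence "(F has_field_derivative D) (at z)"
        by (rule has_field_derivative_transform_within_open[OF _ open_halfspace_Re_gt[of "1 - real k"]])
           (use z Ff in auto)
      thus ?thesis by (auto simp: field_differentiable_def)
    qed
    thus ?thesis by (simp add: holomorphic_on_def field_differentiable_at_within)
  qed
  moreover have "(\<lambda>n. b n / of_nat (Suc n) powr z) sums F z" if "Re z > 1" for z
    using f(2)[OF that, of 0] Ff[of 0 z] that by simp
  ultimately show ?thesis by blast
qed

text \<open>A nonzero \<open>w\<close> would be purely imaginary, with \<open>Im w * ln 2\<close>
  and \<open>Im w * ln 3\<close> both nonzero multiples of 2 pi. Then a positive power of 2 would
  equal a power of 3, against parity.\<close>

lemma powr_two_three_eq_1:
  fixes w :: complex
  assumes "2 powr w = 1" "3 powr w = 1"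
  shows "w = 0"
proof (rule ccontr)
  assume w: "w \<noteq> 0"
  have e2: "exp (w * of_real (ln 2)) = 1" and e3: "exp (w * of_real (ln 3)) = 1"
    using assms by (simp_all add: powr_def Ln_of_real[symmetric] del: Ln_of_real)
  obtain n m :: int where n: "Re w * ln 2 = 0" "Im w * ln 2 = of_int (2 * n) * pi"
    and m: "Im w * ln 3 = of_int (2 * m) * pi"
    using e2 e3 unfolding exp_eq_1 by auto
  have "Re w = 0" using n(1) by simp
  hence I: "Im w \<noteq> 0" using w by (simp add: complex_eq_iff)
  have n0: "n \<noteq> 0" and m0: "m \<noteq> 0" using n(2) m I by auto
  have "Im w * (of_int m * ln 2) = Im w * (of_int n * ln 3)"
  proof -
    have "Im w * (of_int m * ln 2) = of_int m * (Im w * ln 2)" by (simp add: mult_ac)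
    also have "\<dots> = of_int n * (Im w * ln 3)" unfolding n(2) m by simp
    finally show ?thesis by (simp add: mult_ac)
  qed
  hence "of_int m * ln 2 = of_int n * ln (3::real)" using I by simp
  hence "\<bar>of_int m * ln 2\<bar> = \<bar>of_int n * ln (3::real)\<bar>" by simp
  hence "real (nat \<bar>m\<bar>) * ln 2 = real (nat \<bar>n\<bar>) * ln 3" by (simp add: abs_mult)
  hence "ln ((2::real) ^ nat \<bar>m\<bar>) = ln ((3::real) ^ nat \<bar>n\<bar>)" by (simp add: ln_realpow)
  hence "(2::real) ^ nat \<bar>m\<bar> = 3 ^ nat \<bar>n\<bar>" by simp
  hence "real (2 ^ nat \<bar>m\<bar>) = real (3 ^ nat \<bar>n\<bar>)" by simp
  hence "(2::nat) ^ nat \<bar>m\<bar> = 3 ^ nat \<bar>n\<bar>" by (simp only: of_nat_eq_iff)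
  moreover have "even ((2::nat) ^ nat \<bar>m\<bar>)" using m0 by simp
  moreover have "odd ((3::nat) ^ nat \<bar>n\<bar>)" by simp
  ultimately show False by simp
qed

text \<open>A nonzero mean is removed by the factor \<open>1 - p\<^sup>1\<^sup>-\<^sup>z\<close>; as the factors for \<open>p = 2\<close> and \<open>p = 3\<close> have only the zero
  \<open>z = 1\<close> in common, dividing by one of them costs at most the pole at \<open>1\<close>.\<close>

lemma periodic_series_dilate:
  fixes b :: "nat \<Rightarrow> complex"
  assumes q: "q \<ge> 1" and per: "\<And>n. b (n + q) = b n" and p: "p \<ge> 2"
    and L: "\<And>z. Re z > 1 \<Longrightarrow> (\<lambda>n. b n / of_nat (Suc n) powr z) sums L z"
  shows "\<exists>F. F holomorphic_on UNIV \<and> (\<forall>z. Re z > 1 \<longrightarrow> F z = (1 - of_nat p powr (1 - z)) * L z)"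
proof -
  \<comment> \<open>Index \<open>n\<close> belongs to the integer \<open>Suc n\<close>, so
    \<open>h j\<close> is the index of \<open>p * Suc j\<close>. The weight \<open>p\<close> in
    \<open>g\<close> gives \<open>b\<close> and \<open>g\<close> equal sums over the common period
    \<open>p * q\<close>, so that their difference has mean zero.\<close>
  define h where "h = (\<lambda>j. p * Suc j - 1)"
  define g where "g = (\<lambda>n. if p dvd Suc n then of_nat p * b (Suc n div p - 1) else 0)"
  have Sh: "Suc (h j) = p * Suc j" for j using p by (simp add: h_def)
  have gh: "g (h j) = of_nat p * b j" for j using p by (simp add: g_def Sh del: mult_Suc_right)
  have smh: "strict_mono h"
    by (rule strict_monoI) (metis Sh Suc_less_eq mult_less_mono2 less_le_trans p pos2)
  have notin: "g n = 0" if "n \<notin> range h" for n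
  proof (rule ccontr)
    assume "g n \<noteq> 0"
    then obtain i where i: "Suc n = p * i" by (auto simp: g_def split: if_splits elim: dvdE)
    then obtain j where "i = Suc j" by (cases i) auto
    hence "Suc n = Suc (h j)" using i Sh by simp
    thus False using that by auto
  qed
  have gper: "g (n + p * q) = g n" for n
  proof (cases "p dvd Suc n")
    case True
    then obtain i where i: "Suc n = p * i" by (elim dvdE)
    then obtain j where j: "i = Suc j" by (cases i) auto
    have 1: "n = h j" using i j Sh[of j] by simp
    have "Suc (n + p * q) = Suc (h (j + q))" unfolding Sh using i j by (simp add: algebra_simps)
    hence 2: "n + p * q = h (j + q)" by simp
    show ?thesis unfolding 2 unfolding 1 gh using per by simp
  next
    case False
    hence "\<not> p dvd Suc n + p * q" by (subst dvd_add_left_iff) auto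
    thus ?thesis using False by (simp add: g_def)
  qed
  have bper: "b (n + p * q) = b n" for n
  proof -
    have "b (n + k * q) = b n" for k
      by (induction k) (use per[of "n + _ * q"] in \<open>simp_all add: algebra_simps\<close>)
    thus ?thesis .
  qed
  have sumb: "(\<Sum>n<k * q. b n) = of_nat k * (\<Sum>n<q. b n)" for k
  proof (induction k)
    case (Suc k)
    have "(\<Sum>n<Suc k * q. b n) = (\<Sum>n<k * q. b n) + (\<Sum>n<q. b (k * q + n))"
      using sum.nat_group[of b] sum.atLeastLessThan_concat[of 0 "k * q" "Suc k * q" b]
        sum.shift_bounds_nat_ivl[of b 0 "k * q" q]
      by (simp add: lessThan_atLeast0 add.commute)
    also have "(\<Sum>n<q. b (k * q + n)) = (\<Sum>n<q. b n)"
    proof (intro sum.cong refl)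
      fix n show "b (k * q + n) = b n"
        by (induction k) (use per[of "_ * q + n"] in \<open>simp_all add: algebra_simps\<close>)
    qed
    finally show ?case using Suc.IH by (simp add: algebra_simps)
  qed simp
  have sumg: "(\<Sum>n<p * q. g n) = of_nat p * (\<Sum>n<q. b n)"
  proof -
    have "(\<Sum>n<p * q. g n) = (\<Sum>n\<in>h ` {..<q}. g n)"
    proof (rule sum.mono_neutral_right)
      show "h ` {..<q} \<subseteq> {..<p * q}"
      proof safe
        fix j assume "j < q"
        hence "p * Suc j \<le> p * q" by (intro mult_le_mono2) simp
        thus "h j < p * q" using Sh[of j] by linarith
      qed
      show "\<forall>n\<in>{..<p * q} - h ` {..<q}. g n = 0"
      proof
        fix n assume n: "n \<in> {..<p * q} - h ` {..<q}"
        show "g n = 0"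
        proof (rule notin, rule notI)
          assume "n \<in> range h"
          then obtain j where j: "n = h j" by auto
          have "Suc (h j) \<le> p * q" using n j by simp
          hence "p * Suc j \<le> p * q" unfolding Sh .
          hence "j < q" using p by (simp del: mult_Suc_right)
          thus False using n j by auto
        qed
      qed
    qed simp
    also have "\<dots> = (\<Sum>j<q. g (h j))"
      by (rule sum.reindex_cong[of h]) (use smh in \<open>auto intro: strict_mono_imp_inj_on inj_on_subset\<close>)
    finally show ?thesis by (simp add: gh sum_distrib_left)
  qed
  have "\<exists>F. F holomorphic_on UNIV \<and>
    (\<forall>z. Re z > 1 \<longrightarrow> (\<lambda>n. (b n - g n) / of_nat (Suc n) powr z) sums F z)"
    by (rule periodic_series_entire[of "p * q"])
       (use p q bper gper sumb[of p] sumg in \<open>auto simp: sum_subtractf\<close>)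
  then obtain F where F: "F holomorphic_on UNIV"
    "\<And>z. Re z > 1 \<Longrightarrow> (\<lambda>n. (b n - g n) / of_nat (Suc n) powr z) sums F z" by blast
  have "F z = (1 - of_nat p powr (1 - z)) * L z" if z: "Re z > 1" for z
  proof -
    have "(\<lambda>j. of_nat p powr (1 - z) * (b j / of_nat (Suc j) powr z)) sums (of_nat p powr (1 - z) * L z)"
      by (intro sums_mult L z)
    also have "(\<lambda>j. of_nat p powr (1 - z) * (b j / of_nat (Suc j) powr z))
        = (\<lambda>j. g (h j) / of_nat (Suc (h j)) powr z)"
    proof
      fix j
      have "of_nat (Suc (h j)) powr z = of_nat p powr z * of_nat (Suc j) powr z"
        unfolding Sh of_nat_mult by (rule powr_times_real) auto
      thus "of_nat p powr (1 - z) * (b j / of_nat (Suc j) powr z) = g (h j) / of_nat (Suc (h j)) powr z"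
        using p by (simp add: gh powr_diff)
    qed
    finally have "(\<lambda>n. g n / of_nat (Suc n) powr z) sums (of_nat p powr (1 - z) * L z)"
      by (subst (asm) sums_mono_reindex[OF smh]) (use notin in auto)
    from sums_diff[OF L[OF z] this]
    have "(\<lambda>n. (b n - g n) / of_nat (Suc n) powr z) sums (L z - of_nat p powr (1 - z) * L z)"
      by (simp add: diff_divide_distrib)
    from sums_unique2[OF F(2)[OF z] this] show ?thesis by (simp add: algebra_simps)
  qed
  thus ?thesis using F(1) by blast
qed

lemma periodic_series_continuation:
  fixes b :: "nat \<Rightarrow> complex"
  assumes q: "q \<ge> 1" and per: "\<And>n. b (n + q) = b n"
  shows "\<exists>f. f holomorphic_on - {1} \<and> (\<forall>z. Re z > 1 \<longrightarrow> (\<lambda>n. b n / of_nat (Suc n) powr z) sums f z)"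
proof -
  obtain L where L: "\<And>z. Re z > 1 \<Longrightarrow> (\<lambda>n. b n / of_nat (Suc n) powr z) sums L z"
    using powr_diff_series_base[of q b 0] q per by (auto simp: powr_minus divide_inverse)
  obtain F where F: "F holomorphic_on UNIV" "\<And>z. Re z > 1 \<Longrightarrow> F z = (1 - 2 powr (1 - z)) * L z"
    using periodic_series_dilate[of q b 2 L] q per L by auto
  obtain G where G: "G holomorphic_on UNIV" "\<And>z. Re z > 1 \<Longrightarrow> G z = (1 - 3 powr (1 - z)) * L z"
    using periodic_series_dilate[of q b 3 L] q per L by auto
  \<comment> \<open>For \<open>Re z > 1\<close> both sides are the product of \<open>L z\<close>
    with the two factors. Hence the two quotients that are patched together below agree wherever
    both are defined.\<close>
  have FG: "F z * (1 - 3 powr (1 - z)) = G z * (1 - 2 powr (1 - z))" for z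
  proof (rule analytic_continuation_open[where f = "\<lambda>z. F z * (1 - 3 powr (1 - z))"
        and g = "\<lambda>z. G z * (1 - 2 powr (1 - z))" and z = z and s = "{z. Re z > 1}" and s' = UNIV])
    show "{z. Re z > 1} \<noteq> {}" by (rule ex_in_conv[THEN iffD1], rule exI[of _ 2]) simp
    show "F w * (1 - 3 powr (1 - w)) = G w * (1 - 2 powr (1 - w))" if "w \<in> {z. Re z > 1}" for w
    proof -
      have w: "Re w > 1" using that by simp
      show ?thesis unfolding F(2)[OF w] G(2)[OF w] by (simp add: mult_ac)
    qed
  qed (use F(1) G(1) in \<open>auto intro!: holomorphic_intros simp: open_halfspace_Re_gt\<close>)
  define f where "f = (\<lambda>z. if 2 powr (1 - z) \<noteq> 1 then F z / (1 - 2 powr (1 - z)) else G z / (1 - 3 powr (1 - z)))"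
  have ne: "2 powr (1 - z) \<noteq> 1 \<or> 3 powr (1 - z) \<noteq> 1" if "z \<noteq> 1" for z :: complex
    using powr_two_three_eq_1[of "1 - z"] that by auto
  have f3: "f z = G z / (1 - 3 powr (1 - z))" if "3 powr (1 - z) \<noteq> 1" for z
    using FG[of z] that by (auto simp: f_def divide_simps)
  define S2 where "S2 = {z :: complex. 2 powr (1 - z) \<noteq> 1}"
  define S3 where "S3 = {z :: complex. 3 powr (1 - z) \<noteq> 1}"
  have op: "open {z :: complex. w powr (1 - z) \<noteq> 1}" if "w \<noteq> 0" for w :: complex
  proof -
    have "(\<lambda>z. w powr (1 - z)) holomorphic_on UNIV" using that by (intro holomorphic_intros)
    hence "continuous_on UNIV (\<lambda>z. w powr (1 - z))" by (rule holomorphic_on_imp_continuous_on)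
    thus ?thesis by (intro open_Collect_neq) auto
  qed
  have "(\<lambda>z. F z / (1 - 2 powr (1 - z))) holomorphic_on S2"
    using holomorphic_on_subset[OF F(1)] by (intro holomorphic_intros) (auto simp: S2_def)
  hence h2: "f holomorphic_on S2"
    by (rule holomorphic_transform) (auto simp: f_def S2_def)
  have "(\<lambda>z. G z / (1 - 3 powr (1 - z))) holomorphic_on S3"
    using holomorphic_on_subset[OF G(1)] by (intro holomorphic_intros) (auto simp: S3_def)
  hence h3: "f holomorphic_on S3"
    by (rule holomorphic_transform) (use f3 in \<open>auto simp: S3_def\<close>)
  have "f holomorphic_on (S2 \<union> S3)"
    by (rule holomorphic_on_Un[OF h2 h3]) (auto simp: S2_def S3_def intro!: op)
  hence "f holomorphic_on - {1}"
    by (rule holomorphic_on_subset) (use ne in \<open>auto simp: S2_def S3_def\<close>)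
  moreover have "f z = L z" if "Re z > 1" for z
  proof -
    have "z \<noteq> 1" using that by auto
    thus ?thesis using ne[of z] F(2)[OF that] G(2)[OF that] by (auto simp: f_def)
  qed
  ultimately show ?thesis using L by (intro exI[of _ f]) auto
qed

text \<open>The subtracted quotient is the mean of x^(-z) over the interval from \<open>al\<close>
  to \<open>be\<close>. The function varies by at most the right-hand side over this interval, so no
  value differs from the mean by more.\<close>

lemma powr_block_mean_bound:
  fixes z :: complex
  assumes z: "z \<noteq> 1" "Re z > 0" and al: "0 < al" "al \<le> y" "y \<le> be" "al < be"
  shows "norm (of_real y powr (- z) - (of_real be powr (1 - z) - of_real al powr (1 - z)) / (1 - z) / of_real (be - al))
    \<le> norm z * (be - al) * al powr (- Re z - 1)"
proof -
  define B where "B = norm z * (be - al) * al powr (- Re z - 1)"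
  have nnR: "complex_of_real x \<notin> \<real>\<^sub>\<le>\<^sub>0" if "x \<ge> al" for x
    using that al by (auto simp: complex_nonpos_Reals_iff)
  have diff: "norm (complex_of_real x powr (- z) - of_real y powr (- z)) \<le> B" if x: "al \<le> x" "x \<le> be" for x
  proof -
    let ?S = "closed_segment (complex_of_real al) (of_real be)"
    have seg: "complex_of_real u \<in> ?S" if "al \<le> u" "u \<le> be" for u
      using that al by (simp add: closed_segment_of_real closed_segment_eq_real_ivl)
    have "norm (complex_of_real x powr (- z) - of_real y powr (- z))
        \<le> norm z * al powr (- Re z - 1) * norm (complex_of_real x - of_real y)"
    proof (rule field_differentiable_bound[where S = ?S])
      show "((\<lambda>w. w powr (- z)) has_field_derivative (- z * w powr (- z - 1))) (at w within ?S)"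
        if w: "w \<in> ?S" for w
      proof -
        have "w \<notin> \<real>\<^sub>\<le>\<^sub>0" using in_closed_segment_of_real[OF w] al nnR by auto
        thus ?thesis by (intro has_field_derivative_at_within[OF has_field_derivative_powr])
      qed
      show "norm (- z * w powr (- z - 1)) \<le> norm z * al powr (- Re z - 1)" if w: "w \<in> ?S" for w
      proof -
        obtain u where u: "w = of_real u" "al \<le> u" using in_closed_segment_of_real[OF w] al by auto
        have "norm (w powr (- z - 1)) = u powr (- Re z - 1)"
          using u al by (simp add: norm_powr_real_powr)
        also have "\<dots> \<le> al powr (- Re z - 1)" using u al z by (intro powr_mono2') auto
        finally show ?thesis by (simp add: norm_mult mult_left_mono)
      qed
    qed (use x al seg in auto)
    also have "norm (complex_of_real x - of_real y) = \<bar>x - y\<bar>" by (metis norm_of_real of_real_diff)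
    also have "norm z * al powr (- Re z - 1) * \<bar>x - y\<bar> \<le> norm z * al powr (- Re z - 1) * (be - al)"
      using x al by (intro mult_left_mono) auto
    finally show ?thesis by (simp add: B_def mult_ac)
  qed
  \<comment> \<open>An antiderivative of the deviation
    \<open>w powr (- z) - of_real y powr (- z)\<close>. The mean value inequality for it takes the
    place of integrating the deviation.\<close>
  let ?G = "\<lambda>w::complex. w powr (1 - z) / (1 - z) - w * of_real y powr (- z)"
  let ?S = "closed_segment (complex_of_real al) (of_real be)"
  have "norm (?G (of_real be) - ?G (of_real al)) \<le> B * norm (complex_of_real be - of_real al)"
  proof (rule field_differentiable_bound[where S = ?S])
    show "(?G has_field_derivative (w powr (- z) - of_real y powr (- z))) (at w within ?S)"
      if w: "w \<in> ?S" for w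
    proof -
      obtain u where u: "w = of_real u" "al \<le> u" using in_closed_segment_of_real[OF w] al by auto
      have "w \<notin> \<real>\<^sub>\<le>\<^sub>0" using u nnR by simp
      from has_field_derivative_powr[OF this, of "1 - z"]
      have "((\<lambda>w. w powr (1 - z)) has_field_derivative (1 - z) * w powr (- z)) (at w)" by simp
      hence "(?G has_field_derivative (1 - z) * w powr (- z) / (1 - z) - 1 * of_real y powr (- z)) (at w)"
        by (rule DERIV_diff[OF DERIV_cdivide DERIV_cmult_right[OF DERIV_ident]])
      moreover have "(1 - z) * w powr (- z) / (1 - z) - 1 * of_real y powr (- z)
          = w powr (- z) - of_real y powr (- z)" using z by simp
      ultimately show ?thesis by (metis has_field_derivative_at_within)
    qed
    show "norm (w powr (- z) - of_real y powr (- z)) \<le> B" if w: "w \<in> ?S" for w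
      using in_closed_segment_of_real[OF w] al diff by auto
  qed auto
  also have "norm (complex_of_real be - of_real al) = be - al"
    using al by (metis abs_of_pos diff_gt_0_iff_gt norm_of_real of_real_diff)
  finally have "norm (?G (of_real be) - ?G (of_real al)) / (be - al) \<le> B"
    using al by (simp add: field_simps)
  moreover have "?G (of_real be) - ?G (of_real al) = - of_real (be - al) *
     (of_real y powr (- z) - (of_real be powr (1 - z) - of_real al powr (1 - z)) / (1 - z) / of_real (be - al))"
  proof -
    have "X - l * Y = - l * (Y - X / l)" if "l \<noteq> 0" for X Y l :: complex
      using that by (simp add: algebra_simps)
    from this[of "of_real (be - al)" "(of_real be powr (1 - z) - of_real al powr (1 - z)) / (1 - z)"
        "of_real y powr (- z)"]
    show ?thesis using al by (simp add: diff_divide_distrib algebra_simps)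
  qed
  hence "norm (?G (of_real be) - ?G (of_real al)) / (be - al) =
     norm (of_real y powr (- z) - (of_real be powr (1 - z) - of_real al powr (1 - z)) / (1 - z) / of_real (be - al))"
    using al by (simp only: norm_mult norm_minus_cancel norm_of_real) simp
  ultimately show ?thesis unfolding B_def by simp
qed

text \<open>A telescoping majorant, which sums the block errors of
  \<open>periodic_partial_sum_approx\<close> explicitly.\<close>

lemma powr_three_half_le:
  assumes "j \<ge> 2"
  shows "real j powr (- (3/2)) \<le> 2 * (1 / sqrt (real (j - 1)) - 1 / sqrt (real j))"
proof -
  define x where "x = real (j - 1)"
  have x: "x > 0" "real j = x + 1" using assms by (auto simp: x_def)
  have s: "sqrt x > 0" "sqrt (x + 1) > 0" "sqrt x \<le> sqrt (x + 1)" using x by auto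
  have "(sqrt (x + 1) - sqrt x) * (sqrt (x + 1) + sqrt x) = 1" using x by (simp add: algebra_simps)
  moreover have "sqrt (x + 1) + sqrt x \<noteq> 0" using s by linarith
  ultimately have d: "sqrt (x + 1) - sqrt x = 1 / (sqrt (x + 1) + sqrt x)"
    by (rule nonzero_eq_divide_eq[THEN iffD2, rotated])
  have "real j powr (- (3/2)) = 1 / (sqrt (x + 1) * (x + 1))"
  proof -
    have "(x + 1) powr (3/2) = (x + 1) powr (1/2 + 1)" by simp
    also have "\<dots> = sqrt (x + 1) * (x + 1)" using x by (subst powr_add) (simp add: powr_half_sqrt)
    finally show ?thesis by (simp only: x(2) powr_minus inverse_eq_divide)
  qed
  also have "\<dots> = 2 * (1 / (sqrt (x + 1) + sqrt (x + 1))) / (sqrt (x + 1) * sqrt (x + 1))"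
    using x by simp
  also have "\<dots> \<le> 2 * (1 / (sqrt (x + 1) + sqrt x)) / (sqrt x * sqrt (x + 1))"
  proof (rule frac_le)
    have "1 / (sqrt (x + 1) + sqrt (x + 1)) \<le> 1 / (sqrt (x + 1) + sqrt x)"
      using s by (intro frac_le add_pos_pos) auto
    thus "2 * (1 / (sqrt (x + 1) + sqrt (x + 1))) \<le> 2 * (1 / (sqrt (x + 1) + sqrt x))"
      by (rule mult_left_mono) simp
    show "sqrt x * sqrt (x + 1) \<le> sqrt (x + 1) * sqrt (x + 1)" using s by (intro mult_right_mono) auto
  qed (use s in auto)
  also have "\<dots> = 2 * (1 / sqrt x - 1 / sqrt (x + 1))"
  proof -
    have "2 * (a - b) / (b * a) = 2 * (1 / b - 1 / a)" if "a > 0" "b > 0" for a b :: real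
      using that by (simp add: field_simps)
    thus ?thesis unfolding d [symmetric] using s by blast
  qed
  finally show ?thesis by (simp only: x(2) x_def [symmetric])
qed

text \<open>Each block of one period is compared with the integral of \<open>c x\<^sup>-\<^sup>z\<close>; the \<open>j\<close>-th difference is
  \<open>O(j\<^bsup>-1 - Re z\<^esup>)\<close>, so that the corrected partial sums converge to the continuation for \<open>Re z > 0\<close>.\<close>

lemma periodic_partial_sum_approx:
  fixes a :: "nat \<Rightarrow> complex" and f :: "complex \<Rightarrow> complex"
  assumes q: "q \<ge> 1" and per: "\<And>n. a (n + q) = a n" and a1: "\<And>n. norm (a n) \<le> 1"
    and f: "f holomorphic_on - {1}"
      "\<And>z. Re z > 1 \<Longrightarrow> (\<lambda>n. a (Suc n) / of_nat (Suc n) powr z) sums f z"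
    and s: "Re s = 1/2" and m: "m \<ge> 2"
  defines "c \<equiv> (\<Sum>n=1..q. a n) / of_nat q"
  shows "norm (f s - ((\<Sum>n=1..q * m. a n * of_nat n powr (- s)) - c * of_nat (q * m) powr (1 - s) / (1 - s)))
    \<le> 2 * norm s * sqrt (real q) / sqrt (real (m - 1))"
proof -
  define A where "A = (\<lambda>j z. (\<Sum>n=q * j + 1..q * j + q. a n * of_nat n powr (- z))
     - c * (of_nat (q * j + q) powr (1 - z) - of_nat (q * j) powr (1 - z)) / (1 - z))"
  define S where "S = (\<lambda>m z. (\<Sum>n=1..q * m. a n * of_nat n powr (- z)) - c * of_nat (q * m) powr (1 - z) / (1 - z))"
  have SA: "S (Suc j) z = S j z + A j z" for j z
  proof -
    have "{1..q * Suc j} = {1..q * j} \<union> {q * j + 1..q * j + q}" using q by auto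
    hence "(\<Sum>n=1..q * Suc j. a n * of_nat n powr (- z))
      = (\<Sum>n=1..q * j. a n * of_nat n powr (- z)) + (\<Sum>n=q * j + 1..q * j + q. a n * of_nat n powr (- z))"
      by (simp only:) (rule sum.union_disjoint, auto)
    thus ?thesis by (simp add: S_def A_def algebra_simps diff_divide_distrib)
  qed
  have csum: "(\<Sum>n=q * j + 1..q * j + q. a n) = c * of_nat q" for j
  proof (induction j)
    case 0
    show ?case using q by (simp add: c_def)
  next
    case (Suc j)
    have "(\<Sum>n=q * Suc j + 1..q * Suc j + q. a n) = (\<Sum>n=q * j + 1..q * j + q. a (n + q))"
      by (rule sum.reindex_bij_witness[of _ "\<lambda>n. n + q" "\<lambda>n. n - q"]) (auto simp: algebra_simps)
    thus ?case using Suc.IH by (simp add: per)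
  qed
  have Abd: "norm (A j z) \<le> real q * (norm z * real q * real (q * j) powr (- Re z - 1))"
    if z: "z \<noteq> 1" "Re z > 0" and j: "j \<ge> 1" for j z
  proof -
    let ?D = "(of_nat (q * j + q) powr (1 - z) - of_nat (q * j) powr (1 - z)) / (1 - z) / of_nat q :: complex"
    have "A j z = (\<Sum>n=q * j + 1..q * j + q. a n * (of_nat n powr (- z) - ?D))"
    proof -
      have "(\<Sum>n=q * j + 1..q * j + q. a n * (of_nat n powr (- z) - ?D))
        = (\<Sum>n=q * j + 1..q * j + q. a n * of_nat n powr (- z)) - (\<Sum>n=q * j + 1..q * j + q. a n) * ?D"
        by (simp only: right_diff_distrib sum_subtractf sum_distrib_right)
      also have "(\<Sum>n=q * j + 1..q * j + q. a n) * ?D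
        = c * (of_nat (q * j + q) powr (1 - z) - of_nat (q * j) powr (1 - z)) / (1 - z)"
        unfolding csum using q by simp
      finally show ?thesis by (simp add: A_def)
    qed
    also have "norm \<dots> \<le> (\<Sum>n=q * j + 1..q * j + q. norm z * real q * real (q * j) powr (- Re z - 1))"
    proof (rule order_trans[OF norm_sum], rule sum_mono)
      fix n assume n: "n \<in> {q * j + 1..q * j + q}"
      have nn: "real (q * j) \<le> real n" "real n \<le> real (q * j + q)" using n by (simp_all only: of_nat_le_iff) auto
      have "norm (of_real (real n) powr (- z) - (of_real (real (q * j + q)) powr (1 - z)
           - of_real (real (q * j)) powr (1 - z)) / (1 - z) / of_real (real (q * j + q) - real (q * j)))
        \<le> norm z * (real (q * j + q) - real (q * j)) * real (q * j) powr (- Re z - 1)"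
        using q j nn by (intro powr_block_mean_bound z) auto
      also have "real (q * j + q) - real (q * j) = real q" by simp
      finally have D: "norm (of_nat n powr (- z) - ?D) \<le> norm z * real q * real (q * j) powr (- Re z - 1)"
        by (simp only: of_real_of_nat_eq)
      show "norm (a n * (of_nat n powr (- z) - ?D)) \<le> norm z * real q * real (q * j) powr (- Re z - 1)"
        unfolding norm_mult using mult_mono[OF a1[of n] D] by simp
    qed
    also have "\<dots> = real q * (norm z * real q * real (q * j) powr (- Re z - 1))" by simp
    finally show ?thesis .
  qed
  define U where "U = {z :: complex. Re z > 0} - {1}"
  have opU: "open U" unfolding U_def by (intro open_Diff open_halfspace_Re_gt) simp
  have conU: "connected U" unfolding U_def
    by (intro connected_open_diff_countable open_halfspace_Re_gt convex_connected convex_halfspace_Re_gt) auto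
  have Ahol: "A j holomorphic_on U" for j
    unfolding A_def U_def using q by (intro holomorphic_intros) auto
  have bd: "\<exists>d>0. \<exists>M. cball z d \<subseteq> U \<and> summable M \<and> (\<forall>j. \<forall>w\<in>cball z d. norm (A (Suc j) w) \<le> M j)"
    if z: "z \<in> U" for z
  proof -
    obtain d0 where d0: "d0 > 0" "cball z d0 \<subseteq> U" using opU z open_contains_cball by metis
    define d where "d = min d0 (Re z / 2)"
    have d: "d > 0" "cball z d \<subseteq> U" using d0 z by (auto simp: d_def U_def)
    define M where "M = (\<lambda>j. real q * ((norm z + d) * real q * real (Suc j) powr (- (Re z / 2 + 1))))"
    have "summable M" unfolding M_def
      by (intro summable_mult summable_Suc_powr) (use z in \<open>simp add: U_def\<close>)
    moreover have "norm (A (Suc j) w) \<le> M j" if w: "w \<in> cball z d" for j w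
    proof -
      have wU: "w \<noteq> 1" "Re w > 0" using w d(2) by (auto simp: U_def)
      have nw: "norm w \<le> norm z + d"
        using w norm_triangle_sub[of w z] by (simp add: dist_norm norm_minus_commute)
      have "\<bar>Re (z - w)\<bar> \<le> d" using w abs_Re_le_cmod[of "z - w"] by (simp add: dist_norm)
      hence "Re z - Re w \<le> d" by simp
      moreover have "d \<le> Re z / 2" by (simp add: d_def)
      ultimately have Re: "Re w \<ge> Re z / 2" by linarith
      have "norm (A (Suc j) w) \<le> real q * (norm w * real q * real (q * Suc j) powr (- Re w - 1))"
        using wU by (intro Abd) auto
      also have "\<dots> \<le> M j" unfolding M_def
      proof (intro mult_left_mono mult_mono)
        have "real (q * Suc j) powr (- Re w - 1) \<le> real (q * Suc j) powr (- (Re z / 2 + 1))"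
          using Re q by (intro powr_mono) (auto simp: Suc_le_eq simp del: mult_Suc_right of_nat_mult)
        also have "\<dots> \<le> real (Suc j) powr (- (Re z / 2 + 1))"
        proof (rule powr_mono2')
          have "Suc j \<le> q * Suc j" using mult_le_mono1[of 1 q "Suc j"] q by (simp only: mult_1)
          thus "real (Suc j) \<le> real (q * Suc j)" by (simp only: of_nat_le_iff)
        qed (use z in \<open>auto simp: U_def\<close>)
        finally show "real (q * Suc j) powr (- Re w - 1) \<le> real (Suc j) powr (- (Re z / 2 + 1))" .
      qed (use nw d in auto)
      finally show ?thesis .
    qed
    ultimately show ?thesis using d by blast
  qed
  have sums1: "(\<lambda>z. \<Sum>j. A (Suc j) z) holomorphic_on U"
    by (rule holomorphic_on_suminf(1)[OF opU Ahol bd])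
  have sums2: "summable (\<lambda>j. A (Suc j) z)" if "z \<in> U" for z
    by (rule holomorphic_on_suminf(2)[OF opU Ahol bd that])
  \<comment> \<open>The series starts with block 1, as \<open>Abd\<close> covers only blocks with
    positive index; block 0 enters through \<open>S 1\<close>.\<close>
  define E where "E = (\<lambda>z. S 1 z + (\<Sum>j. A (Suc j) z))"
  have Ehol: "E holomorphic_on U"
    unfolding E_def S_def using sums1 q by (intro holomorphic_intros) (auto simp: U_def)
  have S_sum: "S (Suc N) z = S 1 z + (\<Sum>j<N. A (Suc j) z)" for N z
    by (induction N) (simp, simp only: SA[of "Suc _"] sum.lessThan_Suc add.assoc)
  have Elim: "(\<lambda>N. S (Suc N) z) \<longlonglongrightarrow> E z" if "z \<in> U" for z
    unfolding S_sum E_def using summable_LIMSEQ[OF sums2[OF that]] by (intro tendsto_intros)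
  have Ef: "E z = f z" if z: "Re z > 1" for z
  proof -
    have "(\<lambda>N. \<Sum>n<N. a (Suc n) / of_nat (Suc n) powr z) \<longlonglongrightarrow> f z" using f(2)[OF z] by (simp add: sums_def)
    moreover have "filterlim (\<lambda>N. q * Suc N) at_top sequentially"
      using q by (intro filterlim_subseq) (auto simp: strict_mono_def)
    ultimately have "(\<lambda>N. \<Sum>n<q * Suc N. a (Suc n) / of_nat (Suc n) powr z) \<longlonglongrightarrow> f z"
      by (rule filterlim_compose)
    also have "(\<lambda>N. \<Sum>n<q * Suc N. a (Suc n) / of_nat (Suc n) powr z)
       = (\<lambda>N. \<Sum>n=1..q * Suc N. a n * of_nat n powr (- z))"
    proof
      fix N show "(\<Sum>n<q * Suc N. a (Suc n) / of_nat (Suc n) powr z) = (\<Sum>n=1..q * Suc N. a n * of_nat n powr (- z))"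
        by (rule sum.reindex_bij_witness[of _ "\<lambda>n. n - 1" Suc])
           (auto simp: powr_minus divide_inverse simp del: mult_Suc_right)
    qed
    finally have 1: "(\<lambda>N. \<Sum>n=1..q * Suc N. a n * of_nat n powr (- z)) \<longlonglongrightarrow> f z" .
    \<comment> \<open>The main term vanishes in the limit for \<open>Re z > 1\<close>. So
      \<open>E\<close> coincides with \<open>f\<close> there, and by the identity theorem on all of
      \<open>U\<close>.\<close>
    have 2: "(\<lambda>N. of_nat (q * Suc N) powr (1 - z)) \<longlonglongrightarrow> (0 :: complex)"
    proof (rule tendsto_norm_zero_cancel)
      have "filterlim (\<lambda>N. q * Suc N) at_top sequentially"
        using q by (intro filterlim_subseq) (auto simp: strict_mono_def)
      hence "filterlim (\<lambda>N. real (q * Suc N)) at_top sequentially"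
        by (rule filterlim_compose[OF filterlim_real_sequentially])
      hence "(\<lambda>N. real (q * Suc N) powr (1 - Re z)) \<longlonglongrightarrow> 0"
        using z by (intro tendsto_neg_powr) auto
      thus "(\<lambda>N. norm (of_nat (q * Suc N) powr (1 - z) :: complex)) \<longlonglongrightarrow> 0"
        by (simp add: norm_powr_real_powr del: mult_Suc_right of_nat_mult)
    qed
    have "(\<lambda>N. S (Suc N) z) \<longlonglongrightarrow> f z - c * 0 / (1 - z)"
      unfolding S_def using z by (intro tendsto_intros 1 2) auto
    moreover have "z \<in> U" using z by (auto simp: U_def)
    ultimately show ?thesis using Elim[of z] LIMSEQ_unique by fastforce
  qed
  have sU: "s \<in> U" using s by (auto simp: U_def)
  have "E s = f s"
  proof (rule analytic_continuation_open[where f = E and g = f and z = s and s = "{z. Re z > 1}" and s' = U])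
    show "{z. Re z > 1} \<noteq> {}" by (rule ex_in_conv[THEN iffD1], rule exI[of _ 2]) simp
    show "f holomorphic_on U" by (rule holomorphic_on_subset[OF f(1)]) (auto simp: U_def)
  qed (use opU conU Ehol sU Ef in \<open>auto simp: open_halfspace_Re_gt U_def\<close>)
  define B where "B = norm s * sqrt (real q)"
  have As: "norm (A j s) \<le> 2 * B * (1 / sqrt (real (j - 1)) - 1 / sqrt (real j))" if j: "j \<ge> 2" for j
  proof -
    have "norm (A j s) \<le> real q * (norm s * real q * real (q * j) powr (- Re s - 1))"
      using sU j by (intro Abd) (auto simp: U_def)
    also have "real (q * j) powr (- Re s - 1) = real q powr (- (3/2)) * real j powr (- (3/2))"
      unfolding s by (simp add: powr_mult)
    also have "real q powr (- (3/2)) = sqrt (real q) / (real q * real q)"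
    proof -
      have "real q powr (- (3/2)) = real q powr (1/2 - 2)" by simp
      also have "\<dots> = real q powr (1/2) / real q powr 2" by (rule powr_diff)
      finally show ?thesis using q by (simp add: powr_half_sqrt power2_eq_square flip: powr_realpow)
    qed
    also have "real q * (norm s * real q * (sqrt (real q) / (real q * real q) * real j powr (- (3/2))))
       = B * real j powr (- (3/2))" using q by (simp add: B_def)
    also have "\<dots> \<le> B * (2 * (1 / sqrt (real (j - 1)) - 1 / sqrt (real j)))"
      by (intro mult_left_mono powr_three_half_le j) (simp add: B_def)
    finally show ?thesis by (simp only: mult_ac)
  qed
  have diff: "norm (S (m + k) s - S m s) \<le> 2 * B * (1 / sqrt (real (m - 1)) - 1 / sqrt (real (m + k - 1)))" for k
  proof (induction k)
    case (Suc k)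
    have "S (m + Suc k) s - S m s = (S (m + k) s - S m s) + A (m + k) s" by (simp add: SA)
    also have "norm \<dots> \<le> norm (S (m + k) s - S m s) + norm (A (m + k) s)" by (rule norm_triangle_ineq)
    finally show ?case using Suc.IH As[of "m + k"] m by (simp add: algebra_simps)
  qed simp
  have "norm (E s - S m s) \<le> 2 * B / sqrt (real (m - 1))"
  proof (rule LIMSEQ_le_const2)
    have "(\<lambda>N. S (Suc (N + (m - 1))) s) \<longlonglongrightarrow> E s"
      using LIMSEQ_ignore_initial_segment[OF Elim[OF sU]] .
    also have "(\<lambda>N. S (Suc (N + (m - 1))) s) = (\<lambda>N. S (m + N) s)" using m by (intro ext) (simp add: add.commute)
    finally show "(\<lambda>N. norm (S (m + N) s - S m s)) \<longlonglongrightarrow> norm (E s - S m s)" by (intro tendsto_intros)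
    show "\<exists>N. \<forall>n\<ge>N. norm (S (m + n) s - S m s) \<le> 2 * B / sqrt (real (m - 1))"
    proof (intro exI allI impI)
      fix n
      have "B \<ge> 0" by (simp add: B_def)
      hence "2 * B * (1 / sqrt (real (m - 1)) - 1 / sqrt (real (m + n - 1))) \<le> 2 * B * (1 / sqrt (real (m - 1)))"
        by (intro mult_left_mono) auto
      thus "norm (S (m + n) s - S m s) \<le> 2 * B / sqrt (real (m - 1))" using diff[of n] by simp
    qed
  qed
  thus ?thesis unfolding \<open>E s = f s\<close> S_def B_def by (simp add: mult.assoc)
qed

section \<open>Arithmetic of the factors of the modulus\<close>

lemma ceiling_div_nat:
  assumes "k > 0"
  shows "\<lceil>real a / real k\<rceil> = int ((a + k - 1) div k)"
proof (rule ceiling_unique)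
  define m where "m = (a + k - 1) div k"
  have 1: "k * m + (a + k - 1) mod k = a + k - 1" by (simp add: m_def)
  have 2: "(a + k - 1) mod k < k" using assms by simp
  have "a \<le> k * m" "k * m \<le> a + k - 1" using 1 2 by linarith+
  hence "real a \<le> real k * real m" "real k * real m \<le> real a + real k - 1"
    using assms by (simp_all flip: of_nat_mult of_nat_add add: of_nat_diff) 
  thus "real_of_int (int ((a + k - 1) div k)) - 1 < real a / real k"
    "real a / real k \<le> real_of_int (int ((a + k - 1) div k))"
    using assms unfolding m_def[symmetric] by (auto simp: field_simps)
qed

lemma ceiling_half: "\<lceil>real a / 2\<rceil> = int ((a + 1) div 2)"
  using ceiling_div_nat[of 2 a] by simp

lemma ceiling_third: "\<lceil>real a / 3\<rceil> = int ((a + 2) div 3)"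
  using ceiling_div_nat[of 3 a] by simp

lemma mult_extend_power:
  assumes "q \<ge> 1"
  shows "mult_extend (\<lambda>p a. p ^ a) q = q"
  using prime_factorization_nat[of q] assms by (simp add: mult_extend_def)

lemma mult_extend_mult: "mult_extend (\<lambda>p a. f p a * g p a) q = mult_extend f q * mult_extend g q"
  by (simp add: mult_extend_def prod.distrib)

lemma mult_extend_cong:
  assumes "\<And>p a. prime p \<Longrightarrow> a \<ge> 1 \<Longrightarrow> f p a = g p a"
  shows "mult_extend f q = mult_extend g q"
  unfolding mult_extend_def
  by (rule prod.cong) (auto intro!: assms simp: in_prime_factors_iff prime_factors_multiplicity)

lemma mult_extend_dvd:
  fixes f g :: "nat \<Rightarrow> nat \<Rightarrow> nat"
  assumes "\<And>p a. prime p \<Longrightarrow> a \<ge> 1 \<Longrightarrow> f p a dvd g p a"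
  shows "mult_extend f q dvd mult_extend g q"
  unfolding mult_extend_def
  by (rule prod_dvd_prod) (auto intro!: assms simp: in_prime_factors_iff prime_factors_multiplicity)

lemma mult_extend_two_dvd: "mult_extend (\<lambda>p a. if p = 2 then c else 1) q dvd (c :: nat)"
proof -
  have "(\<Prod>p\<in>prime_factors q. if p = 2 then c else 1) = (if 2 \<in> prime_factors q then c else 1)"
    by (subst prod.delta) auto
  thus ?thesis by (simp add: mult_extend_def)
qed

lemma mult_extend_pos:
  fixes f :: "nat \<Rightarrow> nat \<Rightarrow> nat"
  assumes "\<And>p a. prime p \<Longrightarrow> a \<ge> 1 \<Longrightarrow> f p a > 0"
  shows "mult_extend f q > 0"
  unfolding mult_extend_def
  by (rule prod_pos) (auto intro!: assms simp: in_prime_factors_iff prime_factors_multiplicity)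

lemma C1_pp_eq: "C1_pp p a = p ^ ((a + 1) div 2)"
  and D1_pp_eq: "D1_pp p a = p ^ (a - (a + 1) div 2)"
  and C_pp_eq: "C_pp p a = p ^ ((a + 2) div 3)"
  and D_pp_eq: "D_pp p a = (if a = 1 then 1 else if p = 2 then p ^ (a - 2 * ((a + 2) div 3) + 1)
     else p ^ (a - 2 * ((a + 2) div 3)))"
  by (simp_all add: C1_pp_def D1_pp_def C_pp_def D_pp_def ceiling_half ceiling_third)

lemma C1_D1: "q \<ge> 1 \<Longrightarrow> C1_of q * D1_of q = q"
  by (subst (3) mult_extend_power [symmetric], assumption, subst mult_extend_mult [symmetric],
      rule mult_extend_cong) (simp add: C1_pp_eq D1_pp_eq flip: power_add)

lemma D1_dvd_C1: "D1_of q dvd C1_of q"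
  by (rule mult_extend_dvd) (auto simp: C1_pp_eq D1_pp_eq intro!: le_imp_power_dvd)

lemma D_dvd: "q \<ge> 1 \<Longrightarrow> D_of q dvd q"
  by (subst (2) mult_extend_power [symmetric], assumption, rule mult_extend_dvd)
     (auto simp: D_pp_eq simp flip: power_Suc intro!: le_imp_power_dvd)

text \<open>This makes the linear estimates, which need \<open>2 * N\<close> to be at least C1 T^2,
  available at the point C D T^2 / 2 where the quadratic range is left.\<close>

lemma C1_dvd_C_D: "C1_of q dvd C_of q * D_of q"
  unfolding mult_extend_mult [symmetric]
  by (rule mult_extend_dvd)
     (auto simp: C_pp_eq C1_pp_eq D_pp_eq simp flip: power_add power_Suc intro!: le_imp_power_dvd)

text \<open>The 2 accounts for the extra factor of \<open>D_pp\<close> at the prime 2.\<close>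

lemma D_dvd_2C: "D_of q dvd 2 * C_of q"
proof -
  have "D_of q dvd mult_extend (\<lambda>p a. (if p = 2 then 2 else 1) * C_pp p a) q"
    by (rule mult_extend_dvd)
       (auto simp: C_pp_eq D_pp_eq simp flip: power_Suc intro!: le_imp_power_dvd)
  also have "\<dots> dvd 2 * C_of q"
    unfolding mult_extend_mult by (intro mult_dvd_mono mult_extend_two_dvd) simp
  finally show ?thesis .
qed

text \<open>Apart from the extra 2 at the prime 2, whose cube is the 8, the exponents in
  \<open>D_of q\<close> are at most a third of those in \<open>q\<close>. This bounds both
  \<open>ln D\<close> and the number of Weyl blocks in terms of ln Q.\<close>

lemma D_cube_le: assumes "q \<ge> 1" shows "D_of q ^ 3 \<le> 8 * q"
proof -
  have "mult_extend (\<lambda>p a. D_pp p a ^ 3) q dvd mult_extend (\<lambda>p a. (if p = 2 then 8 else 1) * p ^ a) q"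
  proof (rule mult_extend_dvd)
    fix p a :: nat assume "prime p" "a \<ge> 1"
    have "a \<le> 3 * ((a + 2) div 3)" by linarith
    hence e: "(a - 2 * ((a + 2) div 3)) * 3 \<le> a" by linarith
    have "(2::nat) ^ ((a - 2 * ((a + 2) div 3) + 1) * 3) dvd 2 ^ (3 + a)"
      if "a \<noteq> 1" by (intro le_imp_power_dvd) (use e in simp)
    moreover have "p ^ ((a - 2 * ((a + 2) div 3)) * 3) dvd p ^ a"
      by (intro le_imp_power_dvd) (rule e)
    ultimately show "D_pp p a ^ 3 dvd (if p = 2 then 8 else 1) * p ^ a"
      unfolding D_pp_eq by (auto simp: power_add simp flip: power_mult)
  qed
  also have "\<dots> dvd 8 * q"
    unfolding mult_extend_mult mult_extend_power[OF assms]
    by (intro mult_dvd_mono mult_extend_two_dvd) simp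
  finally show ?thesis using assms
    by (intro dvd_imp_le) (simp_all add: mult_extend_def prod_power_distrib)
qed

lemma C1_pos: "C1_of q > 0" and D1_pos: "D1_of q > 0" and C_pos: "C_of q > 0" and D_pos: "D_of q > 0"
  by (rule mult_extend_pos, simp add: C1_pp_eq D1_pp_eq C_pp_eq D_pp_eq prime_gt_0_nat)+

lemma prime_dvd_mult_extend:
  fixes f :: "nat \<Rightarrow> nat \<Rightarrow> nat"
  assumes "q \<ge> 1" "prime p" "p dvd q" "\<And>p a. a \<ge> 1 \<Longrightarrow> p dvd f p a"
  shows "p dvd mult_extend f q"
proof -
  have p: "p \<in> prime_factors q" using assms by (auto simp: in_prime_factors_iff)
  hence "multiplicity p q \<ge> 1" by (auto simp: prime_factors_multiplicity)
  hence "p dvd f p (multiplicity p q)" by (rule assms(4))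
  also have "\<dots> dvd mult_extend f q" unfolding mult_extend_def
    by (rule dvd_prodI) (use p in auto)
  finally show ?thesis .
qed

lemma prime_dvd_C1: "q \<ge> 1 \<Longrightarrow> prime p \<Longrightarrow> p dvd q \<Longrightarrow> p dvd C1_of q"
  by (rule prime_dvd_mult_extend) (auto simp: C1_pp_eq intro!: dvd_power)

lemma prime_dvd_C: "q \<ge> 1 \<Longrightarrow> prime p \<Longrightarrow> p dvd q \<Longrightarrow> p dvd C_of q"
  by (rule prime_dvd_mult_extend) (auto simp: C_pp_eq intro!: dvd_power)

lemma of_nat_mult_extend: "real (mult_extend f q) = mult_extend (\<lambda>p a. real (f p a)) q"
  by (simp add: mult_extend_def)

lemma mult_extend_powr:
  fixes f :: "nat \<Rightarrow> nat \<Rightarrow> real"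
  assumes "\<And>p a. f p a \<ge> 0"
  shows "mult_extend f q powr e = mult_extend (\<lambda>p a. f p a powr e) q"
  using assms by (simp add: mult_extend_def prod_powr_distrib)

lemma mult_extend_divide:
  fixes f g :: "nat \<Rightarrow> nat \<Rightarrow> real"
  shows "mult_extend f q / mult_extend g q = mult_extend (\<lambda>p a. f p a / g p a) q"
  by (simp add: mult_extend_def prod_dividef)

lemma real_eq_mult_extend: "q \<ge> 1 \<Longrightarrow> real q = mult_extend (\<lambda>p a. real (p ^ a)) q"
  using of_nat_mult_extend[of "\<lambda>p a. p ^ a" q] mult_extend_power[of q] by simp

text \<open>The analytic estimates produce \<open>C_of q\<close>, \<open>C1_of q\<close> and
  \<open>D_of q\<close> themselves; this and the next two closed forms convert them into the
  quantities of the statement.\<close>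

lemma sqf_eq: assumes "q \<ge> 1" shows "sqf q = real (C1_of q) / real q powr (1/2)"
  unfolding real_eq_mult_extend[OF assms] of_nat_mult_extend
  by (subst mult_extend_powr, simp, subst mult_extend_divide, rule mult_extend_cong)
     (auto simp: sqf_pp_def C1_pp_eq ceiling_half powr_diff powr_powr prime_gt_0_nat simp flip: powr_realpow)

lemma cbf_eq: assumes "q \<ge> 1" shows "cbf q = real (C_of q) / real q powr (1/3)"
  unfolding real_eq_mult_extend[OF assms] of_nat_mult_extend
  by (subst mult_extend_powr, simp, subst mult_extend_divide, rule mult_extend_cong)
     (auto simp: cbf_pp_def C_pp_eq ceiling_third powr_diff powr_powr prime_gt_0_nat simp flip: powr_realpow)

lemma spf_eq: assumes "q \<ge> 1"
  shows "spf q = real (C1_of q) / (real (C_of q * D_of q) powr (1/2) * real q powr (1/6))"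
proof -
  have "real (C1_of q) / (real (C_of q * D_of q) powr (1/2) * real q powr (1/6))
    = mult_extend (\<lambda>p a. real (C1_pp p a) / ((real (C_pp p a) * real (D_pp p a)) powr (1/2)
          * real (p ^ a) powr (1/6))) q"
    unfolding real_eq_mult_extend[OF assms] of_nat_mult_extend of_nat_mult
    by (simp add: mult_extend_powr mult_extend_divide mult_extend_mult [symmetric] powr_mult
          del: of_nat_power)
  also have "\<dots> = spf q"
  proof (rule mult_extend_cong)
    fix p a :: nat assume p: "prime p" "a \<ge> 1"
    hence p0: "real p > 0" by (simp add: prime_gt_0_nat)
    have D: "sqrt (real (D_pp p a)) = real (D_pp p a) powr (1/2)" by (simp add: powr_half_sqrt)
    show "real (C1_pp p a) / ((real (C_pp p a) * real (D_pp p a)) powr (1/2)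
          * real (p ^ a) powr (1/6)) = spf_pp p a"
      unfolding spf_pp_def D using p0
      by (simp add: C1_pp_eq C_pp_eq ceiling_half ceiling_third powr_diff powr_powr powr_mult
          prime_gt_0_nat flip: powr_realpow)
  qed
  finally show ?thesis ..
qed

section \<open>Counting residues\<close>

lemma card_residue_class_le:
  assumes P: "P \<ge> 1" and dvd: "P dvd C"
  shows "card {l. l < C \<and> [int l = c] (mod int P)} \<le> C div P"
proof -
  let ?S = "{l. l < C \<and> [int l = c] (mod int P)}"
  have "inj_on (\<lambda>l. l div P) ?S"
  proof (rule inj_onI)
    fix x y assume "x \<in> ?S" "y \<in> ?S" and eq: "x div P = y div P"
    hence "[int x = int y] (mod int P)" by (auto intro: cong_trans cong_sym)
    hence "[x = y] (mod P)" by (simp only: cong_int_iff)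
    hence "x mod P = y mod P" by (simp only: cong_def)
    thus "x = y" using eq by (metis div_mult_mod_eq)
  qed
  moreover have "(\<lambda>l. l div P) ` ?S \<subseteq> {..<C div P}"
    using dvd P by (auto simp: less_mult_imp_div_less dvd_div_mult_self)
  ultimately have "card ?S \<le> card {..<C div P}" by (intro card_inj_on_le) auto
  thus ?thesis by simp
qed

lemma cong_of_cong_inverse:
  fixes a b x y :: int
  assumes "[a * x = 1] (mod m)" "[b * y = 1] (mod m)" "[x = y] (mod m)"
  shows "[a = b] (mod m)"
proof -
  have "[a * (b * y) = a * 1] (mod m)" by (intro cong_mult cong_refl assms)
  moreover have "[b * (a * x) = b * 1] (mod m)" by (intro cong_mult cong_refl assms)
  moreover have "[a * (b * x) = a * (b * y)] (mod m)" by (intro cong_mult cong_refl assms)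
  ultimately show ?thesis by (simp add: mult.left_commute) (meson cong_sym cong_trans)
qed

text \<open>As \<open>w\<close> is a unit modulo \<open>P\<close> and inversion is injective, fixing
  \<open>w * iv l\<close> modulo \<open>P\<close> fixes \<open>l\<close> modulo
  \<open>P\<close>.\<close>

lemma card_inverse_class_le:
  fixes iv :: "nat \<Rightarrow> int"
  assumes P: "P \<ge> 1" "P dvd C" "P dvd q" and w: "coprime w (int P)"
    and inv: "\<And>l. l \<in> I \<Longrightarrow> [int l * iv l = 1] (mod int q)" and I: "I \<subseteq> {..<C}"
  shows "real (card {l\<in>I. [w * iv l = c] (mod int P)}) \<le> real C / real P"
proof (cases "{l\<in>I. [w * iv l = c] (mod int P)} = {}")
  case False
  then obtain l1 where l1: "l1 \<in> I" "[w * iv l1 = c] (mod int P)" by blast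
  have inv': "[int l * iv l = 1] (mod int P)" if "l \<in> I" for l
    using cong_dvd_modulus[OF inv[OF that]] P by simp
  have "{l\<in>I. [w * iv l = c] (mod int P)} \<subseteq> {l. l < C \<and> [int l = int l1] (mod int P)}"
  proof safe
    fix l assume l: "l \<in> I" "[w * iv l = c] (mod int P)"
    show "l < C" using l I by auto
    have "[w * iv l = w * iv l1] (mod int P)" using l(2) l1(2) by (meson cong_sym cong_trans)
    hence "[iv l = iv l1] (mod int P)" using w by (simp add: cong_mult_lcancel)
    thus "[int l = int l1] (mod int P)"
      using cong_of_cong_inverse[OF inv'[OF l(1)] inv'[OF l1(1)]] by simp
  qed
  hence "card {l\<in>I. [w * iv l = c] (mod int P)} \<le> card {l. l < C \<and> [int l = int l1] (mod int P)}"
    by (intro card_mono) auto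
  also have "\<dots> \<le> C div P" by (rule card_residue_class_le) (use P in auto)
  finally have "real (card {l\<in>I. [w * iv l = c] (mod int P)}) \<le> real (C div P)"
    by (simp only: of_nat_le_iff)
  thus ?thesis using P by (simp add: real_of_nat_div)
next
  case True
  show ?thesis unfolding True by simp
qed

text \<open>Multiplication by the inverse of one fixed root carries all roots of \<open>v\<close>
  injectively to roots of 1.\<close>

lemma card_sqrt_le_sqrt_one_count:
  assumes D: "D \<ge> 1"
  shows "card {x. x < D \<and> coprime x D \<and> [x\<^sup>2 = v] (mod D)} \<le> sqrt_one_count D"
proof (cases "{x. x < D \<and> coprime x D \<and> [x\<^sup>2 = v] (mod D)} = {}")
  case False
  let ?S = "{x. x < D \<and> coprime x D \<and> [x\<^sup>2 = v] (mod D)}"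
  obtain x0 where x0: "x0 < D" "coprime x0 D" "[x0\<^sup>2 = v] (mod D)" using False by blast
  obtain y where y: "[x0 * y = 1] (mod D)" using cong_solve_coprime_nat[OF x0(2)] by auto
  have cop_y: "coprime y D" using y
    by (metis cong_imp_coprime cong_sym coprime_1_left coprime_mult_left_iff)
  have "inj_on (\<lambda>x. (x * y) mod D) ?S"
  proof (rule inj_onI)
    fix a b assume a: "a \<in> ?S" and b: "b \<in> ?S" and "(a * y) mod D = (b * y) mod D"
    hence "[a * y = b * y] (mod D)" by (simp add: cong_def)
    hence "[a = b] (mod D)" using cop_y by (simp add: cong_mult_rcancel_nat)
    thus "a = b" using a b by (auto simp: cong_less_modulus_unique_nat)
  qed
  moreover have "(\<lambda>x. (x * y) mod D) ` ?S \<subseteq> {x. x < D \<and> [x ^ 2 = 1] (mod D)}"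
  proof safe
    fix x assume x: "[x\<^sup>2 = v] (mod D)"
    show "(x * y) mod D < D" using D by simp
    have "[x\<^sup>2 * y\<^sup>2 = x0\<^sup>2 * y\<^sup>2] (mod D)"
      by (intro cong_mult cong_refl) (use x x0(3) in \<open>meson cong_sym cong_trans\<close>)
    also have "x0\<^sup>2 * y\<^sup>2 = (x0 * y)\<^sup>2" by (simp add: power_mult_distrib)
    also have "[(x0 * y)\<^sup>2 = 1\<^sup>2] (mod D)" by (intro cong_pow y)
    finally have "[(x * y)\<^sup>2 = 1] (mod D)" by (simp add: power_mult_distrib)
    thus "[(x * y mod D)\<^sup>2 = 1] (mod D)" by (simp add: cong_def power_mod)
  qed
  ultimately show ?thesis unfolding sqrt_one_count_def by (intro card_inj_on_le) auto
next
  case True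
  show ?thesis unfolding True by simp
qed

lemma card_mod_mem_le:
  assumes D: "D \<ge> 1" "D dvd E" and A: "A \<subseteq> {..<D}"
  shows "card {l. l < E \<and> l mod D \<in> A} \<le> card A * (E div D)"
proof -
  have finA: "finite A" using A finite_subset by auto
  have "{l. l < E \<and> l mod D \<in> A} \<subseteq> (\<Union>a\<in>A. {l. l < E \<and> [int l = int a] (mod int D)})"
    by (auto simp: cong_int_iff)
  hence "card {l. l < E \<and> l mod D \<in> A} \<le> card (\<Union>a\<in>A. {l. l < E \<and> [int l = int a] (mod int D)})"
    using finA by (intro card_mono) auto
  also have "\<dots> \<le> (\<Sum>a\<in>A. card {l. l < E \<and> [int l = int a] (mod int D)})"
    by (rule card_UN_le[OF finA])
  also have "\<dots> \<le> (\<Sum>a\<in>A. E div D)"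
    by (intro sum_mono card_residue_class_le D)
  finally show ?thesis by simp
qed

text \<open>The congruence fixes the square of \<open>l\<close> modulo \<open>P\<close>, which
  leaves \<open>D div P\<close> values for the square modulo \<open>D\<close>, each with at most
  \<open>sqrt_one_count D\<close> roots modulo \<open>D\<close>. As \<open>D\<close> divides
  \<open>2 * C\<close> but perhaps not \<open>C\<close>, the lifts of these roots are counted below
  \<open>2 * C\<close>; hence the factor 2.\<close>

lemma card_inverse_square_class_le:
  fixes iv :: "nat \<Rightarrow> int"
  assumes P: "P \<ge> 1" "P dvd D" and D: "D \<ge> 1" "D dvd q" "D dvd 2 * C" and w: "coprime w (int P)"
    and inv: "\<And>l. l \<in> I \<Longrightarrow> [int l * iv l = 1] (mod int q)" and I: "I \<subseteq> {..<C}"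
  shows "real (card {l\<in>I. [w * (iv l)\<^sup>2 = c] (mod int P)})
    \<le> 2 * real C * real (sqrt_one_count D) / real P"
proof (cases "{l\<in>I. [w * (iv l)\<^sup>2 = c] (mod int P)} = {}")
  case True
  show ?thesis unfolding True by simp
next
  case False
  let ?S = "{l\<in>I. [w * (iv l)\<^sup>2 = c] (mod int P)}"
  let ?X = "\<lambda>v. {x. x < D \<and> coprime x D \<and> [x\<^sup>2 = v] (mod D)}"
  from False obtain l1 where l1: "l1 \<in> I" "[w * (iv l1)\<^sup>2 = c] (mod int P)" by blast
  have invD: "[int l * iv l = 1] (mod int D)" if "l \<in> I" for l
    using cong_dvd_modulus[OF inv[OF that]] D by simp
  have inv': "[(int l)\<^sup>2 * (iv l)\<^sup>2 = 1] (mod int P)" if "l \<in> I" for l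
  proof -
    have "[int l * iv l = 1] (mod int P)" using cong_dvd_modulus[OF invD[OF that]] P by simp
    from cong_pow[OF this, of 2] show ?thesis by (simp add: power_mult_distrib)
  qed
  define j1 where "j1 = l1\<^sup>2 mod P"
  have sub: "?S \<subseteq> (\<Union>j<D div P. {l. l < 2 * C \<and> l mod D \<in> ?X (j1 + j * P)})"
  proof
    fix l assume "l \<in> ?S"
    hence l: "l \<in> I" "[w * (iv l)\<^sup>2 = c] (mod int P)" by auto
    have "[w * (iv l)\<^sup>2 = w * (iv l1)\<^sup>2] (mod int P)" using l(2) l1(2) by (meson cong_sym cong_trans)
    hence "[(iv l)\<^sup>2 = (iv l1)\<^sup>2] (mod int P)" using w by (simp add: cong_mult_lcancel)
    hence "[(int l)\<^sup>2 = (int l1)\<^sup>2] (mod int P)"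
      using cong_of_cong_inverse[OF inv'[OF l(1)] inv'[OF l1(1)]] by simp
    hence "l\<^sup>2 mod P = l1\<^sup>2 mod P" by (metis cong_def cong_int_iff of_nat_power)
    define r where "r = l\<^sup>2 mod D"
    have r1: "r mod P = j1" using \<open>l\<^sup>2 mod P = l1\<^sup>2 mod P\<close> P by (simp add: r_def j1_def mod_mod_cancel)
    have r2: "r = j1 + r div P * P" using div_mult_mod_eq[of r P] r1 by simp
    have "r < D" using D by (simp add: r_def)
    hence r3: "r div P < D div P" using P D(1)
      by (metis dvd_div_mult_self less_mult_imp_div_less)
    have "coprime (int l) (int D)" using invD[OF l(1)]
      by (metis cong_imp_coprime cong_sym coprime_1_left coprime_mult_left_iff)
    hence cop: "coprime l D" by simp
    have "[(l mod D)\<^sup>2 = r] (mod D)" by (simp add: cong_def r_def power_mod)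
    hence "l mod D \<in> ?X (j1 + r div P * P)" using D cop r2 by simp
    moreover have "l < 2 * C" using l I by auto
    ultimately show "l \<in> (\<Union>j<D div P. {l. l < 2 * C \<and> l mod D \<in> ?X (j1 + j * P)})"
      using r3 by blast
  qed
  have "card ?S \<le> card (\<Union>j<D div P. {l. l < 2 * C \<and> l mod D \<in> ?X (j1 + j * P)})"
    by (rule card_mono[OF _ sub]) auto
  also have "\<dots> \<le> (\<Sum>j<D div P. card {l. l < 2 * C \<and> l mod D \<in> ?X (j1 + j * P)})"
    by (rule card_UN_le) simp
  also have "\<dots> \<le> (\<Sum>j<D div P. sqrt_one_count D * (2 * C div D))"
  proof (intro sum_mono)
    fix j
    have "card {l. l < 2 * C \<and> l mod D \<in> ?X (j1 + j * P)} \<le> card (?X (j1 + j * P)) * (2 * C div D)"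
      by (rule card_mod_mem_le) (use D in auto)
    also have "\<dots> \<le> sqrt_one_count D * (2 * C div D)"
      by (intro mult_right_mono card_sqrt_le_sqrt_one_count D) simp
    finally show "card {l. l < 2 * C \<and> l mod D \<in> ?X (j1 + j * P)} \<le> \<dots>" .
  qed
  also have "\<dots> = D div P * (sqrt_one_count D * (2 * C div D))" by simp
  finally have "real (card ?S) \<le> real (D div P * (sqrt_one_count D * (2 * C div D)))"
    by (simp only: of_nat_le_iff)
  also have "\<dots> = 2 * real C * real (sqrt_one_count D) / real P"
  proof -
    have 1: "real (D div P) = real D / real P" using P by (simp add: real_of_nat_div)
    have 2: "real (2 * C div D) = 2 * real C / real D" using D by (simp add: real_of_nat_div)
    show ?thesis using D P by (simp add: 1 2)
  qed
  finally show ?thesis .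
qed

section \<open>The divisor sum behind the resonances\<close>

lemma inverse_sqrt_le_diff: 
  assumes "n \<ge> 0"
  shows "1 / sqrt (n + 1) \<le> 2 * (sqrt (n + 1) - sqrt n)"
proof -
  have p: "sqrt (n + 1) + sqrt n > 0" "sqrt (n + 1) > 0" using assms by (auto intro!: add_pos_nonneg)
  have "1 = (sqrt (n + 1) - sqrt n) * (sqrt (n + 1) + sqrt n)"
    using assms by (simp add: algebra_simps)
  hence "sqrt (n + 1) - sqrt n = 1 / (sqrt (n + 1) + sqrt n)" using p by (simp add: field_simps)
  moreover have "1 / (2 * sqrt (n + 1)) \<le> 1 / (sqrt (n + 1) + sqrt n)"
    using p assms by (intro divide_left_mono) auto
  ultimately show ?thesis by simp
qed

lemma sum_inverse_sqrt_le: "(\<Sum>j=1..n. 1 / sqrt (real j)) \<le> 2 * sqrt (real n)"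
proof (induction n)
  case (Suc n)
  thus ?case using inverse_sqrt_le_diff[of "real n"] by (simp add: add.commute)
qed simp

text \<open>The gcd is replaced by the sum of all common divisors of \<open>r\<close> and
  \<open>m\<close>. For a fixed divisor \<open>d\<close> the multiples of \<open>d\<close>
  contribute at most \<open>2 * sqrt (real R)\<close>, whatever \<open>d\<close> is, so that only
  the number of divisors enters.\<close>

lemma sum_gcd_div_sqrt_le:
  assumes m: "m \<ge> 1"
  shows "(\<Sum>r=1..<R. real (gcd r m) / sqrt (real r)) \<le> 2 * real (divisor_count m) * sqrt (real R)"
proof -
  let ?D = "{d. d dvd m}"
  have fin: "finite ?D" using m by simp
  have "(\<Sum>r=1..<R. real (gcd r m) / sqrt (real r))
      \<le> (\<Sum>r=1..<R. \<Sum>d\<in>?D. if d dvd r then real d / sqrt (real r) else 0)"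
  proof (intro sum_mono)
    fix r
    have "(\<Sum>d\<in>{gcd r m}. if d dvd r then real d / sqrt (real r) else 0)
        \<le> (\<Sum>d\<in>?D. if d dvd r then real d / sqrt (real r) else 0)"
      using fin by (intro sum_mono2) auto
    thus "real (gcd r m) / sqrt (real r) \<le> (\<Sum>d\<in>?D. if d dvd r then real d / sqrt (real r) else 0)"
      by simp
  qed
  also have "\<dots> = (\<Sum>d\<in>?D. \<Sum>r=1..<R. if d dvd r then real d / sqrt (real r) else 0)"
    by (rule sum.swap)
  also have "\<dots> \<le> (\<Sum>d\<in>?D. 2 * sqrt (real R))"
  proof (intro sum_mono)
    fix d assume "d \<in> ?D"
    hence d: "d > 0" using m by (auto intro!: Nat.gr0I)
    have "(\<Sum>r=1..<R. if d dvd r then real d / sqrt (real r) else 0)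
        = (\<Sum>r\<in>{r\<in>{1..<R}. d dvd r}. real d / sqrt (real r))"
      by (rule sum.inter_filter [symmetric]) simp
    also have "\<dots> = (\<Sum>j\<in>{j\<in>{1..R div d}. d * j < R}. real d / sqrt (real (d * j)))"
      by (rule sum.reindex_bij_witness[of _ "\<lambda>j. d * j" "\<lambda>r. r div d"])
         (use d in \<open>auto simp: div_le_mono less_imp_le_nat dvd_div_mult_self Suc_le_eq 
            div_greater_zero_iff dvd_imp_le\<close>)
    also have "\<dots> \<le> (\<Sum>j=1..R div d. real d / sqrt (real (d * j)))"
      by (intro sum_mono2) auto
    also have "\<dots> = sqrt (real d) * (\<Sum>j=1..R div d. 1 / sqrt (real j))"
      unfolding sum_distrib_left using d
      by (intro sum.cong refl) (simp add: real_sqrt_mult real_div_sqrt field_simps)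
    also have "\<dots> \<le> sqrt (real d) * (2 * sqrt (real (R div d)))"
      by (intro mult_left_mono sum_inverse_sqrt_le) simp
    also have "\<dots> = 2 * sqrt (real (d * (R div d)))" by (simp add: real_sqrt_mult)
    also have "\<dots> \<le> 2 * sqrt (real R)" 
      by (metis (mono_tags) div_times_less_eq_dividend mult.commute mult_left_mono of_nat_le_iff 
          real_sqrt_le_iff zero_le_numeral)
    finally show "(\<Sum>r=1..<R. if d dvd r then real d / sqrt (real r) else 0) \<le> 2 * sqrt (real R)" .
  qed
  also have "\<dots> = 2 * real (divisor_count m) * sqrt (real R)" by (simp add: divisor_count_def)
  finally show ?thesis .
qed

text \<open>After cancelling \<open>B\<close>, the cofactor of \<open>L\<close> is coprime to
  \<open>D div B\<close>, so only \<open>r\<close> can share a factor with the latter. The 2, which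
  stems from differencing a square, costs at most a factor 2.\<close>

lemma gcd_linear_le:
  fixes L :: int and B D r :: nat
  assumes D: "D \<ge> 1" and B: "int B = gcd L (int D)"
  shows "gcd (2 * L * int r) (int D) \<le> 2 * int B * int (gcd r (D div B))"
proof -
  have B1: "int B dvd L" "int B dvd int D" by (simp_all add: B)
  have B0: "B > 0" using D B by (metis gcd_eq_0_iff of_nat_0 not_gr_zero of_nat_eq_0_iff not_one_le_zero)
  obtain L' where L': "L = int B * L'" using B1 by (auto elim: dvdE)
  have D': "D = B * (D div B)" using B1(2) by (simp only: int_dvd_int_iff dvd_mult_div_cancel)
  have "gcd L (int D) = int B * gcd L' (int (D div B))"
    by (subst D', subst L') (simp add: gcd_mult_left)
  hence cop: "coprime L' (int (D div B))" using B B0 D by (simp add: coprime_iff_gcd_eq_1)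
  have "gcd (2 * L * int r) (int D) dvd 2 * gcd (L * int r) (int D)"
  proof -
    have "gcd (2 * L * int r) (int D) dvd gcd (2 * (L * int r)) (2 * int D)"
      by (intro gcd_greatest) (auto simp: mult.assoc)
    thus ?thesis by (simp add: gcd_mult_left)
  qed
  hence "gcd (2 * L * int r) (int D) \<le> 2 * gcd (L * int r) (int D)"
    using D by (intro zdvd_imp_le) (auto simp: gcd_pos_int)
  also have "gcd (L * int r) (int D) = int B * gcd (L' * int r) (int (D div B))"
    by (subst D', subst L') (simp add: gcd_mult_left mult.assoc)
  also have "gcd (L' * int r) (int (D div B)) = gcd (int r) (int (D div B))"
    using cop by (simp add: gcd_mult_left_left_cancel coprime_commute)
  finally show ?thesis by simp
qed

section \<open>Dirichlet characters and phases along progressions\<close>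

lemma dirichlet_character_cong:
  assumes chi: "dirichlet_character q chi" and "[m = n] (mod int q)"
  shows "chi m = chi n"
proof -
  have per: "chi (n + int q) = chi n" for n using chi by (simp add: dirichlet_character_def)
  have nat: "chi (n + int q * int k) = chi n" for n k
  proof (induction k)
    case (Suc k)
    show ?case using per[of "n + int q * int k"] Suc.IH by (simp add: algebra_simps)
  qed simp
  obtain k where k: "m = n + int q * k" using assms(2) by (metis cong_iff_lin cong_sym)
  show ?thesis
  proof (cases "k \<ge> 0")
    case True
    thus ?thesis using nat[of n "nat k"] k by simp
  next
    case False
    thus ?thesis using nat[of m "nat (- k)"] k by simp
  qed
qed

lemma dirichlet_character_1: "dirichlet_character q chi \<Longrightarrow> chi 1 = 1"
  unfolding dirichlet_character_def by (metis coprime_1_left mult.right_neutral mult_cancel_left1)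

lemma dirichlet_character_power:
  assumes "dirichlet_character q chi"
  shows "chi (n ^ k) = chi n ^ k"
  by (induction k) (use assms dirichlet_character_1[OF assms] in \<open>auto simp: dirichlet_character_def\<close>)

text \<open>Nonzero values are roots of unity by Euler's theorem.\<close>

lemma norm_dirichlet_character_le:
  assumes chi: "dirichlet_character q chi"
  shows "norm (chi n) \<le> 1"
proof (cases "coprime n (int q)")
  case True
  have q: "q \<ge> 1" using chi by (simp add: dirichlet_character_def)
  define m where "m = nat (n mod int q)"
  have mn: "[int m = n] (mod int q)" using q by (simp add: m_def cong_def)
  have "coprime (int m) (int q)" using True mn cong_imp_coprime cong_sym by blast
  hence "coprime m q" by simp
  hence "[m ^ totient q = 1] (mod q)" by (rule euler_theorem)
  hence "[int (m ^ totient q) = int 1] (mod int q)" by (simp only: cong_int_iff)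
  hence "[int m ^ totient q = 1] (mod int q)" by simp
  hence "chi (int m ^ totient q) = 1"
    using dirichlet_character_cong[OF chi] dirichlet_character_1[OF chi] by metis
  hence "chi (int m) ^ totient q = 1" by (simp add: dirichlet_character_power[OF chi])
  moreover have "totient q > 0" using q by (simp add: totient_gt_0_iff)
  ultimately have "norm (chi (int m)) ^ totient q = 1" "totient q \<noteq> 0" by (simp_all flip: norm_power)
  hence "norm (chi (int m)) = 1" using power_eq_imp_eq_base[of "norm (chi (int m))" "totient q" 1] by simp
  thus ?thesis using dirichlet_character_cong[OF chi mn] by simp
next
  case False
  hence "chi n = 0" using chi by (auto simp: dirichlet_character_def)
  thus ?thesis by simp
qed

text \<open>Modulo \<open>q\<close>, \<open>l + C * x\<close> is
  \<open>l * (1 + C * (iv * x))\<close>. The progression of an invertible class thus reduces to that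
  of 1, with \<open>x\<close> scaled by the inverse of \<open>l\<close>.\<close>

lemma dirichlet_character_shift:
  assumes chi: "dirichlet_character q chi" and inv: "[l * iv = 1] (mod int q)"
  shows "chi (l + C * x) = chi l * chi (1 + C * (iv * x))"
proof -
  have "[l * (1 + C * (iv * x)) = l + C * x] (mod int q)"
  proof -
    have "[l + (l * iv) * (C * x) = l + 1 * (C * x)] (mod int q)"
      by (intro cong_add cong_mult cong_refl inv)
    thus ?thesis by (simp add: algebra_simps)
  qed
  from dirichlet_character_cong[OF chi this] show ?thesis
    using chi by (simp add: dirichlet_character_def)
qed

lemma dirichlet_character_eq_0:
  assumes chi: "dirichlet_character q chi" and C: "\<And>p. prime p \<Longrightarrow> p dvd q \<Longrightarrow> p dvd C"
    and l: "\<not> coprime l q"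
  shows "chi (int (l + C * x)) = 0"
proof -
  obtain p where p: "prime p" "p dvd l" "p dvd q" using l
    by (metis coprime_iff_gcd_eq_1 gcd_dvd1 gcd_dvd2 prime_factor_nat dvd_trans)
  hence "p dvd l + C * x" using C by auto
  hence "\<not> coprime (l + C * x) q" using p by (meson coprime_common_divisor not_prime_unit)
  hence "\<not> coprime (int (l + C * x)) (int q)" unfolding coprime_int_iff .
  thus ?thesis using chi by (metis dirichlet_character_def)
qed

text \<open>The phase increments of \<open>n\<^sup>-\<^sup>i\<^sup>t\<close> along a progression of step \<open>C\<close> are \<open>- slope t C n\<close>.\<close>

definition slope :: "real \<Rightarrow> real \<Rightarrow> real \<Rightarrow> real" where
  "slope t C y = t / (2 * pi) * (ln (y + C) - ln y)"

lemma slope_le: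
  assumes "t > 0" "C > 0" "y > 0"
  shows "slope t C y \<le> t * C / (2 * pi * y)"
proof -
  have "ln ((y + C) / y) \<le> (y + C) / y - 1" using assms by (intro ln_le_minus_one) auto
  also have "\<dots> = C / y" using assms by (simp add: field_simps)
  finally have "ln (y + C) - ln y \<le> C / y" using assms by (simp add: ln_div)
  hence "slope t C y \<le> t / (2 * pi) * (C / y)" unfolding slope_def
    using assms by (intro mult_left_mono) auto
  thus ?thesis by simp
qed

lemma one_minus_inverse_le_ln: "x > 0 \<Longrightarrow> 1 - 1 / x \<le> ln (x :: real)"
  using ln_le_minus_one[of "1 / x"] by (simp add: ln_div)

lemma slope_ge:
  assumes "t > 0" "C > 0" "y > 0"
  shows "t * C / (2 * pi * (y + C)) \<le> slope t C y"
proof -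
  have "C / (y + C) = 1 - 1 / ((y + C) / y)" using assms by (simp add: field_simps)
  also have "\<dots> \<le> ln ((y + C) / y)" using assms by (intro one_minus_inverse_le_ln) auto
  finally have "C / (y + C) \<le> ln (y + C) - ln y" using assms by (simp add: ln_div)
  hence "t / (2 * pi) * (C / (y + C)) \<le> slope t C y" unfolding slope_def
    using assms by (intro mult_left_mono) auto
  thus ?thesis by simp
qed

lemma slope_diff_eq:
  assumes "C > 0" "y > 0"
  shows "slope t C y - slope t C (y + C) = t / (2 * pi) * ln ((y + C)\<^sup>2 / (y * (y + 2 * C)))"
proof -
  have "ln ((y + C)\<^sup>2 / (y * (y + 2 * C))) = 2 * ln (y + C) - (ln y + ln (y + 2 * C))"
    using assms by (simp add: ln_div ln_mult ln_realpow)
  also have "\<dots> = (ln (y + C) - ln y) - (ln (y + C + C) - ln (y + C))" by (simp add: add.assoc)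
  finally show ?thesis by (simp only: slope_def right_diff_distrib)
qed

lemma slope_diff_ge:
  assumes "t > 0" "C > 0" "y > 0"
  shows "t / (2 * pi) * (C / (y + C))\<^sup>2 \<le> slope t C y - slope t C (y + C)"
proof -
  have e: "(y + C)\<^sup>2 - y * (y + 2 * C) = C\<^sup>2" by (simp add: power2_eq_square algebra_simps)
  have "(C / (y + C))\<^sup>2 = ((y + C)\<^sup>2 - y * (y + 2 * C)) / (y + C)\<^sup>2" unfolding e by (rule power_divide)
  also have "\<dots> = 1 - 1 / ((y + C)\<^sup>2 / (y * (y + 2 * C)))" using assms by (simp add: diff_divide_distrib)
  also have "\<dots> \<le> ln ((y + C)\<^sup>2 / (y * (y + 2 * C)))"
    using assms by (intro one_minus_inverse_le_ln) auto
  finally show ?thesis unfolding slope_diff_eq[OF assms(2,3)]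
    using assms by (intro mult_left_mono) auto
qed

lemma slope_diff_le:
  assumes "t > 0" "C > 0" "y > 0"
  shows "slope t C y - slope t C (y + C) \<le> t / (2 * pi) * (C / y)\<^sup>2"
proof -
  have "ln ((y + C)\<^sup>2 / (y * (y + 2 * C))) \<le> (y + C)\<^sup>2 / (y * (y + 2 * C)) - 1"
    using assms by (intro ln_le_minus_one) auto
  also have "\<dots> = ((y + C)\<^sup>2 - y * (y + 2 * C)) / (y * (y + 2 * C))"
    using assms by (simp add: diff_divide_distrib)
  also have "(y + C)\<^sup>2 - y * (y + 2 * C) = C\<^sup>2" by (simp add: power2_eq_square algebra_simps)
  also have "C\<^sup>2 / (y * (y + 2 * C)) \<le> C\<^sup>2 / (y * y)"
    using assms by (intro divide_left_mono mult_left_mono mult_pos_pos) auto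
  also have "\<dots> = (C / y)\<^sup>2" by (simp add: power2_eq_square)
  finally show ?thesis unfolding slope_diff_eq[OF assms(2,3)]
    using assms by (intro mult_left_mono) auto
qed

lemma slope_antimono:
  assumes "t > 0" "C > 0" "0 < y" "y \<le> z"
  shows "slope t C z \<le> slope t C y"
proof -
  have "ln ((z + C) / z) \<le> ln ((y + C) / y)" using assms by (simp add: field_simps)
  hence "ln (z + C) - ln z \<le> ln (y + C) - ln y" using assms by (simp add: ln_div)
  thus ?thesis unfolding slope_def using assms by (intro mult_left_mono) auto
qed

text \<open>This is a third difference of the logarithm. Weyl differencing uses up one difference,
  so it is this one that makes the increments of the differenced phase grow. The difference is the
  logarithm of the ratio \<open>x\<close>, bounded below by \<open>1 - 1 / x\<close>; what remains
  is a polynomial inequality with nonnegative coefficients.\<close>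

lemma slope_diff2_ge:
  assumes "t > 0" "C > 0" "y > 0"
  shows "t / pi * (C / (y + 2 * C)) ^ 3
    \<le> (slope t C y - slope t C (y + C)) - (slope t C (y + C) - slope t C (y + 2 * C))"
proof -
  define x where "x = ((y + C) ^ 3 * (y + 3 * C)) / (y * (y + 2 * C) ^ 3)"
  have pos: "y + C > 0" "y + 2 * C > 0" "y + 3 * C > 0" using assms by auto
  have x0: "x > 0" using assms pos by (simp add: x_def)
  have lnx: "ln x = 3 * ln (y + C) + ln (y + 3 * C) - ln y - 3 * ln (y + 2 * C)"
    unfolding x_def using assms pos by (simp add: ln_div ln_mult ln_realpow)
  have eq: "(slope t C y - slope t C (y + C)) - (slope t C (y + C) - slope t C (y + 2 * C))
     = t / (2 * pi) * ln x"
  proof -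
    have "ln x = ((ln (y + C) - ln y) - (ln (y + C + C) - ln (y + C)))
        - ((ln (y + C + C) - ln (y + C)) - (ln (y + 2 * C + C) - ln (y + 2 * C)))"
      unfolding lnx by (simp add: add.assoc)
    thus ?thesis by (simp only: slope_def right_diff_distrib)
  qed
  have poly: "(y + C) ^ 3 * (y + 3 * C) - y * (y + 2 * C) ^ 3 = C ^ 3 * (2 * y + 3 * C)"
    by (simp add: algebra_simps power3_eq_cube)
  have "2 * (C / (y + 2 * C)) ^ 3 \<le> C ^ 3 * (2 * y + 3 * C) / ((y + C) ^ 3 * (y + 3 * C))"
  proof -
    have "2 * ((y + C) ^ 3 * (y + 3 * C)) \<le> (2 * y + 3 * C) * (y + 2 * C) ^ 3"
    proof -
      have "(2 * y + 3 * C) * (y + 2 * C) ^ 3 - 2 * ((y + C) ^ 3 * (y + 3 * C))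
        = 3 * y ^ 3 * C + 18 * y ^ 2 * C ^ 2 + 32 * y * C ^ 3 + 18 * C ^ 4"
        by (simp add: algebra_simps power3_eq_cube power2_eq_square power4_eq_xxxx)
      moreover have "\<dots> \<ge> 0" using assms by simp
      ultimately show ?thesis by linarith
    qed
    hence "C ^ 3 * (2 * ((y + C) ^ 3 * (y + 3 * C))) \<le> C ^ 3 * ((2 * y + 3 * C) * (y + 2 * C) ^ 3)"
      using assms by (intro mult_left_mono) auto
    thus ?thesis using pos by (simp add: power_divide divide_le_eq le_divide_eq mult_ac)
  qed
  also have "\<dots> = 1 - 1 / x"
    unfolding poly [symmetric] x_def using assms pos by (simp add: diff_divide_distrib)
  also have "\<dots> \<le> ln x" by (rule one_minus_inverse_le_ln[OF x0])
  finally have "t / (2 * pi) * (2 * (C / (y + 2 * C)) ^ 3) \<le> t / (2 * pi) * ln x"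
    using assms by (intro mult_left_mono) auto
  thus ?thesis unfolding eq by (simp add: field_simps)
qed

section \<open>Partial summation over blocks and progressions\<close>

lemma abel_decreasing:
  fixes a :: "nat \<Rightarrow> complex" and w :: "nat \<Rightarrow> real"
  assumes w: "\<And>i j. m \<le> i \<Longrightarrow> i \<le> j \<Longrightarrow> j < k \<Longrightarrow> w j \<le> w i" "\<And>i. m \<le> i \<Longrightarrow> i < k \<Longrightarrow> 0 \<le> w i"
    and G: "\<And>j. m < j \<Longrightarrow> j \<le> k \<Longrightarrow> norm (\<Sum>i\<in>{m..<j}. a i) \<le> G" and mk: "m < k"
  shows "norm (\<Sum>i\<in>{m..<k}. of_real (w i) * a i) \<le> w m * G"
proof -
  have G0: "G \<ge> 0" using G[of k] mk norm_ge_zero order_trans by blast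
  \<comment> \<open>Comparison with the current weight times the unweighted sum makes the errors
    telescope; adding back the last weight gives exactly \<open>w m * G\<close>.\<close>
  have "norm ((\<Sum>i\<in>{m..<j}. of_real (w i) * a i) - of_real (w (j - 1)) * (\<Sum>i\<in>{m..<j}. a i))
      \<le> (w m - w (j - 1)) * G" if "m < j" "j \<le> k" for j
    using that
  proof (induction j)
    case (Suc j)
    show ?case
    proof (cases "m = j")
      case True
      thus ?thesis by simp
    next
      case False
      hence mj: "m < j" "j \<le> k" using Suc.prems by auto
      let ?A = "\<Sum>i\<in>{m..<j}. a i"
      let ?D = "(\<Sum>i\<in>{m..<j}. of_real (w i) * a i) - of_real (w (j - 1)) * ?A"
      have "(\<Sum>i\<in>{m..<Suc j}. of_real (w i) * a i) - of_real (w (Suc j - 1)) * (\<Sum>i\<in>{m..<Suc j}. a i)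
        = ?D + of_real (w (j - 1) - w j) * ?A"
        using mj by (simp add: algebra_simps)
      also have "norm \<dots> \<le> norm ?D + norm (of_real (w (j - 1) - w j) * ?A)" by (rule norm_triangle_ineq)
      also have "norm (of_real (w (j - 1) - w j) * ?A) \<le> (w (j - 1) - w j) * G"
        unfolding norm_mult norm_of_real using w(1)[of "j - 1" j] mj Suc.prems G[OF mj] by (intro mult_mono) auto
      finally show ?thesis using Suc.IH[OF mj] by (simp add: algebra_simps)
    qed
  qed simp
  from this[OF mk order_refl] 
  have "norm (\<Sum>i\<in>{m..<k}. of_real (w i) * a i) 
    \<le> (w m - w (k - 1)) * G + norm (of_real (w (k - 1)) * (\<Sum>i\<in>{m..<k}. a i))"
    using norm_triangle_sub[of "\<Sum>i\<in>{m..<k}. of_real (w i) * a i" "of_real (w (k - 1)) * (\<Sum>i\<in>{m..<k}. a i)"]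
    by linarith
  also have "norm (of_real (w (k - 1)) * (\<Sum>i\<in>{m..<k}. a i)) \<le> w (k - 1) * G"
    unfolding norm_mult norm_of_real using w(2)[of "k - 1"] mk G[OF mk order_refl] by (intro mult_mono) auto
  finally show ?thesis by (simp add: algebra_simps)
qed

text \<open>The end points are real because the cut points are multiples of a cube root of
  \<open>t\<close>; the left end is open so that consecutive blocks are disjoint.\<close>

definition block :: "real \<Rightarrow> real \<Rightarrow> nat set" where
  "block N M = {n. N < real n \<and> real n \<le> M}"

lemma block_eq: "N \<ge> 0 \<Longrightarrow> block N M = {Suc (nat \<lfloor>N\<rfloor>)..<Suc (nat \<lfloor>M\<rfloor>)}"
  unfolding block_def by (auto simp: less_Suc_eq_le Suc_le_eq nat_less_iff le_nat_iff le_floor_iff floor_less_iff) linarith+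

lemma finite_block [simp]: "finite (block N M)"
proof -
  have "block N M \<subseteq> {..nat \<lfloor>M\<rfloor>}" by (auto simp: block_def le_nat_floor)
  thus ?thesis by (rule finite_subset) simp
qed

lemma block_union:
  assumes "N \<le> K" "K \<le> M"
  shows "block N M = block N K \<union> block K M" "block N K \<inter> block K M = {}"
  using assms by (auto simp: block_def)

lemma abel_block:
  fixes a :: "nat \<Rightarrow> complex"
  assumes N: "N > 0" and G: "\<And>K. N \<le> K \<Longrightarrow> K \<le> M \<Longrightarrow> norm (\<Sum>n\<in>block N K. a n) \<le> G" and NM: "N \<le> M"
  shows "norm (\<Sum>n\<in>block N M. of_real (1 / sqrt (real n)) * a n) \<le> G / sqrt N"
proof -
  let ?m = "Suc (nat \<lfloor>N\<rfloor>)" and ?k = "Suc (nat \<lfloor>M\<rfloor>)"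
  have G0: "G \<ge> 0" using G[of M] NM norm_ge_zero order_trans by blast
  have b: "block N K = {?m..<Suc (nat \<lfloor>K\<rfloor>)}" for K using N by (intro block_eq) simp
  show ?thesis
  proof (cases "?m < ?k")
    case False
    hence "{?m..<?k} = {}" by simp
    thus ?thesis using G0 N unfolding b by (simp only: sum.empty norm_zero) simp
  next
    case True
    have "norm (\<Sum>n\<in>{?m..<?k}. of_real (1 / sqrt (real n)) * a n) \<le> 1 / sqrt (real ?m) * G"
    proof (rule abel_decreasing[OF _ _ _ True])
      fix j assume j: "?m < j" "j \<le> ?k"
      have "N < real (j - 1)" using j N by linarith
      moreover have "real (j - 1) \<le> M" using j N NM by linarith
      ultimately have "norm (\<Sum>n\<in>block N (real (j - 1)). a n) \<le> G" by (intro G) auto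
      moreover have "Suc (nat \<lfloor>real (j - 1)\<rfloor>) = j" using j by simp
      ultimately show "norm (\<Sum>n\<in>{?m..<j}. a n) \<le> G" unfolding b by (simp only:)
    qed (auto intro!: divide_left_mono)
    also have "\<dots> \<le> 1 / sqrt N * G"
    proof (rule mult_right_mono[OF _ G0])
      have "N \<le> real ?m" using N by linarith
      thus "1 / sqrt (real ?m) \<le> 1 / sqrt N" using N by (intro divide_left_mono) auto
    qed
    finally show ?thesis unfolding b by simp
  qed
qed

lemma block_class_split:
  fixes f :: "nat \<Rightarrow> complex"
  assumes C: "C \<ge> 1"
  shows "\<exists>p h. (\<forall>l. {x. l + C * x \<in> block N M} = {p l..<h l}) \<and>
    (\<Sum>n\<in>block N M. f n) = (\<Sum>l<C. \<Sum>x\<in>{p l..<h l}. f (l + C * x))"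
proof -
  have "\<exists>p h. {x. l + C * x \<in> block N M} = {p..<h}" for l
  proof (rule finite_convex_nat_set)
    have "finite ((\<lambda>x. l + C * x) -` block N M)"
      by (rule finite_vimageI) (use C in \<open>auto intro!: injI\<close>)
    thus "finite {x. l + C * x \<in> block N M}" by (simp add: vimage_def)
    fix x y z assume a: "x \<in> {x. l + C * x \<in> block N M}" "z \<in> {x. l + C * x \<in> block N M}" "x \<le> y" "y \<le> z"
    have "l + C * x \<le> l + C * y" "l + C * y \<le> l + C * z" using a by simp_all
    hence "real (l + C * x) \<le> real (l + C * y)" "real (l + C * y) \<le> real (l + C * z)"
      by (simp_all only: of_nat_le_iff)
    thus "y \<in> {x. l + C * x \<in> block N M}" using a unfolding block_def mem_Collect_eq by linarith
  qed
  then obtain p h where ph: "\<And>l. {x. l + C * x \<in> block N M} = {p l..<h l}" by metis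
  have "(\<Sum>n\<in>block N M. f n) = (\<Sum>l<C. \<Sum>n\<in>{n\<in>block N M. n mod C = l}. f n)"
    by (rule sum.group [symmetric]) (use C in auto)
  also have "\<dots> = (\<Sum>l<C. \<Sum>x\<in>{p l..<h l}. f (l + C * x))"
  proof (rule sum.cong[OF refl])
    fix l assume l: "l \<in> {..<C}"
    show "(\<Sum>n\<in>{n\<in>block N M. n mod C = l}. f n) = (\<Sum>x\<in>{p l..<h l}. f (l + C * x))"
    proof (rule sum.reindex_bij_witness[of _ "\<lambda>x. l + C * x" "\<lambda>n. n div C"])
      fix n assume n: "n \<in> {n\<in>block N M. n mod C = l}"
      show eq: "l + C * (n div C) = n" using n by auto
      have "n div C \<in> {x. l + C * x \<in> block N M}" using n eq by simp
      thus "n div C \<in> {p l..<h l}" unfolding ph .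
      show "f (l + C * (n div C)) = f n" unfolding eq ..
    next
      fix x assume "x \<in> {p l..<h l}"
      hence "l + C * x \<in> block N M" unfolding ph [symmetric] by simp
      thus "l + C * x \<in> {n\<in>block N M. n mod C = l}" using l by simp
      show "(l + C * x) div C = x" using l by simp
    qed
  qed
  finally show ?thesis using ph by blast
qed

section \<open>Sums over progressions with linear character phase\<close>

text \<open>\<open>residue_average\<close> for exponential sums with increasing increments:
  \<open>H1\<close> is supplied by Kuzmin-Landau and \<open>H2\<close> by the second derivative
  test.\<close>

lemma class_average:
  fixes phi :: "'a \<Rightarrow> nat \<Rightarrow> real" and u :: "'a \<Rightarrow> int"
  assumes fin: "finite I" and P: "P \<ge> 1" and V: "V \<ge> 0" and lam: "0 < lam" "lam \<le> 1/2"
    and mult: "\<And>c. real (card {l\<in>I. [u l = c] (mod int P)}) \<le> M"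
    and rng: "\<And>l x. l \<in> I \<Longrightarrow> p l \<le> x \<Longrightarrow> Suc x < h l \<Longrightarrow>
        of_int (u l) / real P + al \<le> phi l (Suc x) - phi l x \<and>
        phi l (Suc x) - phi l x \<le> of_int (u l) / real P + al + V"
    and step: "\<And>l x. l \<in> I \<Longrightarrow> p l \<le> x \<Longrightarrow> Suc (Suc x) < h l \<Longrightarrow>
        phi l (Suc x) - phi l x + lam \<le> phi l (Suc (Suc x)) - phi l (Suc x)"
  shows "(\<Sum>l\<in>I. norm (\<Sum>x\<in>{p l..<h l}. ee (phi l x)))
    \<le> M * ((2.83 / sqrt lam + 3) * (3 * V * real P + 6) + 2 * real P * (1 + ln (real P)))"
proof (rule residue_average[OF fin P _ V mult])
  fix l :: 'a and m :: int and eps :: real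
  assume l: "l \<in> I" and eps: "0 < eps" "eps \<le> 1/2"
    and lo: "of_int m + eps \<le> of_int (u l) / real P + al"
    and hi: "of_int (u l) / real P + al + V \<le> of_int m + 1 - eps"
  show "norm (\<Sum>x\<in>{p l..<h l}. ee (phi l x)) \<le> 1 / eps"
  proof (rule kuzmin_landau[OF eps, of _ _ _ m])
    fix x assume x: "p l \<le> x" "Suc x < h l"
    from rng[OF l this] show "of_int m + eps \<le> phi l (Suc x) - phi l x"
      "phi l (Suc x) - phi l x \<le> of_int m + 1 - eps" using lo hi by linarith+
  next
    fix x y assume x: "p l \<le> x" "x \<le> y" "Suc y < h l"
    from x(2,3) show "phi l (Suc x) - phi l x \<le> phi l (Suc y) - phi l y"
    proof (induction y rule: dec_induct)
      case (step n)
      thus ?case using assms(8)[OF l, of n] x(1) lam by simp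
    qed simp
  qed
next
  fix l assume l: "l \<in> I"
  show "norm (\<Sum>x\<in>{p l..<h l}. ee (phi l x)) \<le> of_int (\<lfloor>of_int (u l) / real P + al + V\<rfloor>
        - \<lfloor>of_int (u l) / real P + al\<rfloor> + 1) * (2.83 / sqrt lam + 3)"
    by (rule van_der_corput_cell[OF lam]) (use V rng[OF l] step[OF l] in auto)
qed (use lam in auto)

definition twist :: "(int \<Rightarrow> complex) \<Rightarrow> real \<Rightarrow> nat \<Rightarrow> complex" where
  "twist chi t n = chi (int n) * ee (- (t / (2 * pi)) * ln (real n))"

lemma exp_eq_ee:
  assumes "z = 2 * of_real pi * \<i> * of_real r"
  shows "exp z = ee r"
  unfolding ee_def cis_conv_exp assms by (simp add: mult_ac)

text \<open>Cancelling \<open>B\<close> makes the numerator a unit modulo \<open>D div B\<close>, so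
  that the slope modulo 1 determines the class of \<open>l\<close> modulo
  \<open>D div B\<close>.\<close>

lemma linear_phase:
  fixes Lt :: int
  assumes q: "q \<ge> 1" and chi: "dirichlet_character q chi"
    and phase: "\<And>x :: int. chi (1 + int C * x) = exp (2 * of_real pi * \<i> * of_int Lt * of_int x / of_nat D)"
    and B: "int B = gcd Lt (int D)" and D: "D \<ge> 1"
    and inv: "[int l * iv = 1] (mod int q)"
  shows "chi (int (l + C * x)) = chi (int l) * ee (of_int (Lt div int B * iv) / real (D div B) * real x)"
proof -
  have B0: "B > 0" using D B by (metis gcd_eq_0_iff of_nat_0 not_gr_zero of_nat_eq_0_iff not_one_le_zero)
  have B1: "int B dvd Lt" "B dvd D" using B by (metis gcd_dvd1, metis gcd_dvd2 int_dvd_int_iff)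
  have "chi (int (l + C * x)) = chi (int l) * chi (1 + int C * (iv * int x))"
    using dirichlet_character_shift[OF chi inv, of "int C" "int x"] by simp
  also have "chi (1 + int C * (iv * int x)) = ee (of_int (Lt div int B * iv) / real (D div B) * real x)"
    unfolding phase
  proof (rule exp_eq_ee)
    have "real_of_int Lt = of_int (Lt div int B) * real B"
      using B1 by (metis dvd_div_mult_self of_int_mult of_int_of_nat_eq)
    moreover have "real D = real (D div B) * real B" using B1 by (metis dvd_div_mult_self of_nat_mult)
    ultimately have "real_of_int Lt / real D = of_int (Lt div int B) / real (D div B)" using B0 by simp
    hence "of_int (Lt div int B * iv) / real (D div B) * real x = real_of_int Lt / real D * of_int iv * real x" by simp
    thus "2 * of_real pi * \<i> * of_int Lt * of_int (iv * int x) / of_nat D =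
      2 * complex_of_real pi * \<i> * of_real (of_int (Lt div int B * iv) / real (D div B) * real x)"
      by (simp only:) simp
  qed
  finally show ?thesis .
qed

lemma inverse_mod_exists:
  "\<exists>iv. \<forall>l::nat. coprime l q \<longrightarrow> [int l * iv l = 1] (mod int q)"
proof -
  have "\<forall>l::nat. \<exists>x. coprime l q \<longrightarrow> [int l * x = 1] (mod int q)"
    using cong_solve_coprime_int by (metis coprime_int_iff)
  thus ?thesis by metis
qed

text \<open>Comparison with the slope at \<open>2 * N\<close> instead of 0 saves a factor 2 against
  \<open>slope_le\<close>.\<close>

lemma slope_range:
  assumes "t > 0" "C > 0" "N > 0" "N \<le> y" "y \<le> 2 * N"
  shows "slope t C N - slope t C y \<le> t * C / (4 * pi * N)"
proof -
  have "slope t C N - slope t C y \<le> slope t C N - slope t C (2 * N)"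
    using assms slope_antimono[of t C y "2 * N"] by linarith
  also have "\<dots> = t / (2 * pi) * ln (2 * (N + C) / (2 * N + C))"
  proof -
    have "ln (2 * (N + C) / (2 * N + C)) = (ln (N + C) - ln N) - (ln (2 * N + C) - ln (2 * N))"
      using assms ln_mult[of 2 "N + C"] by (simp add: ln_div ln_mult del: distrib_left_numeral)
    thus ?thesis by (simp only: slope_def right_diff_distrib)
  qed
  also have "\<dots> \<le> t / (2 * pi) * (2 * (N + C) / (2 * N + C) - 1)"
    using assms by (intro mult_left_mono ln_le_minus_one) auto
  also have "2 * (N + C) / (2 * N + C) - 1 = C / (2 * N + C)" using assms by (simp add: field_simps)
  also have "C / (2 * N + C) \<le> C / (2 * N)" using assms by (intro divide_left_mono) auto
  hence "t / (2 * pi) * (C / (2 * N + C)) \<le> t / (2 * pi) * (C / (2 * N))" 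
    using assms by (intro mult_left_mono) auto
  finally show ?thesis by (simp add: mult_ac)
qed

text \<open>To be used with \<open>C1_of q\<close>, \<open>D1_of q\<close> and \<open>B1\<close>.
  \<open>P\<close> is the denominator of the character slopes in lowest terms.\<close>

locale linear_classes =
  fixes q C D B P :: nat and chi :: "int \<Rightarrow> complex" and t :: real and Lt :: int
  assumes q: "q \<ge> 1" and chi: "dirichlet_character q chi"
    and CD: "C * D = q" and DC: "D dvd C" and C_prime: "\<And>p. prime p \<Longrightarrow> p dvd q \<Longrightarrow> p dvd C"
    and phase: "\<And>x :: int. chi (1 + int C * x) = exp (2 * of_real pi * \<i> * of_int Lt * of_int x / of_nat D)"
    and B: "int B = gcd Lt (int D)" and P_def: "P = D div B" and t: "t > 0"
begin

lemma C: "C \<ge> 1" and D: "D \<ge> 1" using CD q by (cases C; cases D; auto)+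

lemma B0: "B > 0" and BD: "B dvd D" and PB: "P * B = D" and P1: "P \<ge> 1"
proof -
  show B0: "B > 0" using D B by (metis gcd_eq_0_iff of_nat_0 not_gr_zero of_nat_eq_0_iff not_one_le_zero)
  show BD: "B dvd D" using B by (metis gcd_dvd2 int_dvd_int_iff)
  show PB: "P * B = D" using BD by (simp add: P_def)
  show "P \<ge> 1" using PB D by (cases P) auto
qed

lemma coprime_P: "coprime (Lt div int B) (int P)"
proof -
  have "int P = int D div int B" by (simp add: P_def zdiv_int)
  moreover have "Lt \<noteq> 0 \<or> int D \<noteq> 0" using D by auto
  ultimately show ?thesis unfolding B using div_gcd_coprime[of Lt "int D"] by simp
qed

definition w where "w = Lt div int B"

definition I where "I = {l. l < C \<and> coprime l q}"

definition class_phase :: "int \<Rightarrow> nat \<Rightarrow> nat \<Rightarrow> real" where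
  "class_phase iv l x = of_int (w * iv) / real P * real x - t / (2 * pi) * ln (real l + real C * real x)"

text \<open>The common start of the three block estimates. On classes not coprime to
  \<open>q\<close> the character vanishes; on the others its constant factor \<open>chi l\<close>
  has modulus at most 1 and drops out.\<close>

lemma block_sum_le:
  "\<exists>p h iv. (\<forall>l. {x. l + C * x \<in> block N M} = {p l..<h l}) \<and>
    (\<forall>c. real (card {l\<in>I. [w * iv l = c] (mod int P)}) \<le> real C / real P) \<and>
    (\<forall>l. coprime l q \<longrightarrow> [int l * iv l = 1] (mod int q)) \<and>
    norm (\<Sum>n\<in>block N M. twist chi t n) \<le> (\<Sum>l\<in>I. norm (\<Sum>x\<in>{p l..<h l}. ee (class_phase (iv l) l x)))"
proof -
  obtain p h where ph: "\<And>l. {x. l + C * x \<in> block N M} = {p l..<h l}"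
    "(\<Sum>n\<in>block N M. twist chi t n) = (\<Sum>l<C. \<Sum>x\<in>{p l..<h l}. twist chi t (l + C * x))"
    using block_class_split[of C N M "twist chi t", OF C] by blast
  obtain iv where iv: "\<And>l::nat. coprime l q \<Longrightarrow> [int l * iv l = 1] (mod int q)"
    using inverse_mod_exists by metis
  let ?E = "\<lambda>l x. ee (class_phase (iv l) l x)"
  have z: "(\<Sum>x\<in>{p l..<h l}. twist chi t (l + C * x)) = 0" if "l \<in> {..<C} - I" for l
  proof (intro sum.neutral ballI)
    fix x
    have "\<not> coprime l q" using that by (simp add: I_def)
    hence "chi (int (l + C * x)) = 0" using C_prime by (intro dirichlet_character_eq_0[OF chi]) auto
    thus "twist chi t (l + C * x) = 0" by (simp only: twist_def mult_zero_left)
  qed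
  have e: "(\<Sum>x\<in>{p l..<h l}. twist chi t (l + C * x)) = chi (int l) * (\<Sum>x\<in>{p l..<h l}. ?E l x)"
    if "l \<in> I" for l
  proof -
    have "twist chi t (l + C * x) = chi (int l) * ?E l x" for x
    proof -
      have "[int l * iv l = 1] (mod int q)" using that by (intro iv) (simp add: I_def)
      from linear_phase[OF q chi phase B D this, of x, folded w_def P_def] show ?thesis
        by (simp add: twist_def class_phase_def ee_add [symmetric] mult.assoc)
    qed
    thus ?thesis by (simp add: sum_distrib_left)
  qed
  have fin: "finite I" by (simp add: I_def)
  have "(\<Sum>n\<in>block N M. twist chi t n) = (\<Sum>l\<in>I. \<Sum>x\<in>{p l..<h l}. twist chi t (l + C * x))"
    unfolding ph(2) by (rule sum.mono_neutral_right) (use z in \<open>auto simp: I_def\<close>)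
  also have "norm \<dots> \<le> (\<Sum>l\<in>I. norm (\<Sum>x\<in>{p l..<h l}. ?E l x))"
  proof (rule order_trans[OF norm_sum], rule sum_mono)
    fix l assume "l \<in> I"
    thus "norm (\<Sum>x\<in>{p l..<h l}. twist chi t (l + C * x)) \<le> norm (\<Sum>x\<in>{p l..<h l}. ?E l x)"
      unfolding e[OF \<open>l \<in> I\<close>] norm_mult using norm_dirichlet_character_le[OF chi]
      by (intro mult_left_le_one_le) auto
  qed
  finally have 1: "norm (\<Sum>n\<in>block N M. twist chi t n) \<le> (\<Sum>l\<in>I. norm (\<Sum>x\<in>{p l..<h l}. ?E l x))" .
  have 2: "real (card {l\<in>I. [w * iv l = c] (mod int P)}) \<le> real C / real P" for c
  proof (rule card_inverse_class_le[where q = q])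
    show "P \<ge> 1" by (rule P1)
    show "P dvd C" using PB DC by (metis dvd_mult_left dvd_trans dvd_triv_left)
    show "P dvd q" using PB CD by (metis dvd_mult dvd_trans dvd_triv_left dvd_triv_right)
    show "coprime w (int P)" unfolding w_def by (rule coprime_P)
  qed (use iv in \<open>auto simp: I_def\<close>)
  show ?thesis using ph(1) 1 2 iv by blast
qed

lemma class_phase_diff:
  "class_phase iv l (Suc x) - class_phase iv l x = of_int (w * iv) / real P - slope t (real C) (real l + real C * real x)"
proof -
  have "real l + real C * real (Suc x) = real l + real C * real x + real C" by (simp add: algebra_simps)
  thus ?thesis unfolding slope_def class_phase_def by (simp only:) (simp add: algebra_simps add_divide_distrib)
qed

text \<open>\<open>class_average\<close> with minus the slope at \<open>N\<close> as offset. On the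
  block the slope falls by at most \<open>t * C / (4 * pi * N)\<close> in all, and at each step by
  at least the amount under the square root, since \<open>y + C\<close> is at most
  \<open>2 * N\<close> there.\<close>

lemma block_vdc_bound:
  assumes N: "N > 0" and NM: "M \<le> 2 * N"
    and lam_le: "t * (real C)\<^sup>2 / (8 * pi * N\<^sup>2) \<le> 1/2"
  shows "norm (\<Sum>n\<in>block N M. twist chi t n) \<le> real C / real P *
    ((2.83 / sqrt (t * (real C)\<^sup>2 / (8 * pi * N\<^sup>2)) + 3) * (3 * (t * real C / (4 * pi * N)) * real P + 6)
      + 2 * real P * (1 + ln (real P)))"
proof -
  obtain p h iv where ph: "\<And>l. {x. l + C * x \<in> block N M} = {p l..<h l}"
    and mult: "\<And>c. real (card {l\<in>I. [w * iv l = c] (mod int P)}) \<le> real C / real P"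
    and le: "norm (\<Sum>n\<in>block N M. twist chi t n) \<le> (\<Sum>l\<in>I. norm (\<Sum>x\<in>{p l..<h l}. ee (class_phase (iv l) l x)))"
    using block_sum_le[of N M] by blast
  define lam where "lam = t * (real C)\<^sup>2 / (8 * pi * N\<^sup>2)"
  define V where "V = t * real C / (4 * pi * N)"
  have C0: "real C > 0" using C by simp
  have inb: "N < real l + real C * real x \<and> real l + real C * real x \<le> M" if "p l \<le> x" "x < h l" for l x
  proof -
    have "x \<in> {x. l + C * x \<in> block N M}" unfolding ph using that by simp
    thus ?thesis by (simp add: block_def)
  qed
  have "(\<Sum>l\<in>I. norm (\<Sum>x\<in>{p l..<h l}. ee (class_phase (iv l) l x)))
    \<le> real C / real P * ((2.83 / sqrt lam + 3) * (3 * V * real P + 6) + 2 * real P * (1 + ln (real P)))"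
  proof (rule class_average[where al = "- slope t (real C) N" and u = "\<lambda>l. w * iv l"])
    show "finite I" by (simp add: I_def)
    show "P \<ge> 1" by (rule P1)
    show "V \<ge> 0" using N t by (simp add: V_def)
    show "lam > 0" using N t C0 by (simp add: lam_def)
    show "lam \<le> 1/2" using lam_le by (simp add: lam_def)
    show "real (card {l\<in>I. [w * iv l = c] (mod int P)}) \<le> real C / real P" for c by (rule mult)
    fix l x
    {
      assume x: "p l \<le> x" "Suc x < h l"
      define y where "y = real l + real C * real x"
      have y: "N < y" "y \<le> 2 * N" using inb[of l x] x NM by (auto simp: y_def)
      have "slope t (real C) y \<le> slope t (real C) N" using y N t C0 by (intro slope_antimono) auto
      moreover have "slope t (real C) N - slope t (real C) y \<le> V"
        unfolding V_def using y N t C0 by (intro slope_range) auto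
      ultimately show "of_int (w * iv l) / real P + - slope t (real C) N
        \<le> class_phase (iv l) l (Suc x) - class_phase (iv l) l x \<and>
        class_phase (iv l) l (Suc x) - class_phase (iv l) l x
        \<le> of_int (w * iv l) / real P + - slope t (real C) N + V"
        unfolding class_phase_diff y_def [symmetric] by auto
    }
    assume x: "p l \<le> x" "Suc (Suc x) < h l"
    define y where "y = real l + real C * real x"
    have y: "N < y" using inb[of l x] x by (auto simp: y_def)
    have yS: "real l + real C * real (Suc x) = y + real C" by (simp add: y_def algebra_simps)
    have yC: "y + real C \<le> 2 * N" using inb[of l "Suc x"] x NM unfolding yS by auto
    have "lam \<le> t / (2 * pi) * (real C / (y + real C))\<^sup>2"
    proof -
      have "lam = t / (2 * pi) * (real C / (2 * N))\<^sup>2" by (simp add: lam_def power2_eq_square)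
      also have "\<dots> \<le> t / (2 * pi) * (real C / (y + real C))\<^sup>2"
        using yC y N t C0 by (intro mult_left_mono power_mono divide_left_mono) auto
      finally show ?thesis .
    qed
    also have "\<dots> \<le> slope t (real C) y - slope t (real C) (y + real C)"
      using y N t C0 by (intro slope_diff_ge) auto
    finally show "class_phase (iv l) l (Suc x) - class_phase (iv l) l x + lam
        \<le> class_phase (iv l) l (Suc (Suc x)) - class_phase (iv l) l (Suc x)"
      unfolding class_phase_diff yS unfolding y_def [symmetric] by simp
  qed
  thus ?thesis using le unfolding lam_def V_def by linarith
qed

text \<open>For \<open>P = 1\<close> the character adds only integers to the increments. The slope
  of the logarithm stays between \<open>eps\<close> and \<open>2 * eps\<close> on the block, with
  \<open>eps\<close> at most 1/4, so Kuzmin-Landau applies to every class.\<close>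

lemma block_kl_bound:
  assumes P: "P = 1" and N: "N \<ge> t * real C / pi" and NM: "M \<le> 2 * N"
  shows "norm (\<Sum>n\<in>block N M. twist chi t n) \<le> 4 * pi * N / t"
proof -
  obtain p h iv where ph: "\<And>l. {x. l + C * x \<in> block N M} = {p l..<h l}"
    and le: "norm (\<Sum>n\<in>block N M. twist chi t n) \<le> (\<Sum>l\<in>I. norm (\<Sum>x\<in>{p l..<h l}. ee (class_phase (iv l) l x)))"
    using block_sum_le[of N M] by blast
  have C0: "real C > 0" using C by simp
  have "t * real C / pi > 0" using C0 t by simp
  hence N0: "N > 0" using N by linarith
  have inb: "N < real l + real C * real x \<and> real l + real C * real x \<le> M" if "p l \<le> x" "x < h l" for l x
  proof -
    have "x \<in> {x. l + C * x \<in> block N M}" unfolding ph using that by simp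
    thus ?thesis by (simp add: block_def)
  qed
  define eps where "eps = t * real C / (4 * pi * N)"
  have eps0: "eps > 0" using C0 t N0 by (simp add: eps_def)
  have eps4: "eps \<le> 1/4" using N N0 by (simp add: eps_def field_simps)
  have "norm (\<Sum>x\<in>{p l..<h l}. ee (class_phase (iv l) l x))
     \<le> 1 / eps" for l
  proof (rule kuzmin_landau[where m = "w * iv l - 1"])
    show "0 < eps" "eps \<le> 1/2" using eps0 eps4 by auto
  next
    fix x assume x: "p l \<le> x" "Suc x < h l"
    define y where "y = real l + real C * real x"
    have y: "N < y" using inb[of l x] x by (auto simp: y_def)
    have yS: "real l + real C * real (Suc x) = y + real C" by (simp add: y_def algebra_simps)
    have yC: "y + real C \<le> 2 * N" using inb[of l "Suc x"] x NM unfolding yS by auto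
    have "eps = t * real C / (2 * pi * (2 * N))" by (simp add: eps_def)
    also have "\<dots> \<le> t * real C / (2 * pi * (y + real C))"
      using yC y N0 C0 t by (intro divide_left_mono mult_left_mono mult_pos_pos) auto
    also have "\<dots> \<le> slope t (real C) y" using y N0 C0 t by (intro slope_ge) auto
    finally have s1: "eps \<le> slope t (real C) y" .
    have "slope t (real C) y \<le> slope t (real C) N" using y N0 C0 t by (intro slope_antimono) auto
    also have "\<dots> \<le> t * real C / (2 * pi * N)" using N0 C0 t by (intro slope_le) auto
    also have "\<dots> = 2 * eps" by (simp add: eps_def)
    finally have s2: "slope t (real C) y \<le> 1 - eps" using eps4 by simp
    have d: "class_phase (iv l) l (Suc x) - class_phase (iv l) l x = of_int (w * iv l) - slope t (real C) y"
      unfolding class_phase_diff y_def [symmetric] using P by simp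
    show "of_int (w * iv l - 1) + eps \<le> class_phase (iv l) l (Suc x) - class_phase (iv l) l x"
      unfolding d using s2 by simp
    show "class_phase (iv l) l (Suc x) - class_phase (iv l) l x \<le> of_int (w * iv l - 1) + 1 - eps"
      unfolding d using s1 by simp
  next
    fix x y assume x: "p l \<le> x" "x \<le> y" "Suc y < h l"
    have a: "N < real l + real C * real x" "real l + real C * real x \<le> real l + real C * real y" 
      using inb[of l x] x C0 by auto
    thus "class_phase (iv l) l (Suc x) - class_phase (iv l) l x
      \<le> class_phase (iv l) l (Suc y) - class_phase (iv l) l y"
      unfolding class_phase_diff
      using slope_antimono[of t "real C" "real l + real C * real x" "real l + real C * real y"] N0 t C0 by auto
  qed
  hence "(\<Sum>l\<in>I. norm (\<Sum>x\<in>{p l..<h l}. ee (class_phase (iv l) l x)))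
    \<le> real (card I) * (1 / eps)" by (rule sum_bounded_above)
  also have "\<dots> \<le> real C * (1 / eps)"
  proof (rule mult_right_mono)
    have "card I \<le> card {..<C}" by (rule card_mono) (auto simp: I_def)
    thus "real (card I) \<le> real C" by simp
  qed (use eps0 in simp)
  also have "\<dots> = 4 * pi * N / t" using C0 by (simp add: eps_def)
  finally show ?thesis using le by linarith
qed

text \<open>For \<open>P\<close> at least 2 the numerators are units modulo \<open>P\<close>, so the
  residue 0 does not occur. Beyond \<open>t * q\<close> the slope of the logarithm is at most
  \<open>1 / (2 * P)\<close>, and the increments for the residue \<open>j\<close> lie between
  \<open>j / (2 * P)\<close> and \<open>j / P\<close> modulo 1. The bound is uniform in
  \<open>M\<close> and thus controls the infinite tail.\<close>

lemma block_tail_bound: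
  assumes P: "P \<ge> 2" and N: "N \<ge> t * real q"
  shows "norm (\<Sum>n\<in>block N M. twist chi t n) \<le> 3 * real C * (1 + ln (real P))"
proof -
  obtain p h iv where ph: "\<And>l. {x. l + C * x \<in> block N M} = {p l..<h l}"
    and mult: "\<And>c. real (card {l\<in>I. [w * iv l = c] (mod int P)}) \<le> real C / real P"
    and iv: "\<And>l. coprime l q \<Longrightarrow> [int l * iv l = 1] (mod int q)"
    and le: "norm (\<Sum>n\<in>block N M. twist chi t n) \<le> (\<Sum>l\<in>I. norm (\<Sum>x\<in>{p l..<h l}. ee (class_phase (iv l) l x)))"
    using block_sum_le[of N M] by blast
  have C0: "real C > 0" and P0: "real P > 0" using C P by auto
  have "t * real q > 0" using q t by simp
  hence N0: "N > 0" using N by linarith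
  have inb: "N < real l + real C * real x" if "p l \<le> x" "x < h l" for l x
  proof -
    have "x \<in> {x. l + C * x \<in> block N M}" unfolding ph using that by simp
    thus ?thesis by (simp add: block_def)
  qed
  have sN: "slope t (real C) N \<le> 1 / (2 * real P)"
  proof -
    have "slope t (real C) N \<le> t * real C / (2 * pi * N)" using N0 C0 t by (intro slope_le) auto
    also have "\<dots> \<le> t * real C / (2 * 1 * (t * real q))"
      using N N0 t C0 q pi_ge_two by (intro divide_left_mono mult_mono mult_pos_pos) auto
    also have "\<dots> = 1 / (2 * real D)" using t C0 by (simp add: CD [symmetric])
    also have "\<dots> \<le> 1 / (2 * real P)"
    proof (intro divide_left_mono)
      have "P \<le> D" using PB D by (metis dvd_imp_le dvd_triv_left less_le_trans zero_less_one)
      thus "2 * real P \<le> 2 * real D" by simp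
    qed (use P D in auto)
    finally show ?thesis .
  qed
  define J where "J = (\<lambda>l. nat ((w * iv l) mod int P))"
  have J: "J l \<in> {1..P - 1}" if l: "l \<in> I" for l
  proof -
    have "coprime (iv l) (int P)"
    proof -
      have "P dvd q" using PB CD by (metis dvd_mult dvd_trans dvd_triv_left dvd_triv_right)
      hence "[int l * iv l = 1] (mod int P)" using cong_dvd_modulus[OF iv] l by (simp add: I_def)
      thus ?thesis by (metis cong_imp_coprime cong_sym coprime_1_left coprime_mult_left_iff)
    qed
    hence "coprime (w * iv l) (int P)" using coprime_P by (simp add: w_def)
    hence "is_unit (int P)" if "int P dvd w * iv l"
      using that coprime_common_divisor dvd_refl by blast
    hence "(w * iv l) mod int P \<noteq> 0" using P by (auto simp: mod_eq_0_iff_dvd)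
    moreover have "0 \<le> (w * iv l) mod int P" "(w * iv l) mod int P < int P" using P by auto
    ultimately show ?thesis by (auto simp: J_def nat_less_iff)
  qed
  define G where "G = (\<lambda>j. 2 * real P / real j + real P / real (P - j))"
  have TG: "norm (\<Sum>x\<in>{p l..<h l}. ee (class_phase (iv l) l x))
     \<le> G (J l)" if l: "l \<in> I" for l
  proof -
    let ?j = "J l"
    have j: "1 \<le> ?j" "?j < P" using J[OF l] P by auto
    define e1 where "e1 = real ?j / (2 * real P)"
    define e2 where "e2 = real (P - ?j) / real P"
    define eps where "eps = min e1 e2"
    have e: "e1 > 0" "e2 > 0" using j P0 by (auto simp: e1_def e2_def)
    have e1h: "e1 \<le> 1/2" using j P0 by (simp add: e1_def field_simps)
    define m where "m = (w * iv l) div int P"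
    have "w * iv l = int P * m + int ?j" using P by (simp add: m_def J_def)
    hence "real_of_int (w * iv l) = real P * of_int m + real ?j" by (metis of_int_add of_int_mult of_int_of_nat_eq)
    hence th: "of_int (w * iv l) / real P = of_int m + real ?j / real P" using P0 by (simp add: field_simps)
    have "norm (\<Sum>x\<in>{p l..<h l}. ee (class_phase (iv l) l x))
      \<le> 1 / eps"
    proof (rule kuzmin_landau[where m = m])
      show "0 < eps" "eps \<le> 1/2" using e e1h by (auto simp: eps_def)
    next
      fix x assume x: "p l \<le> x" "Suc x < h l"
      define y where "y = real l + real C * real x"
      have y: "N < y" using inb[of l x] x by (auto simp: y_def)
      have "0 \<le> t * real C / (2 * pi * (y + real C))" using y N0 C0 t by auto
      also have "\<dots> \<le> slope t (real C) y" using y N0 C0 t by (intro slope_ge) auto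
      finally have s1: "0 \<le> slope t (real C) y" .
      have "slope t (real C) y \<le> slope t (real C) N" using y N0 C0 t by (intro slope_antimono) auto
      also note sN
      also have "1 / (2 * real P) \<le> real ?j / (2 * real P)" using j P0 by (intro divide_right_mono) auto
      finally have s2: "slope t (real C) y \<le> e1" by (simp add: e1_def)
      have d: "class_phase (iv l) l (Suc x) - class_phase (iv l) l x
         = of_int m + real ?j / real P - slope t (real C) y"
        unfolding class_phase_diff y_def [symmetric] th by simp
      have jj: "real ?j / real P = 2 * e1" "real ?j / real P = 1 - e2"
        using j P0 by (auto simp: e1_def e2_def of_nat_diff field_simps)
      show "of_int m + eps \<le> class_phase (iv l) l (Suc x) - class_phase (iv l) l x"
        unfolding d using s2 jj by (simp add: eps_def)
      show "class_phase (iv l) l (Suc x) - class_phase (iv l) l x \<le> of_int m + 1 - eps"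
        unfolding d using s1 jj by (simp add: eps_def)
    next
      fix x y assume x: "p l \<le> x" "x \<le> y" "Suc y < h l"
      have a: "N < real l + real C * real x" "real l + real C * real x \<le> real l + real C * real y" 
        using inb[of l x] x C0 by auto
      thus "class_phase (iv l) l (Suc x) - class_phase (iv l) l x
        \<le> class_phase (iv l) l (Suc y) - class_phase (iv l) l y"
        unfolding class_phase_diff
        using slope_antimono[of t "real C" "real l + real C * real x" "real l + real C * real y"] N0 t C0 by auto
    qed
    also have "\<dots> \<le> 1 / e1 + 1 / e2" using e by (auto simp: eps_def min_def)
    also have "\<dots> = G ?j" by (simp add: G_def e1_def e2_def)
    finally show ?thesis .
  qed
  have finI: "finite I" by (simp add: I_def)
  have "(\<Sum>l\<in>I. norm (\<Sum>x\<in>{p l..<h l}. ee (class_phase (iv l) l x)))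
    \<le> (\<Sum>l\<in>I. G (J l))" by (intro sum_mono TG)
  also have "\<dots> = (\<Sum>j=1..P - 1. \<Sum>l\<in>{l\<in>I. J l = j}. G (J l))"
    by (rule sum.group [symmetric]) (use finI J in auto)
  also have "\<dots> = (\<Sum>j=1..P - 1. real (card {l\<in>I. J l = j}) * G j)"
    by (intro sum.cong refl) simp
  also have "\<dots> \<le> (\<Sum>j=1..P - 1. real C / real P * G j)"
  proof (intro sum_mono mult_right_mono)
    fix j
    have "{l\<in>I. J l = j} \<subseteq> {l\<in>I. [w * iv l = int j] (mod int P)}"
      using P by (auto simp: J_def cong_def)
    hence "card {l\<in>I. J l = j} \<le> card {l\<in>I. [w * iv l = int j] (mod int P)}"
      using finI by (intro card_mono) auto
    thus "real (card {l\<in>I. J l = j}) \<le> real C / real P" using mult[of "int j"] by linarith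
  qed (simp add: G_def)
  also have "\<dots> = real C / real P * (2 * real P * (\<Sum>j=1..P - 1. 1 / real j) + real P * (\<Sum>j=1..P - 1. 1 / real (P - j)))"
  proof -
    have "(\<Sum>j=1..P - 1. G j) = 2 * real P * (\<Sum>j=1..P - 1. 1 / real j) + real P * (\<Sum>j=1..P - 1. 1 / real (P - j))"
      by (simp add: G_def sum.distrib sum_distrib_left)
    thus ?thesis by (simp only: sum_distrib_left [symmetric])
  qed
  also have "(\<Sum>j=1..P - 1. 1 / real (P - j)) = (\<Sum>j=1..P - 1. 1 / real j)"
    by (rule sum.reindex_bij_witness[of _ "\<lambda>j. P - j" "\<lambda>j. P - j"]) auto
  also have "real C / real P * (2 * real P * (\<Sum>j=1..P - 1. 1 / real j) + real P * (\<Sum>j=1..P - 1. 1 / real j))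
     = 3 * real C * (\<Sum>j=1..P - 1. 1 / real j)" using P0 by (simp add: field_simps)
  also have "(\<Sum>j=1..P - 1. 1 / real j) \<le> 1 + ln (real P)"
  proof -
    have "(\<Sum>j=1..P - 1. 1 / real j) \<le> (\<Sum>j=1..P. 1 / real j)" by (intro sum_mono2) auto
    also have "\<dots> \<le> 1 + ln (real P)" using P by (intro sum_inverse_le_ln) auto
    finally show ?thesis .
  qed
  hence "3 * real C * (\<Sum>j=1..P - 1. 1 / real j) \<le> 3 * real C * (1 + ln (real P))"
    by (intro mult_left_mono) auto
  finally show ?thesis using le by linarith
qed

end

section \<open>Sums over progressions with quadratic character phase\<close>

text \<open>A shift by \<open>r\<close> steps is telescoped into single steps. This gives the range
  of the increments after differencing; the next lemma gives their growth.\<close>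

lemma slope_shift_bounds:
  assumes "t > 0" "C > 0" "N > 0" "N \<le> y"
  shows "0 \<le> slope t C y - slope t C (y + real r * C)"
    "slope t C y - slope t C (y + real r * C) \<le> real r * (t * C\<^sup>2 / (2 * pi * N\<^sup>2))"
proof -
  have rC: "real r * C \<ge> 0" using assms by simp
  show "0 \<le> slope t C y - slope t C (y + real r * C)"
    using slope_antimono[of t C y "y + real r * C"] assms rC by simp
  show "slope t C y - slope t C (y + real r * C) \<le> real r * (t * C\<^sup>2 / (2 * pi * N\<^sup>2))"
  proof (induction r)
    case (Suc r)
    define z where "z = y + real r * C"
    have z1: "z \<ge> N" using assms by (auto simp: z_def intro: add_increasing2)
    hence z: "z \<ge> N" "z > 0" using assms by linarith+
    have "slope t C z - slope t C (z + C) \<le> t / (2 * pi) * (C / z)\<^sup>2"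
      using assms z by (intro slope_diff_le) auto
    also have "\<dots> \<le> t / (2 * pi) * (C / N)\<^sup>2"
      using assms z by (intro mult_left_mono power_mono divide_left_mono) auto
    also have "\<dots> = t * C\<^sup>2 / (2 * pi * N\<^sup>2)" by (simp add: power_divide)
    finally have "slope t C z - slope t C (z + C) \<le> t * C\<^sup>2 / (2 * pi * N\<^sup>2)" .
    moreover have "y + real (Suc r) * C = z + C" by (simp add: z_def algebra_simps)
    moreover have "real (Suc r) * k = real r * k + k" for k :: real by (simp add: algebra_simps)
    ultimately show ?case using Suc.IH unfolding z_def [symmetric] by (simp only:)
  qed simp
qed

lemma slope_shift_step:
  assumes "t > 0" "C > 0" "N > 0" "y > 0" "y + (real r + 1) * C \<le> 2 * N"
  shows "real r * (t * C ^ 3 / (8 * pi * N ^ 3)) \<le> (slope t C y - slope t C (y + real r * C))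
      - (slope t C (y + C) - slope t C (y + C + real r * C))"
  using assms(5)
proof (induction r)
  case (Suc r)
  define z where "z = y + real r * C"
  have z: "z > 0" using assms by (auto simp: z_def intro: add_pos_nonneg)
  have z2: "z + 2 * C \<le> 2 * N" using Suc.prems by (simp add: z_def algebra_simps)
  have "t * C ^ 3 / (8 * pi * N ^ 3) = t / pi * (C / (2 * N)) ^ 3" by (simp add: power3_eq_cube)
  also have "\<dots> \<le> t / pi * (C / (z + 2 * C)) ^ 3"
    using assms z z2 by (intro mult_left_mono power_mono divide_left_mono) auto
  also have "\<dots> \<le> (slope t C z - slope t C (z + C)) - (slope t C (z + C) - slope t C (z + 2 * C))"
    using assms z by (intro slope_diff2_ge) auto
  finally have "t * C ^ 3 / (8 * pi * N ^ 3) \<le> \<dots>" .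
  moreover have "real r * (t * C ^ 3 / (8 * pi * N ^ 3)) \<le> (slope t C y - slope t C z)
      - (slope t C (y + C) - slope t C (z + C))"
  proof -
    have "y + (real r + 1) * C \<le> 2 * N" using Suc.prems assms(2) by (simp add: algebra_simps)
    from Suc.IH[OF this] show ?thesis by (simp add: z_def add_ac)
  qed
  moreover have "y + real (Suc r) * C = z + C" "y + C + real (Suc r) * C = z + 2 * C"
    by (simp_all add: z_def algebra_simps)
  moreover have "real (Suc r) * k = real r * k + k" for k :: real by (simp add: algebra_simps)
  ultimately show ?case by (simp only:)
qed simp

locale quadratic_classes =
  fixes q C D B :: nat and chi :: "int \<Rightarrow> complex" and t :: real and L0 L :: int
  assumes q: "q \<ge> 1" and chi: "dirichlet_character q chi"
    and C: "C \<ge> 1" and D: "D \<ge> 1" and Dq: "D dvd q" and DC: "D dvd 2 * C"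
    and C_prime: "\<And>p. prime p \<Longrightarrow> p dvd q \<Longrightarrow> p dvd C"
    and phase: "\<And>x :: int. chi (1 + int C * x)
           = exp (4 * of_real pi * \<i> * of_int L0 * of_int x / of_nat (C * D)
                  + 2 * of_real pi * \<i> * of_int L * of_int x ^ 2 / of_nat D)"
    and B: "int B = gcd L (int D)" and t: "t > 0"
begin

definition I where "I = {l. l < C \<and> coprime l q}"

text \<open>\<open>g r\<close>, \<open>P r\<close> and \<open>w r\<close> put the fraction
  \<open>- 2 * L * r / D\<close> into lowest terms, as common factor, denominator and numerator. The
  sign is that of the negated phase in \<open>class_phase_diff2\<close>.\<close>

definition g where "g r = nat (gcd (2 * L * int r) (int D))"

lemma g: "int (g r) = gcd (2 * L * int r) (int D)" by (simp add: g_def)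

lemma g_pos: "g r > 0" using g[of r] D by (metis gcd_eq_0_iff of_nat_0 not_gr_zero of_nat_eq_0_iff not_one_le_zero)

lemma g_dvd: "g r dvd D" "int (g r) dvd 2 * L * int r"
  using g[of r] by (metis gcd_dvd2 int_dvd_int_iff, metis gcd_dvd1)

definition P where "P r = D div g r"

lemma P_g: "P r * g r = D" using g_dvd by (simp add: P_def)

lemma P_pos: "P r \<ge> 1" using P_g[of r] D by (cases "P r") auto

lemma P_dvd: "P r dvd D" using P_g[of r] by (metis dvd_triv_left)

definition w where "w r = - (2 * L * int r div int (g r))"

lemma w_g: "w r * int (g r) = - (2 * L * int r)" using g_dvd(2)[of r] by (simp add: w_def)

lemma coprime_w: "coprime (w r) (int (P r))"
proof -
  have "int (P r) = int D div int (g r)" by (simp add: P_def zdiv_int)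
  moreover have "2 * L * int r \<noteq> 0 \<or> int D \<noteq> 0" using D by auto
  ultimately show ?thesis unfolding w_def g using div_gcd_coprime[of "2 * L * int r" "int D"] by simp
qed

lemma w_div_P: "of_int (w r) / real (P r) = - (2 * real_of_int L * real r / real D)"
proof -
  have "real_of_int (w r) * real (g r) = - (2 * real_of_int L * real r)"
    using arg_cong[OF w_g[of r], of real_of_int] by simp
  moreover have "real D = real (P r) * real (g r)" using P_g[of r] by (metis of_nat_mult)
  moreover have "real (g r) > 0" "real (P r) > 0" using g_pos[of r] P_pos[of r] by auto
  ultimately show ?thesis by (simp add: field_simps)
qed

definition class_phase :: "int \<Rightarrow> nat \<Rightarrow> nat \<Rightarrow> real" where
  "class_phase iv l x = 2 * of_int (L0 * iv) / real (C * D) * real x + of_int L * (of_int iv)\<^sup>2 / real D * (real x)\<^sup>2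
     - t / (2 * pi) * ln (real l + real C * real x)"

lemma twist_class:
  assumes "[int l * iv = 1] (mod int q)"
  shows "twist chi t (l + C * x) = chi (int l) * ee (class_phase iv l x)"
proof -
  have "chi (int (l + C * x)) = chi (int l) * chi (1 + int C * (iv * int x))"
    using dirichlet_character_shift[OF chi assms, of "int C" "int x"] by simp
  also have "chi (1 + int C * (iv * int x)) = ee (2 * of_int (L0 * iv) / real (C * D) * real x
      + of_int L * (of_int iv)\<^sup>2 / real D * (real x)\<^sup>2)"
    unfolding phase by (rule exp_eq_ee) (simp add: field_simps power2_eq_square)
  finally show ?thesis by (simp add: twist_def class_phase_def ee_add [symmetric] mult.assoc)
qed

text \<open>Differencing by \<open>r\<close> makes the term in \<open>L\<close> linear and the term
  in \<open>L0\<close> constant, so that \<open>L0\<close> drops out of the increments. The phase is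
  negated to make its increments increasing.\<close>

lemma class_phase_diff2:
  defines "psi \<equiv> \<lambda>iv l r y. - (class_phase iv l (y + r) - class_phase iv l y)"
  shows "psi iv l r (Suc y) - psi iv l r y = of_int (w r * iv\<^sup>2) / real (P r)
    - (slope t (real C) (real l + real C * real y) - slope t (real C) (real l + real C * real y + real r * real C))"
proof -
  define z where "z = real l + real C * real y"
  have e: "real l + real C * real (Suc y) = z + real C" "real l + real C * real (y + r) = z + real r * real C"
    "real l + real C * real (Suc y + r) = z + real r * real C + real C" by (simp_all add: z_def algebra_simps)
  have "of_int (w r * iv\<^sup>2) / real (P r) = of_int (w r) / real (P r) * (of_int iv)\<^sup>2" by simp
  also have "\<dots> = - (2 * real_of_int L * real r / real D * (of_int iv)\<^sup>2)" unfolding w_div_P by simp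
  finally have w': "of_int (w r * iv\<^sup>2) / real (P r) = - (of_int L * (of_int iv)\<^sup>2 / real D * (2 * real r))" by simp
  define k where "k = of_int L * (of_int iv)\<^sup>2 / real D"
  define k0 where "k0 = 2 * of_int (L0 * iv) / real (C * D)"
  show ?thesis unfolding psi_def class_phase_def slope_def e w' unfolding z_def [symmetric] 
      k_def [symmetric] k0_def [symmetric]
    by (simp add: algebra_simps power2_eq_square)
qed

lemma correlation_sum_le:
  assumes N: "N > 0" and NM: "M \<le> 2 * N" and r: "r \<ge> 1"
    and ph: "\<And>l. {x. l + C * x \<in> block N M} = {p l..<h l}"
    and iv: "\<And>l. coprime l q \<Longrightarrow> [int l * iv l = 1] (mod int q)"
    and lam: "real r * (t * real C ^ 3 / (8 * pi * N ^ 3)) \<le> 1/2"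
  shows "(\<Sum>l\<in>I. norm (\<Sum>y\<in>{p l..<h l - r}. ee (class_phase (iv l) l (y + r) - class_phase (iv l) l y)))
    \<le> 2 * real C * real (sqrt_one_count D) / real (P r) *
      ((2.83 / sqrt (real r * (t * real C ^ 3 / (8 * pi * N ^ 3))) + 3)
         * (3 * (real r * (t * (real C)\<^sup>2 / (2 * pi * N\<^sup>2))) * real (P r) + 6)
       + 2 * real (P r) * (1 + ln (real (P r))))"
proof -
  define V where "V = real r * (t * (real C)\<^sup>2 / (2 * pi * N\<^sup>2))"
  define psi where "psi = (\<lambda>l y. - (class_phase (iv l) l (y + r) - class_phase (iv l) l y))"
  have C0: "real C > 0" using C by simp
  have inb: "N < real l + real C * real x \<and> real l + real C * real x \<le> M" if "p l \<le> x" "x < h l" for l x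
  proof -
    have "x \<in> {x. l + C * x \<in> block N M}" unfolding ph using that by simp
    thus ?thesis by (simp add: block_def)
  qed
  have psi_diff: "psi l (Suc y) - psi l y = of_int (w r * (iv l)\<^sup>2) / real (P r)
    - (slope t (real C) (real l + real C * real y) - slope t (real C) (real l + real C * real y + real r * real C))" for l y
    unfolding psi_def by (rule class_phase_diff2)
  have "(\<Sum>l\<in>I. norm (\<Sum>y\<in>{p l..<h l - r}. ee (psi l y)))
    \<le> 2 * real C * real (sqrt_one_count D) / real (P r) *
      ((2.83 / sqrt (real r * (t * real C ^ 3 / (8 * pi * N ^ 3))) + 3) * (3 * V * real (P r) + 6)
       + 2 * real (P r) * (1 + ln (real (P r))))"
  \<comment> \<open>The offset is \<open>- V\<close> because the subtracted difference of slopes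
    lies between 0 and \<open>V\<close>.\<close>
  proof (rule class_average[where al = "- V" and u = "\<lambda>l. w r * (iv l)\<^sup>2"])
    show "finite I" by (simp add: I_def)
    show "P r \<ge> 1" by (rule P_pos)
    show "V \<ge> 0" using t by (simp add: V_def)
    show "real r * (t * real C ^ 3 / (8 * pi * N ^ 3)) > 0" using N t C0 r by simp
    show "real r * (t * real C ^ 3 / (8 * pi * N ^ 3)) \<le> 1/2" by (rule lam)
    show "real (card {l\<in>I. [w r * (iv l)\<^sup>2 = c] (mod int (P r))})
        \<le> 2 * real C * real (sqrt_one_count D) / real (P r)" for c
      by (rule card_inverse_square_class_le[where q = q])
         (use P_pos P_dvd D Dq DC coprime_w iv in \<open>auto simp: I_def\<close>)
    fix l y
    {
      assume y: "p l \<le> y" "Suc y < h l - r"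
      have "N < real l + real C * real y" using inb[of l y] y by auto
      hence "0 \<le> slope t (real C) (real l + real C * real y) - slope t (real C) (real l + real C * real y + real r * real C)"
        "slope t (real C) (real l + real C * real y) - slope t (real C) (real l + real C * real y + real r * real C) \<le> V"
        unfolding V_def using slope_shift_bounds[of t "real C" N] t C0 N by auto
      thus "of_int (w r * (iv l)\<^sup>2) / real (P r) + - V \<le> psi l (Suc y) - psi l y \<and>
        psi l (Suc y) - psi l y \<le> of_int (w r * (iv l)\<^sup>2) / real (P r) + - V + V"
        unfolding psi_diff by auto
    }
    assume y: "p l \<le> y" "Suc (Suc y) < h l - r"
    define z where "z = real l + real C * real y"
    have "real l + real C * real (Suc y + r) \<le> M" using inb[of l "Suc y + r"] y by auto
    hence z2: "z + (real r + 1) * real C \<le> 2 * N" using NM by (simp add: z_def algebra_simps)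
    have "N < z" using inb[of l y] y by (auto simp: z_def)
    hence z0: "z > 0" using N by linarith
    have zS: "real l + real C * real (Suc y) = z + real C" by (simp add: z_def algebra_simps)
    show "psi l (Suc y) - psi l y + real r * (t * real C ^ 3 / (8 * pi * N ^ 3))
        \<le> psi l (Suc (Suc y)) - psi l (Suc y)"
      unfolding psi_diff zS z_def [symmetric]
      using slope_shift_step[of t "real C" N z r] t C0 N z0 z2 by linarith
  qed
  also have "(\<Sum>l\<in>I. norm (\<Sum>y\<in>{p l..<h l - r}. ee (psi l y)))
    = (\<Sum>l\<in>I. norm (\<Sum>y\<in>{p l..<h l - r}. ee (class_phase (iv l) l (y + r) - class_phase (iv l) l y)))"
    unfolding psi_def ee_uminus by (simp flip: cnj_sum)
  finally show ?thesis unfolding V_def .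
qed

text \<open>Cauchy-Schwarz over the classes comes before their correlations are estimated. In this
  way the correlations of one shift are summed over all classes, as
  \<open>correlation_sum_le\<close> requires. \<open>K\<close> bounds the number of terms of a class
  in the block.\<close>

lemma block_weyl:
  assumes N: "N > 0" and NM: "M \<le> 2 * N" and R: "R \<ge> 1"
    and lam: "real R * (t * real C ^ 3 / (8 * pi * N ^ 3)) \<le> 1/2"
  defines "K \<equiv> N / real C + 1"
  shows "(norm (\<Sum>n\<in>block N M. twist chi t n))\<^sup>2 \<le> real C * ((K + real R) / real R) *
    (real C * K + 2 * (\<Sum>r=1..<R. 2 * real C * real (sqrt_one_count D) / real (P r) *
      ((2.83 / sqrt (real r * (t * real C ^ 3 / (8 * pi * N ^ 3))) + 3)
         * (3 * (real r * (t * (real C)\<^sup>2 / (2 * pi * N\<^sup>2))) * real (P r) + 6)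
       + 2 * real (P r) * (1 + ln (real (P r))))))"
proof -
  define X where "X = (\<lambda>r. 2 * real C * real (sqrt_one_count D) / real (P r) *
      ((2.83 / sqrt (real r * (t * real C ^ 3 / (8 * pi * N ^ 3))) + 3)
         * (3 * (real r * (t * (real C)\<^sup>2 / (2 * pi * N\<^sup>2))) * real (P r) + 6)
       + 2 * real (P r) * (1 + ln (real (P r)))))"
  obtain p h where ph: "\<And>l. {x. l + C * x \<in> block N M} = {p l..<h l}"
    "(\<Sum>n\<in>block N M. twist chi t n) = (\<Sum>l<C. \<Sum>x\<in>{p l..<h l}. twist chi t (l + C * x))"
    using block_class_split[of C N M "twist chi t", OF C] by blast
  obtain iv where iv: "\<And>l::nat. coprime l q \<Longrightarrow> [int l * iv l = 1] (mod int q)"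
    using inverse_mod_exists by metis
  have C0: "real C > 0" using C by simp
  have R0: "real R > 0" using R by simp
  have K0: "K > 0" using N C0 by (simp add: K_def add_pos_pos)
  have finI: "finite I" by (simp add: I_def)
  have cardI: "real (card I) \<le> real C"
  proof -
    have "card I \<le> card {..<C}" by (rule card_mono) (auto simp: I_def)
    thus ?thesis by simp
  qed
  define S where "S = (\<lambda>l. \<Sum>x\<in>{p l..<h l}. ee (class_phase (iv l) l x))"
  define corr where "corr = (\<lambda>l r. norm (\<Sum>y\<in>{p l..<h l - r}. ee (class_phase (iv l) l (y + r) - class_phase (iv l) l y)))"
  have Kl: "real (h l - p l) \<le> K" for l
  proof (cases "p l < h l")
    case True
    have m: "p l \<in> {x. l + C * x \<in> block N M}" "h l - 1 \<in> {x. l + C * x \<in> block N M}"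
      unfolding ph using True by auto
    have "real C * (real (h l - 1) - real (p l)) \<le> N"
      using m NM by (simp add: block_def algebra_simps)
    hence "real (h l - 1) - real (p l) \<le> N / real C" using C0 by (simp add: field_simps)
    thus ?thesis using True by (simp add: K_def of_nat_diff)
  qed (use K0 in simp)
  have weyl: "(norm (S l))\<^sup>2 \<le> (K + real R) / real R * (K + 2 * (\<Sum>r=1..<R. corr l r))" for l
  proof -
    define z where "z = (\<lambda>x. ee (class_phase (iv l) l (p l + x)))"
    define Kl where "Kl = h l - p l"
    have "S l = (\<Sum>x<Kl. z x)" unfolding S_def z_def Kl_def
      by (rule sum.reindex_bij_witness[of _ "\<lambda>x. p l + x" "\<lambda>x. x - p l"]) auto
    moreover have "(norm (\<Sum>x<Kl. z x))\<^sup>2 \<le> (real Kl + real R) / real R *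
      (real Kl + 2 * (\<Sum>r=1..<R. norm (\<Sum>x<Kl - r. z (x + r) * cnj (z x))))"
      by (rule weyl_differencing[OF R]) (simp add: z_def)
    moreover have "norm (\<Sum>x<Kl - r. z (x + r) * cnj (z x)) = corr l r" for r
    proof -
      have "(\<Sum>x<Kl - r. z (x + r) * cnj (z x))
        = (\<Sum>y\<in>{p l..<h l - r}. ee (class_phase (iv l) l (y + r) - class_phase (iv l) l y))"
        by (rule sum.reindex_bij_witness[of _ "\<lambda>y. y - p l" "\<lambda>x. p l + x"])
           (auto simp: z_def Kl_def add.assoc ee_uminus [symmetric] ee_add [symmetric])
      thus ?thesis by (simp add: corr_def)
    qed
    ultimately have "(norm (S l))\<^sup>2 \<le> (real Kl + real R) / real R * (real Kl + 2 * (\<Sum>r=1..<R. corr l r))" by simp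
    also have "\<dots> \<le> (K + real R) / real R * (K + 2 * (\<Sum>r=1..<R. corr l r))"
      using Kl[of l] R0 K0 unfolding Kl_def
      by (intro mult_mono divide_right_mono add_mono) (auto intro!: sum_nonneg add_nonneg_nonneg simp: corr_def)
    finally show ?thesis .
  qed
  have z: "(\<Sum>x\<in>{p l..<h l}. twist chi t (l + C * x)) = 0" if "l \<in> {..<C} - I" for l
  proof (intro sum.neutral ballI)
    fix x
    have "\<not> coprime l q" using that by (simp add: I_def)
    hence "chi (int (l + C * x)) = 0" using C_prime by (intro dirichlet_character_eq_0[OF chi]) auto
    thus "twist chi t (l + C * x) = 0" by (simp only: twist_def mult_zero_left)
  qed
  have e: "(\<Sum>x\<in>{p l..<h l}. twist chi t (l + C * x)) = chi (int l) * S l" if "l \<in> I" for l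
    using twist_class[OF iv[of l]] that by (simp add: S_def I_def sum_distrib_left)
  have "(\<Sum>n\<in>block N M. twist chi t n) = (\<Sum>l\<in>I. \<Sum>x\<in>{p l..<h l}. twist chi t (l + C * x))"
    unfolding ph(2) by (rule sum.mono_neutral_right) (use z in \<open>auto simp: I_def\<close>)
  also have "norm \<dots> \<le> (\<Sum>l\<in>I. 1 * norm (S l))"
  proof (rule order_trans[OF norm_sum], rule sum_mono)
    fix l assume "l \<in> I"
    thus "norm (\<Sum>x\<in>{p l..<h l}. twist chi t (l + C * x)) \<le> 1 * norm (S l)"
      unfolding e[OF \<open>l \<in> I\<close>] norm_mult using norm_dirichlet_character_le[OF chi]
      by (intro mult_right_mono) auto
  qed
  finally have "(norm (\<Sum>n\<in>block N M. twist chi t n))\<^sup>2 \<le> (\<Sum>l\<in>I. 1 * norm (S l))\<^sup>2"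
    by (intro power_mono) auto
  also have "\<dots> \<le> (\<Sum>l\<in>I. 1\<^sup>2) * (\<Sum>l\<in>I. (norm (S l))\<^sup>2)" by (rule Cauchy_Schwarz_ineq_sum)
  also have "\<dots> \<le> real C * (\<Sum>l\<in>I. (K + real R) / real R * (K + 2 * (\<Sum>r=1..<R. corr l r)))"
    using cardI by (intro mult_mono sum_mono weyl) (auto intro!: sum_nonneg)
  also have "(\<Sum>l\<in>I. (K + real R) / real R * (K + 2 * (\<Sum>r=1..<R. corr l r)))
    = (K + real R) / real R * (real (card I) * K + 2 * (\<Sum>r=1..<R. \<Sum>l\<in>I. corr l r))"
  proof -
    have "(\<Sum>l\<in>I. \<Sum>r=1..<R. corr l r) = (\<Sum>r=1..<R. \<Sum>l\<in>I. corr l r)" by (rule sum.swap)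
    moreover have "(\<Sum>l\<in>I. K + 2 * (\<Sum>r=1..<R. corr l r)) = real (card I) * K + 2 * (\<Sum>l\<in>I. \<Sum>r=1..<R. corr l r)"
      by (simp only: sum.distrib sum_constant sum_distrib_left)
    ultimately show ?thesis by (simp only: sum_distrib_left [symmetric])
  qed
  also have "\<dots> \<le> (K + real R) / real R * (real C * K + 2 * (\<Sum>r=1..<R. X r))"
  proof (intro mult_left_mono add_mono mult_right_mono sum_mono cardI)
    fix r assume r: "r \<in> {1..<R}"
    have "real r * (t * real C ^ 3 / (8 * pi * N ^ 3)) \<le> real R * (t * real C ^ 3 / (8 * pi * N ^ 3))"
      using r t N by (intro mult_right_mono) auto
    also note lam
    finally show "(\<Sum>l\<in>I. corr l r) \<le> X r"
      unfolding corr_def X_def using r by (intro correlation_sum_le[OF N NM _ ph(1) iv]) auto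
  qed (use K0 R0 in auto)
  hence "real C * ((K + real R) / real R * (real (card I) * K + 2 * (\<Sum>r=1..<R. \<Sum>l\<in>I. corr l r)))
    \<le> real C * ((K + real R) / real R * (real C * K + 2 * (\<Sum>r=1..<R. X r)))"
    by (rule mult_left_mono) simp
  finally show ?thesis unfolding X_def by (simp only: mult.assoc)
qed

text \<open>In terms of \<open>y = N / (C * T)\<close>, and with shifts below \<open>R\<close>, the
  integer part of \<open>y\<close>, growth and range of the differenced increments depend on
  \<open>y\<close> and \<open>T\<close> alone. The diagonal, the resonances due to \<open>V\<close>
  and those due to the denominators \<open>P r\<close> are then all of order
  \<open>N * C * T\<close>, up to the arithmetic factors and \<open>ln D\<close>. The two bounds on
  \<open>N\<close> enter as \<open>y\<close> at least 9 and \<open>2 * y\<close> at most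
  \<open>D * T\<close>.\<close>

lemma block_weyl_simple:
  fixes T N M :: real
  assumes T: "T \<ge> 5.8" "T ^ 3 = t" and N: "9 * real C * T \<le> N" "2 * N \<le> real C * real D * T\<^sup>2"
    and NM: "M \<le> 2 * N"
  shows "(norm (\<Sum>n\<in>block N M. twist chi t n))\<^sup>2 \<le> N * real C * T *
    (real (sqrt_one_count D) * real B * real (divisor_count (D div B))) * (1015 + 2 * ln (real D))"
proof -
  define y where "y = N / (real C * T)"
  define R where "R = nat \<lfloor>y\<rfloor>"
  define la where "la = real (sqrt_one_count D)"
  define bt where "bt = real B * real (divisor_count (D div B))"
  define lam where "lam = t * real C ^ 3 / (8 * pi * N ^ 3)"
  define V where "V = t * (real C)\<^sup>2 / (2 * pi * N\<^sup>2)"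
  have C0: "real C > 0" and D0: "real D > 0" and T0: "T > 0" using C D T by auto
  have Ny: "N = real C * T * y" using C0 T0 by (simp add: y_def)
  have y9: "y \<ge> 9" using N(1) C0 T0 by (simp add: y_def field_simps)
  have y0: "y > 0" using y9 by simp
  have N0: "N > 0" unfolding Ny using C0 T0 y0 by simp
  have Rle: "real R \<le> y" and Rge: "real R \<ge> y - 1" using y0 unfolding R_def by linarith+
  have R8: "real R \<ge> 8/9 * y" using Rge y9 by simp
  have R1: "R \<ge> 1" and R0: "real R > 0" using R8 y9 by auto
  have lnD: "ln (real D) \<ge> 0" using D by simp
  have la1: "la \<ge> 1"
  proof -
    have "{1 mod D} \<subseteq> {x. x < D \<and> [x ^ 2 = 1] (mod D)}" using D by (simp add: cong_def power_mod)
    hence "card {1 mod D} \<le> sqrt_one_count D" unfolding sqrt_one_count_def by (intro card_mono) auto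
    thus ?thesis by (simp add: la_def)
  qed
  have BD: "B dvd D" using B by (metis gcd_dvd2 int_dvd_int_iff)
  hence B0: "B \<ge> 1" "D div B \<ge> 1" using D by (auto simp: Suc_le_eq dvd_imp_le dvd_pos_nat div_greater_zero_iff)
  have bt1: "bt \<ge> 1"
  proof -
    have "{1} \<subseteq> {d. d dvd D div B}" by simp
    hence "card {1::nat} \<le> divisor_count (D div B)" unfolding divisor_count_def
      using B0 by (intro card_mono) auto
    hence "real (divisor_count (D div B)) \<ge> 1" by simp
    thus ?thesis unfolding bt_def using mult_mono[of 1 "real B" 1 "real (divisor_count (D div B))"] B0 by simp
  qed
  have lam_y: "lam = 1 / (8 * pi * y ^ 3)"
    unfolding lam_def T(2) [symmetric] Ny using C0 T0 by (simp add: power_mult_distrib)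
  have lam0: "lam > 0" using y0 by (simp add: lam_y)
  have V_y: "V = T / (2 * pi * y\<^sup>2)"
    unfolding V_def T(2) [symmetric] Ny using C0 T0 by (simp add: power_mult_distrib power2_eq_square power3_eq_cube)
  have V0: "V > 0" using y0 T0 by (simp add: V_y)
  \<comment> \<open>From \<open>pi > 3\<close> and \<open>y\<close> at least 9, as 1944 is 8 * 3 *
    81. It is also small enough to absorb the 3 in \<open>2.83 / s + 3\<close> below.\<close>
  have rlam: "real r * lam \<le> 1 / 1944" if "r \<le> R" for r
  proof -
    have "real r * lam \<le> y * lam" using that Rle lam0 by (intro mult_right_mono) auto
    also have "\<dots> = 1 / (8 * pi * y\<^sup>2)" using y0 by (simp add: lam_y power2_eq_square power3_eq_cube)
    also have "\<dots> \<le> 1 / (8 * 3 * 9\<^sup>2)" using y9 pi_gt3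
      by (intro divide_left_mono mult_mono power_mono mult_pos_pos) auto
    finally show ?thesis by simp
  qed
  \<comment> \<open>5.02 is sqrt (8 pi) rounded up; in the next estimate 0.8165 is sqrt (2/3)
    rounded up, with 3 in place of pi.\<close>
  have slam: "1 / sqrt lam \<le> 5.02 * (y * sqrt y)"
  proof -
    have "1 / lam = 8 * pi * y ^ 3" by (simp add: lam_y)
    also have "\<dots> \<le> 25.2004 * y ^ 3" using pi_approx y0 by (intro mult_right_mono) auto
    also have "\<dots> = (5.02 * (y * sqrt y))\<^sup>2" using y0 by (simp add: power_mult_distrib power2_eq_square power3_eq_cube)
    finally have "sqrt (1 / lam) \<le> 5.02 * (y * sqrt y)" using y0 by (intro real_le_lsqrt) auto
    thus ?thesis by (simp add: real_sqrt_divide)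
  qed
  have Vlam: "V / sqrt lam \<le> 0.8165 * (T / sqrt y)"
  proof -
    have "V\<^sup>2 / lam = 2 * T\<^sup>2 / (pi * y)" using y0 T0
      by (simp add: V_y lam_y power_divide power_mult_distrib field_simps power2_eq_square power3_eq_cube)
    also have "\<dots> \<le> 2 * T\<^sup>2 / (3 * y)" using pi_gt3 y0 by (intro divide_left_mono mult_right_mono) auto
    also have "\<dots> = 2 / 3 * (T\<^sup>2 / y)" by simp
    also have "\<dots> \<le> 0.8165\<^sup>2 * (T\<^sup>2 / y)" using y0 by (intro mult_right_mono) (auto simp: power2_eq_square)
    also have "\<dots> = (0.8165 * (T / sqrt y))\<^sup>2" using y0 by (simp add: power_mult_distrib power_divide)
    finally have "sqrt (V\<^sup>2 / lam) \<le> 0.8165 * (T / sqrt y)" using y0 T0 by (intro real_le_lsqrt) auto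
    thus ?thesis using V0 by (simp add: real_sqrt_divide)
  qed
  define X where "X = (\<lambda>r. 2 * real C * la / real (P r) *
      ((2.83 / sqrt (real r * lam) + 3) * (3 * (real r * V) * real (P r) + 6)
       + 2 * real (P r) * (1 + ln (real (P r)))))"
  \<comment> \<open>7.35 is 9 * 0.8165 rounded up, and 180.72 is 18 * 5.02 * 2.\<close>
  have Xle: "X r \<le> 2 * real C * la * (7.35 * T + 180.72 * (y * sqrt y) * real B / real D * (real (gcd r (D div B)) / sqrt (real r))
      + 2 * (1 + ln (real D)))" if r: "r \<in> {1..<R}" for r
  proof -
    have r0: "real r > 0" "real r \<le> y" using r Rle by auto
    have P0: "real (P r) > 0" using P_pos[of r] by simp
    define s where "s = sqrt (real r * lam)"
    have s0: "s > 0" using r0 lam0 by (simp add: s_def)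
    have "s \<le> 1 / 44"
    proof -
      have "real r * lam \<le> (1/44)\<^sup>2" using rlam[of r] r by (simp add: power2_eq_square)
      thus ?thesis unfolding s_def by (intro real_le_lsqrt) auto
    qed
    hence "2.83 / s + 3 \<le> 3 / s" using s0 by (simp add: field_simps)
    moreover have "X r = 2 * real C * la * ((2.83 / s + 3) * (3 * (real r * V) + 6 / real (P r)) + 2 * (1 + ln (real (P r))))"
      unfolding X_def s_def [symmetric] using P0 by (simp add: field_simps)
    moreover have "(2.83 / s + 3) * (3 * (real r * V) + 6 / real (P r)) \<le> 3 / s * (3 * (real r * V) + 6 / real (P r))"
      using calculation(1) V0 P0 r0 by (intro mult_right_mono add_nonneg_nonneg) auto
    moreover have "ln (real (P r)) \<le> ln (real D)"
    proof -
      have "P r \<le> D" using P_dvd[of r] D by (intro dvd_imp_le) auto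
      thus ?thesis using P0 by simp
    qed
    moreover have "3 / s * (3 * (real r * V) + 6 / real (P r)) \<le> 7.35 * T
       + 180.72 * (y * sqrt y) * real B / real D * (real (gcd r (D div B)) / sqrt (real r))"
    proof -
      have "3 / s * (3 * (real r * V)) = 9 * (real r / sqrt (real r)) * (V / sqrt lam)"
        by (simp add: s_def real_sqrt_mult)
      also have "\<dots> = 9 * sqrt (real r) * (V / sqrt lam)" using r0 by (simp add: real_div_sqrt)
      also have "\<dots> \<le> 9 * sqrt y * (0.8165 * (T / sqrt y))"
        using r0 V0 lam0 Vlam by (intro mult_mono) auto
      also have "\<dots> \<le> 7.35 * T" using y0 T0 by simp
      finally have 1: "3 / s * (3 * (real r * V)) \<le> 7.35 * T" .
      have "3 / s * (6 / real (P r)) = 18 * (1 / sqrt lam) * (1 / real (P r)) / sqrt (real r)"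
        by (simp add: s_def real_sqrt_mult)
      also have "\<dots> \<le> 18 * (5.02 * (y * sqrt y)) * (2 * real B * real (gcd r (D div B)) / real D) / sqrt (real r)"
      proof (intro divide_right_mono mult_mono)
        have "real (g r) \<le> 2 * real B * real (gcd r (D div B))"
        proof -
          have "int (g r) \<le> 2 * int B * int (gcd r (D div B))" unfolding g by (rule gcd_linear_le[OF D B])
          hence "real_of_int (int (g r)) \<le> real_of_int (2 * int B * int (gcd r (D div B)))" by (simp only: of_int_le_iff)
          thus ?thesis by simp
        qed
        moreover have "1 / real (P r) = real (g r) / real D"
          using P_g[of r] P0 D0 by (simp add: field_simps flip: of_nat_mult)
        ultimately show "1 / real (P r) \<le> 2 * real B * real (gcd r (D div B)) / real D"
          using D0 by (simp add: divide_right_mono)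
      qed (use slam y0 lam0 in auto)
      also have "\<dots> = 180.72 * (y * sqrt y) * real B / real D * (real (gcd r (D div B)) / sqrt (real r))" by simp
      finally show ?thesis using 1 by (simp only: distrib_left)
    qed
    ultimately show ?thesis using C0 la1 by (auto intro!: mult_left_mono)
  qed
  have sumX: "(\<Sum>r=1..<R. X r) \<le> 2 * real C * la * (bt * y * T) * (188.5 + 0.345 * ln (real D))"
  proof -
    have "(\<Sum>r=1..<R. X r) \<le> (\<Sum>r=1..<R. 2 * real C * la * (7.35 * T + 180.72 * (y * sqrt y) * real B / real D * (real (gcd r (D div B)) / sqrt (real r))
      + 2 * (1 + ln (real D))))" by (intro sum_mono Xle)
    also have "\<dots> = 2 * real C * la * (real (R - 1) * (7.35 * T + 2 * (1 + ln (real D)))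
       + 180.72 * (y * sqrt y) * real B / real D * (\<Sum>r=1..<R. real (gcd r (D div B)) / sqrt (real r)))"
      by (simp only: sum_distrib_left [symmetric] sum.distrib sum_constant card_atLeastLessThan) (simp add: algebra_simps)
    also have "\<dots> \<le> 2 * real C * la * (bt * y * T * (7.35 + 0.345 * (1 + ln (real D))) + bt * y * T * 180.72)"
    proof (intro mult_left_mono add_mono)
      \<comment> \<open>For \<open>T\<close> at least 5.8, \<open>0.345 * T\<close> is at least
        2.\<close>
      have "7.35 * T + 2 * (1 + ln (real D)) \<le> T * (7.35 + 0.345 * (1 + ln (real D)))"
      proof -
        have "2 * (1 + ln (real D)) \<le> (0.345 * T) * (1 + ln (real D))"
          using T lnD by (intro mult_right_mono) auto
        thus ?thesis by (simp add: algebra_simps)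
      qed
      hence "real (R - 1) * (7.35 * T + 2 * (1 + ln (real D))) \<le> y * (T * (7.35 + 0.345 * (1 + ln (real D))))"
        using Rle y0 T0 lnD by (intro mult_mono) auto
      also have "\<dots> \<le> bt * (y * (T * (7.35 + 0.345 * (1 + ln (real D)))))"
        using bt1 y0 T0 lnD mult_right_mono[of 1 bt "y * (T * (7.35 + 0.345 * (1 + ln (real D))))"] by simp
      finally show "real (R - 1) * (7.35 * T + 2 * (1 + ln (real D))) \<le> bt * y * T * (7.35 + 0.345 * (1 + ln (real D)))"
        by (simp only: mult.assoc)
      have "180.72 * (y * sqrt y) * real B / real D * (\<Sum>r=1..<R. real (gcd r (D div B)) / sqrt (real r))
        \<le> 180.72 * (y * sqrt y) * real B / real D * (2 * real (divisor_count (D div B)) * sqrt y)"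
      proof (intro mult_left_mono)
        have "(\<Sum>r=1..<R. real (gcd r (D div B)) / sqrt (real r)) \<le> 2 * real (divisor_count (D div B)) * sqrt (real R)"
          by (rule sum_gcd_div_sqrt_le[OF B0(2)])
        also have "\<dots> \<le> 2 * real (divisor_count (D div B)) * sqrt y" using Rle by (intro mult_left_mono) auto
        finally show "(\<Sum>r=1..<R. real (gcd r (D div B)) / sqrt (real r)) \<le> 2 * real (divisor_count (D div B)) * sqrt y" .
      qed (use y0 in auto)
      also have "\<dots> = 180.72 * bt * y * (2 * (y / real D))" using y0 by (simp add: bt_def)
      also have "\<dots> \<le> 180.72 * bt * y * T"
      proof (intro mult_left_mono)
        have "2 * (real C * T * y) \<le> real C * real D * T\<^sup>2" using N(2) unfolding Ny .
        hence "(real C * T) * (2 * y) \<le> (real C * T) * (real D * T)" by (simp add: mult_ac power2_eq_square)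
        hence "2 * y \<le> real D * T" using C0 T0 by simp
        thus "2 * (y / real D) \<le> T" using D0 by (simp add: field_simps)
      qed (use bt1 y0 in auto)
      finally show "180.72 * (y * sqrt y) * real B / real D * (\<Sum>r=1..<R. real (gcd r (D div B)) / sqrt (real r))
        \<le> bt * y * T * 180.72" by (simp add: mult_ac)
    qed (use C0 la1 in auto)
    also have "\<dots> = 2 * real C * la * (bt * y * T) * (7.35 + 0.345 * (1 + ln (real D)) + 180.72)"
      by (simp only: distrib_left mult.assoc)
    also have "\<dots> \<le> 2 * real C * la * (bt * y * T) * (188.5 + 0.345 * ln (real D))"
    proof (rule mult_left_mono)
      have e: "0.345 * (1 + ln (real D)) = 0.345 + 0.345 * ln (real D)" by (simp only: distrib_left mult_1_right)
      show "7.35 + 0.345 * (1 + ln (real D)) + 180.72 \<le> 188.5 + 0.345 * ln (real D)" unfolding e by simp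
    qed (use C0 la1 bt1 y0 T0 in auto)
    finally show ?thesis .
  qed
  have sumX0: "(\<Sum>r=1..<R. X r) \<ge> 0"
  proof (intro sum_nonneg)
    fix r
    have "real (P r) \<ge> 1" using P_pos[of r] by simp
    thus "X r \<ge> 0" unfolding X_def using C0 la1 V0 lam0
      by (intro mult_nonneg_nonneg add_nonneg_nonneg divide_nonneg_nonneg) auto
  qed
  define K where "K = N / real C + 1"
  have Kle: "K \<le> 1.0192 * (y * T)"
  proof -
    have "9 * 5.8 \<le> y * T" using y9 T by (intro mult_mono) auto
    thus ?thesis using C0 by (simp add: K_def Ny mult.commute)
  qed
  have K0: "K \<ge> 0" using N0 by (simp add: K_def)
  have KR: "K + real R \<le> 1.192 * (y * T)"
  proof -
    have "y * 5.8 \<le> y * T" using y0 T by (intro mult_left_mono) auto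
    thus ?thesis using Kle Rle by simp
  qed
  have Rinv: "1 / real R \<le> 9 / (8 * y)" using R8 R0 y0 by (simp add: field_simps)
  have "(norm (\<Sum>n\<in>block N M. twist chi t n))\<^sup>2
      \<le> real C * ((K + real R) / real R) * (real C * K + 2 * (\<Sum>r=1..<R. X r))"
  proof -
    have "real R * lam \<le> 1/2" using rlam[of R] by simp
    from block_weyl[OF N0 NM R1 this[unfolded lam_def]]
    show ?thesis unfolding K_def X_def lam_def V_def la_def .
  qed
  also have "\<dots> = real C * (K + real R) * (1 / real R) * (real C * K + 2 * (\<Sum>r=1..<R. X r))" by simp
  also have "\<dots> \<le> real C * (1.192 * (y * T)) * (9 / (8 * y)) *
     (real C * (1.0192 * (y * T)) + 2 * (2 * real C * la * (bt * y * T) * (188.5 + 0.345 * ln (real D))))"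
  proof (intro mult_mono add_mono mult_left_mono KR Rinv Kle sumX)
  qed (use C0 y0 T0 R0 K0 sumX0 in auto)
  also have "\<dots> = N * real C * T * (1.192 * 9 / 8 * (1.0192 + 4 * (la * bt) * (188.5 + 0.345 * ln (real D))))"
    unfolding Ny using y0 by (simp add: field_simps)
  \<comment> \<open>1.192 * 9 / 8 * (1.0192 + 4 * 188.5) is below 1013, and the coefficient of
    \<open>ln D\<close> is below 1.86.\<close>
  also have "\<dots> \<le> N * real C * T * (la * bt * (1015 + 2 * ln (real D)))"
  proof (rule mult_left_mono)
    have lb: "la * bt \<ge> 1" using mult_mono[of 1 la 1 bt] la1 bt1 by simp
    have "1.192 * 9 / 8 * (1.0192 + 4 * (la * bt) * (188.5 + 0.345 * ln (real D)))
       \<le> 1.192 * 9 / 8 * (1.0192 * (la * bt) + 4 * (la * bt) * (188.5 + 0.345 * ln (real D)))"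
      using lb by (intro mult_left_mono add_right_mono) auto
    also have "\<dots> = (la * bt) * (1.192 * 9 / 8 * (1.0192 + 4 * (188.5 + 0.345 * ln (real D))))"
      by (simp add: algebra_simps)
    also have "\<dots> \<le> (la * bt) * (1015 + 2 * ln (real D))"
      using lnD lb by (intro mult_left_mono) auto
    finally show "1.192 * 9 / 8 * (1.0192 + 4 * (la * bt) * (188.5 + 0.345 * ln (real D))) \<le> la * bt * (1015 + 2 * ln (real D))" .
  qed (use N0 C0 T0 in auto)
  finally show ?thesis unfolding la_def bt_def by (simp only: mult.assoc)
qed

end

section \<open>Assembling the partial sums\<close>

lemma C_mult_D_dvd: "q \<ge> 1 \<Longrightarrow> C_of q * D_of q dvd q"
  by (subst (3) mult_extend_power [symmetric], assumption, subst mult_extend_mult [symmetric],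
      rule mult_extend_dvd)
     (auto simp: C_pp_eq D_pp_eq simp flip: power_add power_Suc intro!: le_imp_power_dvd)

text \<open>The range is halved from the top. 2.5 is 1 / (sqrt 2 - 1) rounded up, and 4.5 is 1 / (1
  - 1 / sqrt 2), rounded up to 3.5, plus 1 for the incomplete lowest block.\<close>

lemma dyadic_sum_bound:
  fixes F :: "real \<Rightarrow> complex"
  assumes N0: "N0 > 0" and a: "a \<ge> 0" and b: "b \<ge> 0" and M: "N0 \<le> M"
    and step: "\<And>N K. N0 \<le> N \<Longrightarrow> N \<le> K \<Longrightarrow> K \<le> 2 * N \<Longrightarrow> norm (F K - F N) \<le> a * sqrt N + b / sqrt N"
  shows "norm (F M - F N0) \<le> 2.5 * a * sqrt M + 4.5 * b / sqrt N0"
proof -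
  have "1.4 \<le> sqrt 2" by (rule real_le_rsqrt) (simp add: power2_eq_square)
  hence s2: "3.5 \<le> 2.5 * sqrt 2" by simp
  \<comment> \<open>The subtracted \<open>3.5 / sqrt M\<close> strengthens the claim for the
    induction. With these constants both summands need the same inequality, \<open>3.5\<close> at
    most \<open>2.5 * sqrt 2\<close>.\<close>
  have claim: "norm (F M - F N0) \<le> 2.5 * a * sqrt M + b * (4.5 / sqrt N0 - 3.5 / sqrt M)"
    if "N0 \<le> M" "M \<le> 2 ^ n * N0" for n M
    using that
  proof (induction n arbitrary: M)
    case 0
    hence "M = N0" by simp
    moreover have "b * (4.5 / sqrt N0 - 3.5 / sqrt N0) \<ge> 0" using b N0
      by (intro mult_nonneg_nonneg) (auto simp: divide_right_mono)
    ultimately show ?case using a N0 by simp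
  next
    case (Suc n)
    have M0: "M > 0" using Suc.prems N0 by linarith
    show ?case
    proof (cases "M \<le> 2 * N0")
      case True
      have sq: "sqrt N0 \<le> sqrt M" using Suc.prems by simp
      have "norm (F M - F N0) \<le> a * sqrt N0 + b / sqrt N0" using Suc.prems True by (intro step) auto
      also have "a * sqrt N0 \<le> 2.5 * a * sqrt M"
        using mult_mono[of a "2.5 * a" "sqrt N0" "sqrt M"] a sq N0 by simp
      also have "b / sqrt N0 \<le> b * (4.5 / sqrt N0 - 3.5 / sqrt M)"
      proof -
        have "3.5 / sqrt M \<le> 3.5 / sqrt N0" using sq N0 by (intro divide_left_mono) auto
        hence "1 / sqrt N0 \<le> 4.5 / sqrt N0 - 3.5 / sqrt M" by (simp add: field_simps)
        thus ?thesis using mult_left_mono[OF _ b] by fastforce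
      qed
      finally show ?thesis by simp
    next
      case False
      define r where "r = sqrt M"
      have r0: "r > 0" using M0 by (simp add: r_def)
      have half: "sqrt (M / 2) = r / sqrt 2" by (simp add: r_def real_sqrt_divide)
      have "norm (F M - F N0) \<le> norm (F M - F (M / 2)) + norm (F (M / 2) - F N0)"
        using norm_triangle_ineq[of "F M - F (M / 2)" "F (M / 2) - F N0"] by simp
      also have "norm (F M - F (M / 2)) \<le> a * sqrt (M / 2) + b / sqrt (M / 2)"
        using False M0 by (intro step) auto
      also have "norm (F (M / 2) - F N0) \<le> 2.5 * a * sqrt (M / 2) + b * (4.5 / sqrt N0 - 3.5 / sqrt (M / 2))"
        using False Suc.prems by (intro Suc.IH) auto
      finally have "norm (F M - F N0) \<le> a * (3.5 * (r / sqrt 2)) + b * (4.5 / sqrt N0 - 2.5 * (sqrt 2 / r))"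
        unfolding half using r0 by (simp add: algebra_simps)
      also have "\<dots> \<le> a * (2.5 * r) + b * (4.5 / sqrt N0 - 3.5 / r)"
      proof (intro add_mono mult_left_mono diff_mono a b order_refl)
        show "3.5 * (r / sqrt 2) \<le> 2.5 * r" using s2 r0 by (simp add: field_simps)
        show "3.5 / r \<le> 2.5 * (sqrt 2 / r)" using s2 r0 by (simp add: divide_right_mono)
      qed
      finally show ?thesis by (simp add: r_def)
    qed
  qed
  obtain n where "M / N0 < 2 ^ n" using real_arch_pow[of 2 "M / N0"] by auto
  hence "M \<le> 2 ^ n * N0" using N0 by (simp add: field_simps)
  from claim[OF M this] have "norm (F M - F N0) \<le> 2.5 * a * sqrt M + b * (4.5 / sqrt N0 - 3.5 / sqrt M)" .
  also have "b * (4.5 / sqrt N0 - 3.5 / sqrt M) \<le> b * (4.5 / sqrt N0)"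
    using b M N0 by (intro mult_left_mono) auto
  finally show ?thesis by simp
qed

text \<open>A partial sum of the Dirichlet series at 1/2 + i t, as \<open>of_nat_powr_eq_ee\<close>
  shows.\<close>

definition partial :: "(int \<Rightarrow> complex) \<Rightarrow> real \<Rightarrow> real \<Rightarrow> complex" where
  "partial chi t x = (\<Sum>n\<in>block 0 x. of_real (1 / sqrt (real n)) * twist chi t n)"

lemma partial_diff:
  assumes "0 \<le> N" "N \<le> K"
  shows "partial chi t K - partial chi t N = (\<Sum>n\<in>block N K. of_real (1 / sqrt (real n)) * twist chi t n)"
proof -
  have "partial chi t K = partial chi t N + (\<Sum>n\<in>block N K. of_real (1 / sqrt (real n)) * twist chi t n)"
    unfolding partial_def block_union(1)[OF assms]
    by (rule sum.union_disjoint) (use block_union(2)[OF assms] in auto)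
  thus ?thesis by simp
qed

lemma norm_partial_diff_le:
  assumes "0 < N" "N \<le> K" and "\<And>M. N \<le> M \<Longrightarrow> M \<le> K \<Longrightarrow> norm (\<Sum>n\<in>block N M. twist chi t n) \<le> G"
  shows "norm (partial chi t K - partial chi t N) \<le> G / sqrt N"
proof -
  have "partial chi t K - partial chi t N = (\<Sum>n\<in>block N K. of_real (1 / sqrt (real n)) * twist chi t n)"
    using assms by (intro partial_diff) auto
  thus ?thesis using abel_block[OF assms(1,3,2)] by simp
qed

lemma norm_partial_le:
  assumes chi: "dirichlet_character q chi" and x: "x \<ge> 0"
  shows "norm (partial chi t x) \<le> 2 * sqrt x"
proof -
  have "norm (partial chi t x) \<le> (\<Sum>n\<in>block 0 x. 1 / sqrt (real n))"
    unfolding partial_def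
  proof (rule order_trans[OF norm_sum], rule sum_mono)
    fix n
    have tw: "norm (twist chi t n) \<le> 1"
      unfolding twist_def norm_mult using norm_dirichlet_character_le[OF chi] by simp
    thus "norm (complex_of_real (1 / sqrt (real n)) * twist chi t n) \<le> 1 / sqrt (real n)"
      using mult_left_mono[OF tw, of "1 / sqrt (real n)"] by (simp add: norm_mult norm_divide)
  qed
  also have "block 0 x = {1..nat \<lfloor>x\<rfloor>}" by (subst block_eq) auto
  also have "(\<Sum>n\<in>{1..nat \<lfloor>x\<rfloor>}. 1 / sqrt (real n)) \<le> 2 * sqrt (real (nat \<lfloor>x\<rfloor>))"
    by (rule sum_inverse_sqrt_le)
  also have "\<dots> \<le> 2 * sqrt x" using x by simp
  finally show ?thesis .
qed

context quadratic_classes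
begin

text \<open>The bound for a block at \<open>N\<close> is proportional to sqrt N, and partial
  summation divides it by sqrt N. So every dyadic block costs the same, and only their number
  counts.\<close>

lemma partial_weyl_chain:
  assumes T: "T \<ge> 5.8" "T ^ 3 = t" and v: "v = 9 * real C * T"
    and n: "\<And>k. k < n \<Longrightarrow> 2 * (v * 2 ^ k) \<le> real C * real D * T\<^sup>2"
  shows "norm (partial chi t (v * 2 ^ n) - partial chi t v) \<le> real n * sqrt (real C * T *
    (real (sqrt_one_count D) * real B * real (divisor_count (D div B))) * (1015 + 2 * ln (real D)))"
  using n
proof (induction n)
  case (Suc n)
  define A where "A = (real (sqrt_one_count D) * real B * real (divisor_count (D div B))) * (1015 + 2 * ln (real D))"
  define N where "N = v * 2 ^ n"
  have v0: "v > 0" using v T C by simp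
  have N0: "N > 0" using v0 by (simp add: N_def)
  have Nv: "N \<ge> v" using v0 by (simp add: N_def)
  have "norm (partial chi t (2 * N) - partial chi t N) \<le> sqrt (N * (real C * T * A)) / sqrt N"
  proof (rule norm_partial_diff_le)
    fix M assume M: "M \<le> 2 * N"
    have "(norm (\<Sum>n\<in>block N M. twist chi t n))\<^sup>2 \<le> N * (real C * T * A)"
      using block_weyl_simple[OF T, of N M] Suc.prems[of n] Nv M unfolding v A_def N_def by (simp add: mult.assoc)
    thus "norm (\<Sum>n\<in>block N M. twist chi t n) \<le> sqrt (N * (real C * T * A))" by (rule real_le_rsqrt)
  qed (use N0 in auto)
  also have "\<dots> = sqrt (real C * T * A)" using N0 by (simp add: real_sqrt_mult)
  finally have 1: "norm (partial chi t (v * 2 ^ Suc n) - partial chi t (v * 2 ^ n)) \<le> sqrt (real C * T * A)"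
    by (simp add: N_def mult_ac)
  have "norm (partial chi t (v * 2 ^ n) - partial chi t v) \<le> real n * sqrt (real C * T * A)"
    using Suc.IH Suc.prems unfolding A_def by (simp add: mult.assoc)
  moreover have "norm (partial chi t (v * 2 ^ Suc n) - partial chi t v)
    \<le> norm (partial chi t (v * 2 ^ Suc n) - partial chi t (v * 2 ^ n)) + norm (partial chi t (v * 2 ^ n) - partial chi t v)"
    by (metis diff_add_cancel add_diff_eq norm_triangle_ineq)
  ultimately have "norm (partial chi t (v * 2 ^ Suc n) - partial chi t v) \<le> real (Suc n) * sqrt (real C * T * A)"
    using 1 by (simp add: algebra_simps)
  thus ?case unfolding A_def by (simp only: mult.assoc)
qed simp

end

context linear_classes
begin

text \<open>The first term stems from the bounded number of residues that always lie close to an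
  integer. The second stems from those brought there by the range \<open>V\<close> and, with the
  logarithm, from Kuzmin-Landau. When the blocks are summed up, the first is dominated by the upper
  end and the second by the lower end.\<close>

lemma partial_block_vdc:
  assumes T: "T \<ge> 5.8" "T ^ 3 = t" "t \<ge> 195" and N: "2 * N \<ge> real C * T\<^sup>2" "N \<le> K" "K \<le> 2 * N"
  shows "norm (partial chi t K - partial chi t N) \<le> 85.3 / (sqrt t * real P) * sqrt N
    + real C * sqrt t * (5.5 + 0.15 * ln (real P)) / sqrt N"
proof -
  have C0: "real C > 0" and P0: "real P \<ge> 1" and T0: "T > 0" using C P1 T by auto
  have "real C * T\<^sup>2 > 0" using C0 T0 by simp
  hence N0: "N > 0" using N by linarith
  have lnP: "ln (real P) \<ge> 0" using P0 by simp
  define r where "r = sqrt t"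
  have r0: "r > 0" using t by (simp add: r_def)
  have rr: "r * r = t" using t by (simp add: r_def)
  have r13: "r \<ge> 13.9" unfolding r_def using T(3) by (intro real_le_rsqrt) (simp add: power2_eq_square)
  define lam where "lam = t * (real C)\<^sup>2 / (8 * pi * N\<^sup>2)"
  define V where "V = t * real C / (4 * pi * N)"
  have lam0: "lam > 0" using t C0 N0 by (simp add: lam_def)
  have V0: "V > 0" using t C0 N0 by (simp add: V_def)
  have tC: "t * real C / N \<le> 2 * T"
  proof -
    have "T * (real C * T\<^sup>2) \<le> T * (2 * N)" using N(1) T0 by (intro mult_left_mono) auto
    hence "t * real C \<le> 2 * T * N" by (simp add: T(2) [symmetric] power2_eq_square power3_eq_cube mult_ac)
    thus ?thesis using N0 by (simp add: field_simps)
  qed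
  have Tr: "2.4 * T \<le> r"
  proof -
    have "(2.4 * T)\<^sup>2 = 5.76 * T\<^sup>2" by (simp add: power_mult_distrib power2_eq_square)
    also have "\<dots> \<le> T * T\<^sup>2" using T by (intro mult_right_mono) auto
    also have "\<dots> = t" using T by (simp add: power2_eq_square power3_eq_cube)
    finally show ?thesis unfolding r_def by (rule real_le_rsqrt)
  qed
  have lam_half: "lam \<le> 1/2"
  proof -
    have "lam = (t * real C / N)\<^sup>2 / (8 * pi * t)" using t by (simp add: lam_def power_divide power_mult_distrib power2_eq_square mult_ac)
    also have "\<dots> \<le> (2 * T)\<^sup>2 / (8 * 3 * t)"
      using tC t C0 N0 pi_gt3 by (intro frac_le power_mono mult_right_mono mult_left_mono) auto
    also have "\<dots> = 1 / (6 * T)" using T0 by (simp add: T(2) [symmetric] power2_eq_square power3_eq_cube)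
    also have "\<dots> \<le> 1/2" using T by (simp add: field_simps)
    finally show ?thesis .
  qed
  have slam: "1 / sqrt lam \<le> 5.02 * N / (real C * r)"
  proof -
    have "1 / lam = 8 * pi * N\<^sup>2 / (t * (real C)\<^sup>2)" by (simp add: lam_def)
    also have "\<dots> \<le> 25.2004 * N\<^sup>2 / (t * (real C)\<^sup>2)"
      using pi_approx t by (intro divide_right_mono mult_right_mono) auto
    also have "\<dots> = (5.02 * N / (real C * r))\<^sup>2"
      by (simp add: power_divide power_mult_distrib power2_eq_square rr [symmetric] mult_ac)
    finally have "sqrt (1 / lam) \<le> 5.02 * N / (real C * r)" using N0 C0 r0 by (intro real_le_lsqrt) auto
    thus ?thesis by (simp add: real_sqrt_divide)
  qed
  define G where "G = 85.3 / (r * real P) * N + real C * r * (5.5 + 0.15 * ln (real P))"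
  have "norm (partial chi t K - partial chi t N) \<le> G / sqrt N"
  proof (rule norm_partial_diff_le[OF N0 N(2)])
    fix M assume "M \<le> K"
    hence M: "M \<le> 2 * N" using N by simp
    have "norm (\<Sum>n\<in>block N M. twist chi t n)
      \<le> real C / real P * ((2.83 / sqrt lam + 3) * (3 * V * real P + 6) + 2 * real P * (1 + ln (real P)))"
      using block_vdc_bound[OF N0 M] lam_half unfolding lam_def V_def by blast
    also have "\<dots> = real C * (2.83 * (1 / sqrt lam)) * (3 * V) + real C * (2.83 * (1 / sqrt lam)) * 6 / real P
       + 9 * real C * V + 18 * real C / real P + 2 * real C * (1 + ln (real P))"
    proof -
      have e: "2.83 / sqrt lam = 2.83 * (1 / sqrt lam)" by simp
      have "c / p * ((x + 3) * (3 * V * p + 6) + 2 * p * l)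
        = c * x * (3 * V) + c * x * 6 / p + 9 * c * V + 18 * c / p + 2 * c * l" if "p \<noteq> 0" for c p x l :: real
        using that by (simp add: field_simps)
      moreover have "real P \<noteq> 0" using P0 by simp
      ultimately show ?thesis unfolding e by blast
    qed
    \<comment> \<open>The leading terms are those with \<open>1 / sqrt lam\<close>; 2.83 * 5.02 * 6
      is about 85.24. The other three are absorbed by means of \<open>Tr\<close> and
      \<open>r13\<close>.\<close>
    also have "\<dots> \<le> 3.41 * (real C * r) + 85.3 * N / (r * real P) + 0.61 * (real C * r) + 1.3 * (real C * r)
       + 0.15 * (real C * r) * (1 + ln (real P))"
    proof (intro add_mono)
      have "real C * (2.83 * (1 / sqrt lam)) * (3 * V) \<le> real C * (2.83 * (5.02 * N / (real C * r))) * (3 * V)"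
        using slam C0 V0 by (intro mult_left_mono mult_right_mono) auto
      also have "\<dots> = 2.83 * 5.02 * 3 / 4 / pi * (real C * r)"
        using C0 r0 N0 by (simp add: V_def rr [symmetric])
      also have "\<dots> \<le> 3.41 * (real C * r)"
      proof (rule mult_right_mono)
        have "2.83 * 5.02 * 3 / 4 / pi \<le> 2.83 * 5.02 * 3 / 4 / 3.14" using pi_approx by (intro divide_left_mono) auto
        also have "\<dots> \<le> 3.41" by simp
        finally show "2.83 * 5.02 * 3 / 4 / pi \<le> 3.41" .
      qed (use C0 r0 in auto)
      finally show "real C * (2.83 * (1 / sqrt lam)) * (3 * V) \<le> 3.41 * (real C * r)" .
      have "real C * (2.83 * (1 / sqrt lam)) * 6 / real P \<le> real C * (2.83 * (5.02 * N / (real C * r))) * 6 / real P"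
        using slam C0 P0 by (intro divide_right_mono mult_left_mono mult_right_mono) auto
      also have "\<dots> = 85.2396 * (N / (r * real P))" using C0 by simp
      also have "\<dots> \<le> 85.3 * (N / (r * real P))" using N0 r0 P0 by (intro mult_right_mono) auto
      finally show "real C * (2.83 * (1 / sqrt lam)) * 6 / real P \<le> 85.3 * N / (r * real P)" by simp
      have "9 * real C * V = 9 / (4 * pi) * (real C * (t * real C / N))" by (simp add: V_def)
      also have "\<dots> \<le> 9 / (4 * 3.14) * (real C * (2 * T))"
        using tC C0 T0 t N0 pi_approx by (intro mult_mono divide_left_mono mult_left_mono) auto
      also have "\<dots> \<le> 9 / (4 * 3.14) * (real C * (2 * (r / 2.4)))"
        using Tr C0 by (intro mult_left_mono) auto
      also have "\<dots> \<le> 0.61 * (real C * r)" using C0 r0 by simp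
      finally show "9 * real C * V \<le> 0.61 * (real C * r)" .
      have "18 * real C / real P \<le> 18 * real C / 1" using P0 C0 by (intro divide_left_mono) auto
      also have "\<dots> \<le> 1.3 * (real C * r)" using mult_left_mono[OF r13, of "real C"] C0 by simp
      finally show "18 * real C / real P \<le> 1.3 * (real C * r)" .
      have "2 * real C \<le> 0.15 * (real C * r)" using mult_left_mono[OF r13, of "real C"] C0 by simp
      thus "2 * real C * (1 + ln (real P)) \<le> 0.15 * (real C * r) * (1 + ln (real P))"
        using lnP by (intro mult_right_mono) auto
    qed
    also have "\<dots> = 85.3 / (r * real P) * N + real C * r * (3.41 + 0.61 + 1.3 + 0.15 * (1 + ln (real P)))"
      by (simp add: algebra_simps)
    also have "\<dots> \<le> G" unfolding G_def
    proof (intro add_left_mono mult_left_mono)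
      have e: "0.15 * (1 + ln (real P)) = 0.15 + 0.15 * ln (real P)" by (simp only: distrib_left mult_1_right)
      show "3.41 + 0.61 + 1.3 + 0.15 * (1 + ln (real P)) \<le> 5.5 + 0.15 * ln (real P)" unfolding e by simp
    qed (use C0 r0 in auto)
    finally show "norm (\<Sum>n\<in>block N M. twist chi t n) \<le> G" .
  qed
  also have "G / sqrt N = 85.3 / (r * real P) * (N / sqrt N) + real C * r * (5.5 + 0.15 * ln (real P)) / sqrt N"
    by (simp add: G_def add_divide_distrib)
  also have "N / sqrt N = sqrt N" using N0 by (simp add: real_div_sqrt)
  finally show ?thesis unfolding r_def .
qed

lemma partial_block_kl:
  assumes P: "P = 1" and N: "N \<ge> t * real q" and K: "N \<le> K" "K \<le> 2 * N"
  shows "norm (partial chi t K - partial chi t N) \<le> 4 * pi / t * sqrt N + 0 / sqrt N"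
proof -
  have "t * real q > 0" using t q by simp
  hence N0: "N > 0" using N by linarith
  have "norm (partial chi t K - partial chi t N) \<le> (4 * pi * N / t) / sqrt N"
  proof (rule norm_partial_diff_le[OF N0 K(1)])
    fix M assume "M \<le> K"
    have "t * real C / pi \<le> t * real C / 1" using t pi_gt3 by (intro divide_left_mono) auto
    also have "\<dots> \<le> t * real q"
    proof -
      have "C \<le> q" using CD q by (metis dvd_imp_le dvd_triv_left less_le_trans zero_less_one)
      thus ?thesis using t by simp
    qed
    finally show "norm (\<Sum>n\<in>block N M. twist chi t n) \<le> 4 * pi * N / t"
      using N K \<open>M \<le> K\<close> by (intro block_kl_bound P) auto
  qed
  also have "\<dots> = 4 * pi / t * (N / sqrt N)" by simp
  also have "N / sqrt N = sqrt N" using N0 by (simp add: real_div_sqrt)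
  finally show ?thesis by simp
qed

lemma partial_tail:
  assumes P: "P \<ge> 2" and N: "N \<ge> t * real q" and K: "N \<le> K"
  shows "norm (partial chi t K - partial chi t N) \<le> 3 * real C * (1 + ln (real P)) / sqrt N"
proof -
  have "t * real q > 0" using t q by simp
  hence N0: "N > 0" using N by linarith
  show ?thesis by (rule norm_partial_diff_le[OF N0 K block_tail_bound[OF P N]])
qed

end

section \<open>Numerical inequalities and conclusion\<close>

lemma ln_ge_21_4:
  assumes "Q \<ge> 200"
  shows "21 / 4 \<le> ln (Q :: real)"
proof -
  have "exp (21 / 4) ^ 4 = exp (1::real) ^ 21" by (simp flip: exp_of_nat_mult)
  also have "\<dots> \<le> (272 / 100) ^ 21" using e_less_272 by (intro power_mono) auto
  also have "\<dots> \<le> 200 ^ 4" by (simp add: power_divide)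
  finally have "exp (21 / 4) \<le> (200::real)" by (rule power_le_imp_le_base[of _ 3, simplified]) simp
  also note assms
  finally show ?thesis by (subst ln_ge_iff) (use assms in auto)
qed

text \<open>In terms of \<open>X - 21 / 4\<close> all coefficients are nonnegative. In the second
  inequality \<open>X / 2\<close> bounds the number of Weyl blocks, \<open>1017 + 2 / 3 * X\<close>
  is \<open>1015 + 2 * ln D\<close> after \<open>ln D\<close> is replaced by its bound
  \<open>1 + X / 3\<close>, and 1.7364 is the factor of the root in \<open>Z_fun\<close>.\<close>

lemma Z_polynomial_bounds:
  assumes "X \<ge> 21 / (4::real)"
  shows "65.5619 - 17.1704 * X - 2.4781 * X ^ 2 + 0.6807 * X ^ 3 \<ge> 0"
    "(X / 2)\<^sup>2 * (1017 + 2 / 3 * X) \<le> 1.7364\<^sup>2 * (- 1732.5 - 817.82 * X + 71.68 * X ^ 2 + 47.57 * X ^ 3)"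
proof -
  define y where "y = X - 21 / 4"
  have y: "y \<ge> 0" and X: "X = y + 21 / 4" using assms by (auto simp: y_def)
  have p: "y ^ 2 \<ge> 0" "y ^ 3 \<ge> 0" using y by auto
  have "65.5619 - 17.1704 * X - 2.4781 * X ^ 2 + 0.6807 * X ^ 3 = 718603 / 128000 + 2095189 / 160000 * y + 329717 / 40000 * y ^ 2 + 6807 / 10000 * y ^ 3"
    unfolding X by (simp add: power2_eq_square power3_eq_cube field_simps)
  also have "\<dots> \<ge> 0" using y p by (intro add_nonneg_nonneg mult_nonneg_nonneg) auto
  finally show "65.5619 - 17.1704 * X - 2.4781 * X ^ 2 + 0.6807 * X ^ 3 \<ge> 0" .
  have "1.7364\<^sup>2 * (- 1732.5 - 817.82 * X + 71.68 * X ^ 2 + 47.57 * X ^ 3) - (X / 2)\<^sup>2 * (1017 + 2 / 3 * X) = 60412526029737 / 40000000000 + 89797394883663 / 10000000000 * y + 5545577142003 / 2500000000 * y ^ 2 + 268614234151 / 1875000000 * y ^ 3"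
    unfolding X by (simp add: power2_eq_square power3_eq_cube field_simps)
  also have "\<dots> \<ge> 0" using y p by (intro add_nonneg_nonneg mult_nonneg_nonneg) auto
  finally show "(X / 2)\<^sup>2 * (1017 + 2 / 3 * X) \<le> 1.7364\<^sup>2 * (- 1732.5 - 817.82 * X + 71.68 * X ^ 2 + 47.57 * X ^ 3)" by simp
qed

text \<open>The number \<open>kappa\<close> is the modulus of the mean value of \<open>chi\<close>. Stating the approximation of \<open>w\<close> by partial sums
  with moduli only makes it invariant under conjugation, which gives the case of negative \<open>t\<close>.\<close>

lemma main_bound:
  fixes q B1 B :: nat and chi :: "int \<Rightarrow> complex" and t kappa :: real and Lt L0 L :: int and w :: complex
  assumes q: "q \<ge> 1" and chi: "dirichlet_character q chi" and t: "t \<ge> 200"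
    and ph1: "\<And>x :: int. chi (1 + int (C1_of q) * x)
           = exp (2 * of_real pi * \<i> * of_int Lt * of_int x / of_nat (D1_of q))"
    and B1: "int B1 = gcd Lt (int (D1_of q))"
    and ph2: "\<And>x :: int. chi (1 + int (C_of q) * x)
           = exp (4 * of_real pi * \<i> * of_int L0 * of_int x / of_nat (C_of q * D_of q)
                  + 2 * of_real pi * \<i> * of_int L * of_int x ^ 2 / of_nat (D_of q))"
    and B: "int B = gcd L (int (D_of q))"
    and kappa: "0 \<le> kappa" "kappa \<le> 1"
    and w1: "\<And>m. m \<ge> 2 \<Longrightarrow> norm (w - partial chi t (real (q * m)))
       \<le> 2 * sqrt (t\<^sup>2 + 1/4) * sqrt (real q) / sqrt (real (m - 1)) + kappa * sqrt (real (q * m)) / sqrt (t\<^sup>2 + 1/4)"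
    and w2: "\<And>m. m \<ge> 2 \<Longrightarrow> kappa * sqrt (real (q * m)) / sqrt (t\<^sup>2 + 1/4)
       \<le> norm (w - partial chi t (real (q * m))) + 2 * sqrt (t\<^sup>2 + 1/4) * sqrt (real q) / sqrt (real (m - 1))"
  shows "norm w \<le> (real q * t) powr (1 / 6) * Z_fun q B (ln (real q * t)) + W_fun q B1 (ln (real q * t))"
proof -
  define P where "P = D1_of q div B1"
  interpret lin: linear_classes q "C1_of q" "D1_of q" B1 P chi t Lt
    by unfold_locales (use q chi t ph1 B1 C1_D1 D1_dvd_C1 prime_dvd_C1 in \<open>auto simp: P_def\<close>)
  interpret quad: quadratic_classes q "C_of q" "D_of q" B chi t L0 L
    by unfold_locales (use q chi t ph2 B C_pos[of q] D_pos[of q] D_dvd D_dvd_2C prime_dvd_C in \<open>auto simp: Suc_le_eq\<close>)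
  define C where "C = real (C_of q)"
  define D where "D = real (D_of q)"
  define C1 where "C1 = real (C1_of q)"
  define Q where "Q = real q * t"
  define X where "X = ln Q"
  define T where "T = t powr (1/3)"
  define Q6 where "Q6 = Q powr (1/6)"
  define sg where "sg = sqrt (t\<^sup>2 + 1/4)"
  define A where "A = real (sqrt_one_count (D_of q)) * real B * real (divisor_count (D_of q div B))"
  define F where "F = partial chi t"
  have q1: "real q \<ge> 1" using q by simp
  have C0: "C \<ge> 1" and D0: "D \<ge> 1" and C10: "C1 \<ge> 1"
    using quad.C quad.D lin.C by (simp_all add: C_def D_def C1_def)
  have t0: "t > 0" using t by simp
  have Q200: "Q \<ge> 200" unfolding Q_def using mult_mono[of 1 "real q" 200 t] q1 t by simp
  have Q0: "Q > 0" using Q200 by simp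
  have X: "X \<ge> 21/4" unfolding X_def by (rule ln_ge_21_4[OF Q200])
  have lnq: "ln (real q) \<le> X"
    unfolding X_def Q_def using q1 t by (intro ln_mono) (auto intro: order_trans[of _ "real q * 1"] mult_left_mono)
  have T3: "T ^ 3 = t" using t0 by (simp add: T_def powr_powr flip: powr_realpow)
  have T58: "T \<ge> 5.8"
  proof (rule ccontr)
    assume "\<not> T \<ge> 5.8"
    hence "T ^ 3 < 5.8 ^ 3" by (intro power_strict_mono) (auto simp: T_def)
    hence "t < 5.8 ^ 3" by (simp only: T3)
    also have "\<dots> < 200" by (simp add: power3_eq_cube)
    finally show False using t by simp
  qed
  have T0: "T > 0" using T58 by simp
  have Tt: "T \<le> t"
  proof -
    have "1 \<le> T\<^sup>2" using T58 by (intro one_le_power) simp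
    from mult_left_mono[OF this, of T] show ?thesis using T0
      by (simp add: T3 [symmetric] power2_eq_square power3_eq_cube)
  qed
  have P1: "real P \<ge> 1" using lin.P1 by simp
  have PB: "real P * real B1 = real (D1_of q)" using lin.PB by (metis of_nat_mult)
  have C1D1: "C1 * real (D1_of q) = real q" using C1_D1[OF q] unfolding C1_def by (metis of_nat_mult)
  have B10: "real B1 \<ge> 1" using lin.B0 by simp
  have sqf: "sqf q = C1 / sqrt (real q)" using sqf_eq[OF q] by (simp add: C1_def powr_half_sqrt)
  have sqf': "sqrt (real q) / real P = real B1 * sqf q"
  proof -
    have "sqrt (real q) / real P = real B1 * (sqrt (real q) / (real P * real B1))" using B10 by simp
    also have "sqrt (real q) / (real P * real B1) = C1 / sqrt (real q)"
    proof -
      have "real P * real B1 > 0" using P1 B10 by simp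
      moreover have "sqrt (real q) * sqrt (real q) = C1 * (real P * real B1)" using C1D1 unfolding PB by simp
      moreover have "sqrt (real q) \<noteq> 0" using q1 by simp
      ultimately show ?thesis by (subst frac_eq_eq) auto
    qed
    finally show ?thesis by (simp add: sqf)
  qed
  have sqf1: "sqf q \<ge> 1"
  proof -
    have "D1_of q \<le> C1_of q" using D1_dvd_C1 C1_pos by (rule dvd_imp_le)
    hence "real (D1_of q) \<le> C1" by (simp add: C1_def)
    hence "real q \<le> C1\<^sup>2" using C1D1 C10 mult_left_mono[of "real (D1_of q)" C1 C1] by (simp add: power2_eq_square)
    hence "sqrt (real q) \<le> C1" using C10 by (intro real_le_lsqrt) auto
    thus ?thesis using q1 by (simp add: sqf)
  qed
  have Bs: "real B1 * sqf q \<ge> 1" using mult_mono[OF B10 sqf1] by simp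
  have Q6_0: "Q6 > 0" using Q0 by (simp add: Q6_def)
  have CT: "sqrt (C * T) = sqrt (cbf q) * Q6"
  proof -
    have "C * T = cbf q * Q powr (1/3)"
      using q1 by (simp add: cbf_eq[OF q] C_def T_def Q_def powr_mult)
    moreover have "sqrt (Q powr (1/3)) = Q6" using Q0 by (simp add: Q6_def powr_powr flip: powr_half_sqrt)
    ultimately show ?thesis by (simp add: real_sqrt_mult)
  qed
  have spf0: "spf q * Q6 = C1 * t powr (1/6) / sqrt (C * D)"
    using q1 by (simp add: spf_eq[OF q] C1_def C_def D_def Q6_def Q_def powr_mult powr_half_sqrt real_sqrt_mult)
  have t6: "sqrt t = T * t powr (1/6)" 
    using t0 by (simp add: T_def powr_add [symmetric] flip: powr_half_sqrt)
  have lnD: "ln D \<le> 1 + X / 3"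
  proof -
    have "real (D_of q ^ 3) \<le> real (8 * q)" using D_cube_le[OF q] by (simp only: of_nat_le_iff)
    hence "ln (D ^ 3) \<le> ln (8 * real q)" using D0 q1 by (intro ln_mono) (auto simp: D_def)
    hence "3 * ln D \<le> ln (2 ^ 3) + ln (real q)" using D0 q1 by (simp add: ln_realpow ln_mult)
    also have "ln ((2::real) ^ 3) = 3 * ln 2" by (subst ln_realpow) auto
    also have "ln (2::real) \<le> 1" using ln_le_minus_one[of 2] by simp
    finally show ?thesis using lnq by simp
  qed
  have lnP: "ln (real P) \<le> X / 2" "ln (real P) \<ge> 0"
  proof -
    have "D1_of q \<le> C1_of q" using D1_dvd_C1 C1_pos by (rule dvd_imp_le)
    hence "real (D1_of q) * real (D1_of q) \<le> C1 * real (D1_of q)" unfolding C1_def by (intro mult_right_mono) auto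
    moreover have "real P \<le> real (D1_of q)" unfolding PB [symmetric] using P1 B10 by simp
    ultimately have "real P * real P \<le> real q" unfolding C1D1 using P1 by (meson mult_mono order_trans of_nat_0_le_iff)
    hence "ln (real P * real P) \<le> ln (real q)" using P1 q1 by (intro ln_mono) auto
    thus "ln (real P) \<le> X / 2" using P1 lnq by (simp add: ln_mult)
    show "ln (real P) \<ge> 0" using P1 by simp
  qed

  \<comment> \<open>The 9 serves two purposes: the trivial bound \<open>2 * sqrt v\<close> is 6 sqrt
    (C T), within the coefficient 6.6668 of \<open>Z_fun\<close>, and beyond \<open>v\<close> the
    Weyl shifts have enough room for \<open>block_weyl_simple\<close>.\<close>
  define v where "v = 9 * C * T"
  have v0: "v > 0" using C0 T0 by (simp add: v_def)
  \<comment> \<open>The number of doublings that leave the Weyl range; minimality keeps every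
    earlier block inside it.\<close>
  define n where "n = (LEAST n. C * D * T\<^sup>2 \<le> 2 * (v * 2 ^ n))"
  define u where "u = v * 2 ^ n"
  have ex: "\<exists>n. C * D * T\<^sup>2 \<le> 2 * (v * 2 ^ n)"
  proof -
    obtain n where "C * D * T\<^sup>2 / (2 * v) < 2 ^ n" using real_arch_pow[of 2] by auto
    thus ?thesis using v0 by (intro exI[of _ n]) (simp add: field_simps)
  qed
  have u_ge: "C * D * T\<^sup>2 \<le> 2 * u" unfolding u_def n_def by (rule LeastI_ex[OF ex])
  have u0: "u > 0" using v0 by (simp add: u_def)
  have below: "2 * (v * 2 ^ k) \<le> C * D * T\<^sup>2" if "k < n" for k
    using not_less_Least[OF that[unfolded n_def]] by simp
  have CDq: "C * D \<le> real q"
  proof -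
    have "C_of q * D_of q \<le> q" using C_mult_D_dvd[OF q] q by (intro dvd_imp_le) auto
    thus ?thesis unfolding C_def D_def by (metis of_nat_le_iff of_nat_mult)
  qed
  \<comment> \<open>This keeps \<open>Y\<close> below q t^2, near which the sum is cut off if
    \<open>P = 1\<close>.\<close>
  have u_le: "u \<le> real q * t\<^sup>2"
  proof (cases n)
    case 0
    have "C \<le> C * D" using C0 D0 by simp
    hence "C \<le> real q" using CDq by linarith
    moreover have "9 * T \<le> t\<^sup>2"
    proof -
      have "9 * T \<le> 200 * t" using Tt t0 by simp
      also have "\<dots> \<le> t * t" using t by (intro mult_right_mono) auto
      finally show ?thesis by (simp add: power2_eq_square)
    qed
    ultimately have "C * (9 * T) \<le> real q * t\<^sup>2" using C0 T0 by (intro mult_mono) auto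
    thus ?thesis using 0 by (simp add: u_def v_def)
  next
    case (Suc k)
    have "u = 2 * (v * 2 ^ k)" by (simp add: u_def Suc)
    also have "\<dots> \<le> C * D * T\<^sup>2" by (rule below) (simp add: Suc)
    also have "\<dots> \<le> real q * t\<^sup>2"
    proof (intro mult_mono power_mono CDq Tt)
    qed (use T0 in auto)
    finally show ?thesis .
  qed
  \<comment> \<open>By minimality \<open>9 * 2 ^ n\<close> is at most \<open>D * T\<close>. Cubing
    and \<open>D_cube_le\<close> give \<open>(2 ^ n) ^ 3\<close> at most \<open>Q\<close>, and
    \<open>ln 2\<close> is at least 2/3.\<close>
  have n_le: "real n \<le> X / 2"
  proof (cases n)
    case 0
    thus ?thesis using X by simp
  next
    case (Suc k)
    have "9 * C * T * 2 ^ n = 2 * (v * 2 ^ k)" by (simp add: v_def Suc)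
    also have "\<dots> \<le> C * D * T\<^sup>2" by (rule below) (simp add: Suc)
    finally have "(C * T) * (9 * 2 ^ n) \<le> (C * T) * (D * T)" by (simp add: power2_eq_square mult_ac)
    hence "9 * 2 ^ n \<le> D * T" using C0 T0 by simp
    hence "(9 * 2 ^ n) ^ 3 \<le> (D * T) ^ 3" by (rule power_mono) simp
    also have "\<dots> = real (D_of q ^ 3) * t" by (simp add: power_mult_distrib T3 D_def)
    also have "real (D_of q ^ 3) * t \<le> real (8 * q) * t"
      using D_cube_le[OF q] t0 by (intro mult_right_mono) (simp_all only: of_nat_le_iff less_imp_le)
    finally have "729 * (2 ^ n) ^ 3 \<le> 8 * Q" by (simp add: power_mult_distrib Q_def)
    moreover have "8 * Q \<le> 729 * Q" using Q0 by simp
    ultimately have "(2 ^ n) ^ 3 \<le> Q" by linarith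
    hence "ln ((2 ^ n) ^ 3) \<le> X" unfolding X_def by (intro ln_mono) auto
    hence "3 * (real n * ln 2) \<le> X" by (simp add: ln_realpow)
    moreover have "real n * (2/3) \<le> real n * ln 2" using ln2_ge_two_thirds by (intro mult_left_mono) auto
    ultimately show ?thesis by simp
  qed

  have part1: "norm (F v) \<le> Q6 * (6 * sqrt (cbf q))"
  proof -
    have "norm (F v) \<le> 2 * sqrt v" unfolding F_def using norm_partial_le[OF chi] v0 by simp
    also have "sqrt v = 3 * sqrt (C * T)" unfolding v_def by (simp add: real_sqrt_mult mult.assoc)
    finally show ?thesis by (simp add: CT mult_ac)
  qed

  have part2: "norm (F u - F v) \<le> Q6 * (1.7364 * sqrt (real (sqrt_one_count (D_of q)) * cbf q
         * real B * real (divisor_count (D_of q div B))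
         * (- 1732.5 - 817.82 * X + 71.68 * X ^ 2 + 47.57 * X ^ 3)))"
  proof -
    have A0: "A \<ge> 0" by (simp add: A_def)
    have "norm (F u - F v) \<le> real n * sqrt (C * T * A * (1015 + 2 * ln D))"
      unfolding F_def u_def A_def C_def D_def
      by (rule quad.partial_weyl_chain) (use T58 T3 below in \<open>auto simp: v_def C_def D_def\<close>)
    also have "\<dots> \<le> (X / 2) * sqrt (C * T * A * (1017 + 2 / 3 * X))"
      using n_le lnD ln_ge_zero[OF D0] C0 T0 A0 X by (intro mult_mono real_sqrt_le_mono mult_left_mono) auto
    also have "\<dots> = sqrt (C * T * A * ((X / 2)\<^sup>2 * (1017 + 2 / 3 * X)))"
      using X by (simp add: real_sqrt_mult)
    also have "\<dots> \<le> sqrt (C * T * A * (1.7364\<^sup>2 * (- 1732.5 - 817.82 * X + 71.68 * X ^ 2 + 47.57 * X ^ 3)))"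
      using Z_polynomial_bounds(2)[OF X] C0 T0 A0 by (intro real_sqrt_le_mono mult_left_mono) auto
    also have "\<dots> = sqrt (C * T) * (1.7364 * sqrt (A * (- 1732.5 - 817.82 * X + 71.68 * X ^ 2 + 47.57 * X ^ 3)))"
      by (simp add: real_sqrt_mult)
    also have "\<dots> = Q6 * (1.7364 * sqrt (real (sqrt_one_count (D_of q)) * cbf q
         * real B * real (divisor_count (D_of q div B))
         * (- 1732.5 - 817.82 * X + 71.68 * X ^ 2 + 47.57 * X ^ 3)))"
      unfolding CT A_def by (simp add: real_sqrt_mult)
    finally show ?thesis .
  qed

  \<comment> \<open>If the Weyl range already reaches past \<open>Q\<close>, the linear range is
    empty and the tail starts at \<open>u\<close>.\<close>
  define Y where "Y = max Q u"
  have YQ: "Y \<ge> t * real q" by (simp add: Y_def Q_def mult.commute)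
  have Y0: "Y > 0" using Q0 by (simp add: Y_def)
  have Ym: "Y \<le> real q * t\<^sup>2"
  proof -
    have "Q \<le> real q * t\<^sup>2" unfolding Q_def power2_eq_square using t q1 by (intro mult_left_mono) auto
    thus ?thesis using u_le by (simp add: Y_def)
  qed

  \<comment> \<open>213.25 is 2.5 * 85.3. The numbers 35.1 and 0.48 round up 4.5 * 1.415 * 5.5 and
    4.5 * 1.415 * 0.075; here 1.415 exceeds sqrt 2, which comes from the 2 in \<open>u_ge\<close>,
    and 0.075 is half of 0.15, as \<open>ln P\<close> is at most \<open>X / 2\<close>.\<close>
  have part3: "norm (F Y - F u) \<le> 213.25 * (real B1 * sqf q) + Q6 * (spf q * (35.1 + 0.48 * X))"
  proof -
    define a where "a = 85.3 / (sqrt t * real P)"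
    define b where "b = C1 * sqrt t * (5.5 + 0.15 * ln (real P))"
    have a0: "a \<ge> 0" using t0 by (simp add: a_def)
    have b0: "b \<ge> 0" using t0 C10 lnP by (simp add: b_def)
    have "norm (F Y - F u) \<le> 2.5 * a * sqrt Q + 4.5 * b / sqrt u"
    proof (cases "u \<le> Q")
      case True
      have "norm (F Q - F u) \<le> 2.5 * a * sqrt Q + 4.5 * b / sqrt u"
      proof (rule dyadic_sum_bound[OF u0 a0 b0 True])
        fix N K assume N: "u \<le> N" "N \<le> K" "K \<le> 2 * N"
        have "C1 \<le> C * D"
        proof -
          have "C1_of q \<le> C_of q * D_of q" using C1_dvd_C_D C_pos D_pos by (intro dvd_imp_le) auto
          thus ?thesis unfolding C1_def C_def D_def by (metis of_nat_le_iff of_nat_mult)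
        qed
        hence "C1 * T\<^sup>2 \<le> C * D * T\<^sup>2" by (intro mult_right_mono) auto
        hence "2 * N \<ge> real (C1_of q) * T\<^sup>2" using u_ge N(1) unfolding C1_def by linarith
        from lin.partial_block_vdc[OF T58 T3 _ this N(2,3)] t
        show "norm (F K - F N) \<le> a * sqrt N + b / sqrt N" unfolding F_def a_def b_def C1_def by simp
      qed
      thus ?thesis using True by (simp add: Y_def max_def)
    next
      case False
      thus ?thesis using a0 b0 Q0 u0 by (simp add: Y_def max_def)
    qed
    also have "2.5 * a * sqrt Q = 213.25 * (real B1 * sqf q)"
      unfolding sqf' [symmetric] a_def Q_def using t0 by (simp add: real_sqrt_mult)
    also have "4.5 * b / sqrt u \<le> Q6 * (spf q * (35.1 + 0.48 * X))"
    proof -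
      have CD0: "C * D > 0" using C0 D0 by (intro mult_pos_pos) auto
      have "sqrt (C * D) * T \<le> 1.415 * sqrt u"
      proof -
        have "sqrt (C * D) * T = sqrt (C * D * T\<^sup>2)" using T0 by (simp add: real_sqrt_mult)
        also have "\<dots> \<le> sqrt (2 * u)" using u_ge by simp
        also have "\<dots> = sqrt 2 * sqrt u" by (simp add: real_sqrt_mult)
        also have "sqrt 2 \<le> (1.415::real)" by (rule real_le_lsqrt) (auto simp: power2_eq_square)
        hence "sqrt 2 * sqrt u \<le> 1.415 * sqrt u" using u0 by (intro mult_right_mono) auto
        finally show ?thesis .
      qed
      hence 1: "1 / sqrt u \<le> 1.415 / (sqrt (C * D) * T)" using CD0 T0 u0 by (simp add: field_simps)
      have "4.5 * b / sqrt u = 4.5 * b * (1 / sqrt u)" by simp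
      also have "\<dots> \<le> 4.5 * b * (1.415 / (sqrt (C * D) * T))" using 1 b0 by (intro mult_left_mono) auto
      also have "\<dots> = (C1 * t powr (1/6) / sqrt (C * D)) * (4.5 * 1.415 * (5.5 + 0.15 * ln (real P)))"
      proof -
        have "4.5 * (C1 * (T * x) * g) * (1.415 / (y * T)) = C1 * x / y * (4.5 * 1.415 * g)" for x y g :: real
          using T0 by simp
        thus ?thesis unfolding b_def t6 .
      qed
      also have "\<dots> = (spf q * Q6) * (4.5 * 1.415 * (5.5 + 0.15 * ln (real P)))" unfolding spf0 ..
      also have "\<dots> \<le> (spf q * Q6) * (35.1 + 0.48 * X)"
      proof (rule mult_left_mono)
        have "4.5 * 1.415 * (5.5 + 0.15 * ln (real P)) \<le> 4.5 * 1.415 * (5.5 + 0.15 * (X / 2))"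
          using lnP by (intro mult_left_mono add_left_mono) auto
        also have "\<dots> \<le> 35.1 + 0.48 * X" using X by (simp add: field_simps)
        finally show "4.5 * 1.415 * (5.5 + 0.15 * ln (real P)) \<le> 35.1 + 0.48 * X" .
        show "0 \<le> spf q * Q6" unfolding spf0 using C10 CD0 by simp
      qed
      finally show ?thesis by (simp only: mult_ac)
    qed
    finally show ?thesis by simp
  qed

  have sg: "sg > 0" "sg\<^sup>2 = t\<^sup>2 + 1/4" unfolding sg_def by (auto intro!: add_nonneg_pos)
  have part4: "norm (w - F Y) \<le> real B1 * sqf q * (36 + 0.11 * X)"
  proof (cases "P = 1")
    case True
    have Bsq: "real B1 * sqf q = sqrt (real q)" using sqf' True by simp
    \<comment> \<open>With about t^2 periods, the truncation error, of order sg sqrt q / sqrt m, and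
      the main term, of order sqrt (q m) / sg, are both of order sqrt q.\<close>
    define m where "m = nat \<lceil>t\<^sup>2\<rceil>"
    have t2: "t\<^sup>2 \<ge> 40000" using power_mono[OF t, of 2] by simp
    have m: "real m \<ge> t\<^sup>2" "real m \<le> t\<^sup>2 + 1" using t2 unfolding m_def by linarith+
    have m2: "m \<ge> 2" using m t2 by linarith
    have Yqm: "Y \<le> real (q * m)"
    proof -
      have "real q * t\<^sup>2 \<le> real q * real m" using m by (intro mult_left_mono) auto
      thus ?thesis using Ym by simp
    qed
    have sm: "sqrt (real m) \<le> 1.01 * t"
    proof (rule real_le_lsqrt)
      show "real m \<le> (1.01 * t)\<^sup>2" using m t2 by (simp add: power_mult_distrib power2_eq_square)
    qed (use t0 in auto)
    have "norm (F (real (q * m)) - F Y) \<le> 2.5 * (4 * pi / t) * sqrt (real (q * m)) + 4.5 * 0 / sqrt Y"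
    proof (rule dyadic_sum_bound[OF Y0 _ _ Yqm])
      fix N K assume N: "Y \<le> N" "N \<le> K" "K \<le> 2 * N"
      have "N \<ge> t * real q" using N YQ by linarith
      from lin.partial_block_kl[OF True this N(2,3)]
      show "norm (F K - F N) \<le> 4 * pi / t * sqrt N + 0 / sqrt N" unfolding F_def .
    qed (use t0 in auto)
    also have "\<dots> = 10 * pi / t * (sqrt (real q) * sqrt (real m))" by (simp add: real_sqrt_mult)
    also have "\<dots> \<le> 10 * 3.15 / t * (sqrt (real q) * (1.01 * t))"
      using sm pi_approx t0 by (intro mult_mono divide_right_mono mult_left_mono) auto
    also have "\<dots> = 31.815 * sqrt (real q)" using t0 by simp
    finally have 1: "norm (F (real (q * m)) - F Y) \<le> 31.815 * sqrt (real q)" .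
    have 2: "2 * sg * sqrt (real q) / sqrt (real (m - 1)) \<le> 2.1 * sqrt (real q)"
    proof -
      have mm: "real (m - 1) = real m - 1" using m2 by simp
      have "(2 * sg)\<^sup>2 \<le> (2.1 * sqrt (real m - 1))\<^sup>2"
        using m t2 m2 by (simp add: power_mult_distrib sg(2)) (simp add: power2_eq_square)
      hence "2 * sg \<le> 2.1 * sqrt (real m - 1)" by (rule power2_le_imp_le) (use m2 in simp)
      moreover have "sqrt (real m - 1) > 0" using m2 by simp
      ultimately have "2 * sg / sqrt (real m - 1) \<le> 2.1" by (simp add: divide_le_eq)
      from mult_right_mono[OF this, of "sqrt (real q)"] show ?thesis unfolding mm by simp
    qed
    have 3: "kappa * sqrt (real (q * m)) / sg \<le> 1.1 * sqrt (real q)"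
    proof -
      have "(1.1 * sg)\<^sup>2 = 1.21 * sg\<^sup>2" by (simp add: power_mult_distrib power2_eq_square)
      hence "(sqrt (real m))\<^sup>2 \<le> (1.1 * sg)\<^sup>2" using m t2 unfolding sg(2) by simp
      hence "sqrt (real m) \<le> 1.1 * sg" by (rule power2_le_imp_le) (use sg in simp)
      hence "sqrt (real m) / sg \<le> 1.1" using sg by (simp add: divide_le_eq)
      hence "kappa * (sqrt (real m) / sg) \<le> 1 * 1.1" using kappa sg by (intro mult_mono) auto
      from mult_right_mono[OF this, of "sqrt (real q)"] show ?thesis by (simp add: real_sqrt_mult mult_ac)
    qed
    have "norm (w - F (real (q * m))) \<le> 2.1 * sqrt (real q) + 1.1 * sqrt (real q)"
      using w1[OF m2] 2 3 unfolding F_def sg_def by linarith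
    moreover have "norm (w - F Y) \<le> norm (w - F (real (q * m))) + norm (F (real (q * m)) - F Y)"
      using norm_triangle_ineq[of "w - F (real (q * m))" "F (real (q * m)) - F Y"] by simp
    ultimately have "norm (w - F Y) \<le> 35.015 * sqrt (real q)" using 1 by simp
    also have "\<dots> \<le> sqrt (real q) * 36" by simp
    also have "\<dots> \<le> sqrt (real q) * (36 + 0.11 * X)" using X by (intro mult_left_mono) auto
    finally show ?thesis unfolding Bsq .
  next
    case False
    hence P2: "P \<ge> 2" using lin.P1 by linarith
    define S where "S = 3 * C1 * (1 + ln (real P)) / sqrt Y"
    have tail: "norm (F K - F Y) \<le> S" if "Y \<le> K" for K
      unfolding F_def S_def C1_def using lin.partial_tail[OF P2 YQ that] .
    define E where "E = 2 * sg * sqrt (real q)"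
    have E0: "E > 0" using sg q1 by (simp add: E_def)
    have big: "\<exists>m\<ge>2. Y \<le> real (q * m) \<and> R \<le> real (m - 1)" for R
    proof -
      obtain m :: nat where m: "max (max Y R) 2 \<le> real m" using real_arch_simple by blast
      have "real (Suc m) \<le> real (q * Suc m)" using mult_right_mono[OF q1, of "real (Suc m)"] by (simp only: of_nat_mult) simp
      thus ?thesis using m by (intro exI[of _ "Suc m"]) auto
    qed
    \<comment> \<open>A main term would grow with \<open>m\<close>, but the partial sums stay bounded.\<close>
    have k0: "kappa = 0"
    proof (rule ccontr)
      assume "kappa \<noteq> 0"
      hence k: "kappa > 0" using kappa by simp
      define H where "H = norm (w - F Y) + S + E"
      obtain m where m: "m \<ge> 2" "Y \<le> real (q * m)" "(H * sg / kappa)\<^sup>2 + 1 \<le> real (m - 1)" using big by blast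
      have "E / sqrt (real (m - 1)) \<le> E / 1" using E0 m(1) by (intro divide_left_mono) auto
      moreover have "norm (w - F (real (q * m))) \<le> norm (w - F Y) + norm (F (real (q * m)) - F Y)"
        using norm_triangle_ineq4[of "w - F Y" "F (real (q * m)) - F Y"] by simp
      ultimately have "kappa * sqrt (real (q * m)) / sg \<le> H"
        using w2[OF m(1)] tail[OF m(2)] unfolding H_def F_def E_def sg_def by linarith
      hence "sqrt (real (q * m)) \<le> H * sg / kappa" using k sg by (simp add: field_simps)
      hence "real (q * m) \<le> (H * sg / kappa)\<^sup>2" by (rule sqrt_le_D)
      moreover have "real (m - 1) \<le> real (q * m)"
        using mult_right_mono[OF q1, of "real m"] by (simp add: of_nat_diff)
      ultimately show False using m(3) by linarith
    qed
    \<comment> \<open>Without a main term the truncation error tends to 0, so the cut-off can be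
      sent to infinity.\<close>
    have "norm (w - F Y) \<le> S"
    proof (rule field_le_epsilon)
      fix e :: real assume e: "e > 0"
      obtain m where m: "m \<ge> 2" "Y \<le> real (q * m)" "(E / e)\<^sup>2 \<le> real (m - 1)" using big by blast
      have "E / e \<le> sqrt (real (m - 1))" using m(3) by (rule real_le_rsqrt)
      moreover have "sqrt (real (m - 1)) > 0" using m(1) by simp
      ultimately have "E / sqrt (real (m - 1)) \<le> e" using e by (simp add: field_simps)
      hence "norm (w - F (real (q * m))) \<le> e" using w1[OF m(1)] unfolding k0 E_def F_def sg_def by simp
      moreover have "norm (w - F Y) \<le> norm (w - F (real (q * m))) + norm (F (real (q * m)) - F Y)"
        using norm_triangle_ineq[of "w - F (real (q * m))" "F (real (q * m)) - F Y"] by simp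
      ultimately show "norm (w - F Y) \<le> S + e" using tail[OF m(2)] by linarith
    qed
    also have "S \<le> sqf q * (36 + 0.11 * X)"
    proof -
      have st: "sqrt t \<ge> 14" using t by (intro real_le_rsqrt) auto
      have "S \<le> 3 * C1 * (1 + X / 2) / sqrt Q"
        unfolding S_def using C10 lnP Q0 X by (intro frac_le mult_left_mono add_left_mono) (auto simp: Y_def)
      also have "\<dots> = sqf q * ((3 + 1.5 * X) / sqrt t)"
        unfolding sqf Q_def by (simp add: real_sqrt_mult)
      also have "\<dots> \<le> sqf q * ((3 + 1.5 * X) / 14)" using sqf1 st X t0 by (intro mult_left_mono divide_left_mono) auto
      also have "\<dots> \<le> sqf q * (36 + 0.11 * X)" using sqf1 X by (intro mult_left_mono) auto
      finally show ?thesis .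
    qed
    also have "\<dots> \<le> real B1 * (sqf q * (36 + 0.11 * X))"
      using B10 sqf1 X mult_right_mono[of 1 "real B1" "sqf q * (36 + 0.11 * X)"] by simp
    finally show ?thesis by (simp only: mult.assoc)
  qed

  define Z1 where "Z1 = sqrt (real (sqrt_one_count (D_of q)) * cbf q * (65.5619 - 17.1704 * X - 2.4781 * X ^ 2 + 0.6807 * X ^ 3))"
  define Z2 where "Z2 = sqrt (real (sqrt_one_count (D_of q)) * cbf q
         * real B * real (divisor_count (D_of q div B)) * (- 1732.5 - 817.82 * X + 71.68 * X ^ 2 + 47.57 * X ^ 3))"
  have cbf0: "cbf q \<ge> 0" using cbf_eq[OF q] by simp
  have Z10: "Z1 \<ge> 0" unfolding Z1_def using Z_polynomial_bounds(1)[OF X] cbf0 by simp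
  have spfn: "spf q \<ge> 0" using spf_eq[OF q] by simp
  have "norm w \<le> norm (F v) + norm (F u - F v) + norm (F Y - F u) + norm (w - F Y)"
  proof -
    have "w = F v + (F u - F v) + (F Y - F u) + (w - F Y)" by simp
    thus ?thesis by (metis norm_triangle_ineq norm_triangle_mono order_refl)
  qed
  also have "\<dots> \<le> Q6 * (6 * sqrt (cbf q)) + Q6 * (1.7364 * Z2)
    + (213.25 * (real B1 * sqf q) + Q6 * (spf q * (35.1 + 0.48 * X))) + real B1 * sqf q * (36 + 0.11 * X)"
    by (intro add_mono part1 part2[folded Z2_def] part3 part4)
  also have "\<dots> = Q6 * (6 * sqrt (cbf q) + spf q * (35.1 + 0.48 * X) + 1.7364 * Z2)
    + real B1 * sqf q * (249.25 + 0.11 * X)" by (simp add: algebra_simps)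
  also have "\<dots> \<le> Q6 * (6.6668 * sqrt (cbf q) + spf q * (15.6004 * X - 16.0834) + 1.7364 * Z1 + 1.7364 * Z2)
    + W_fun q B1 X"
  proof (rule add_mono[OF mult_left_mono])
    show "6 * sqrt (cbf q) + spf q * (35.1 + 0.48 * X) + 1.7364 * Z2
      \<le> 6.6668 * sqrt (cbf q) + spf q * (15.6004 * X - 16.0834) + 1.7364 * Z1 + 1.7364 * Z2"
    proof -
      \<comment> \<open>At \<open>X = 21 / 4\<close> the two factors are about 37.6 and
        65.8.\<close>
      have "spf q * (35.1 + 0.48 * X) \<le> spf q * (15.6004 * X - 16.0834)" using spfn X by (intro mult_left_mono) auto
      moreover have "6 * sqrt (cbf q) \<le> 6.6668 * sqrt (cbf q)" using cbf0 by (intro mult_right_mono) auto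
      moreover have "0 \<le> 1.7364 * Z1" using Z10 by simp
      moreover have "a + b + c \<le> a' + b' + d + c" if "b \<le> b'" "a \<le> a'" "0 \<le> d" for a a' b b' c d :: real
        using that by linarith
      ultimately show ?thesis by blast
    qed
    \<comment> \<open>The surplus of \<open>W_fun\<close> in its part with
      \<open>B1 * sqf q\<close>. It has to make up for \<open>19.092 * X - 101.152\<close>, which is
      slightly negative at \<open>X = 21 / 4\<close>; by \<open>Bs\<close> it is large
      enough.\<close>
    define G where "G = real B1 * sqf q * (94.868 * X - 444.946)"
    have "1 * (94.868 * X - 444.946) \<le> G"
      unfolding G_def using Bs X by (intro mult_right_mono) auto
    moreover have "W_fun q B1 X = real B1 * sqf q * (249.25 + 0.11 * X) + G + (19.092 * X - 101.152)"
      unfolding W_fun_def G_def by (simp add: field_simps)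
    ultimately show "real B1 * sqf q * (249.25 + 0.11 * X) \<le> W_fun q B1 X" using X by simp
  qed (use Q6_0 in auto)
  finally show ?thesis
    unfolding Z_fun_def Z1_def Z2_def Q6_def X_def Q_def
    by (simp add: algebra_simps)
qed

lemma of_nat_powr_eq_ee:
  assumes "n > 0"
  shows "of_nat n powr - (1/2 + \<i> * of_real t) = of_real (1 / sqrt (real n)) * ee (- (t / (2 * pi)) * ln (real n))"
proof -
  have "(of_nat n :: complex) powr - (1/2 + \<i> * of_real t)
      = exp (of_real (- (1/2) * ln (real n)) + \<i> * of_real (2 * pi * (- (t / (2 * pi)) * ln (real n))))"
  proof -
    have "- (1/2 + \<i> * of_real t) * of_real (ln (real n))
      = of_real (- (1/2) * ln (real n)) + \<i> * complex_of_real (2 * pi * (- (t / (2 * pi)) * ln (real n)))"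
      by (simp add: left_diff_distrib)
    thus ?thesis using assms by (simp only: powr_def Ln_of_nat of_nat_eq_0_iff) simp
  qed
  also have "\<dots> = of_real (exp (- (1/2) * ln (real n))) * ee (- (t / (2 * pi)) * ln (real n))"
    unfolding exp_add ee_def cis_conv_exp exp_of_real ..
  also have "exp (- (1/2) * ln (real n)) = real n powr (- (1/2))" using assms by (simp add: powr_def)
  also have "\<dots> = 1 / sqrt (real n)" by (simp add: powr_minus_divide powr_half_sqrt)
  finally show ?thesis .
qed

theorem theorem1p2:
  fixes q B1 B :: nat and chi :: "int \<Rightarrow> complex" and t :: real and Lt L0 L :: int
  assumes "q \<ge> 1"
    and "dirichlet_character q chi"
    and "\<bar>t\<bar> \<ge> 200"
    and "\<And>x :: int. chi (1 + int (C1_of q) * x)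
           = exp (2 * of_real pi * \<i> * of_int Lt * of_int x / of_nat (D1_of q))"
    and "int B1 = gcd Lt (int (D1_of q))"
    and "\<And>x :: int. chi (1 + int (C_of q) * x)
           = exp (4 * of_real pi * \<i> * of_int L0 * of_int x / of_nat (C_of q * D_of q)
                  + 2 * of_real pi * \<i> * of_int L * of_int x ^ 2 / of_nat (D_of q))"
    and "int B = gcd L (int (D_of q))"
  shows "let Q = real q * \<bar>t\<bar> in
           norm (dirichlet_L chi (1 / 2 + \<i> * of_real t))
             \<le> Q powr (1 / 6) * Z_fun q B (ln Q) + W_fun q B1 (ln Q)"
proof -
  note q = assms(1) and chi = assms(2)
  define s where "s = 1 / 2 + \<i> * complex_of_real t"
  define a where "a = (\<lambda>n::nat. chi (int n))"
  have per: "a (n + q) = a n" for n using chi by (simp add: a_def dirichlet_character_def)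
  have a1: "norm (a n) \<le> 1" for n unfolding a_def by (rule norm_dirichlet_character_le[OF chi])
  have "a (Suc (n + q)) = a (Suc n)" for n using per[of "Suc n"] by simp
  then obtain f where f: "f holomorphic_on - {1}"
    "\<And>z. Re z > 1 \<Longrightarrow> (\<lambda>n. a (Suc n) / of_nat (Suc n) powr z) sums f z"
    using periodic_series_continuation[of q "\<lambda>n. a (Suc n)"] q by blast
  \<comment> \<open>Hence the domain in the definition of \<open>dirichlet_L\<close> is the
    punctured plane, on which \<open>f\<close> is holomorphic.\<close>
  have s1: "s \<noteq> 1" by (auto simp: s_def complex_eq_iff)
  have "continues_L_series chi (insert s (- {1})) f"
    using f s1 by (auto simp: continues_L_series_def a_def insert_absorb)
  hence Lf: "dirichlet_L chi s = f s" by (rule dirichlet_L_eqI)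
  define c where "c = (\<Sum>n=1..q. a n) / of_nat q"
  define sg where "sg = sqrt (t\<^sup>2 + 1/4)"
  have norms: "norm s = sg" "norm (1 - s) = sg"
    by (simp_all add: s_def sg_def cmod_def power2_eq_square add.commute)
  have c1: "norm c \<le> 1"
  proof -
    have "norm (\<Sum>n=1..q. a n) \<le> (\<Sum>n=1..q. 1)" by (rule order_trans[OF norm_sum]) (intro sum_mono a1)
    thus ?thesis using q by (simp add: c_def norm_divide)
  qed
  have F: "(\<Sum>n=1..q * m. a n * of_nat n powr (- s)) = partial chi t (real (q * m))" for m
  proof -
    have "block 0 (real (q * m)) = {1..q * m}" by (auto simp: block_def Suc_le_eq simp del: of_nat_mult)
    moreover have "a n * of_nat n powr (- s) = of_real (1 / sqrt (real n)) * twist chi t n" if "n \<in> {1..q * m}" for n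
      unfolding s_def twist_def a_def using that by (subst of_nat_powr_eq_ee) (auto simp only: atLeastAtMost_iff mult.left_commute)
    ultimately show ?thesis unfolding partial_def by (intro sum.cong) auto
  qed
  define E where "E = (\<lambda>m. 2 * sg * sqrt (real q) / sqrt (real (m - 1)))"
  \<comment> \<open>The modulus of the main term. The triangle inequality in both directions yields
    the hypotheses \<open>w1\<close> and \<open>w2\<close> of \<open>main_bound\<close>.\<close>
  define R where "R = (\<lambda>m. norm c * sqrt (real (q * m)) / sg)"
  have approx: "norm (f s - partial chi t (real (q * m))) \<le> E m + R m \<and>
      R m \<le> norm (f s - partial chi t (real (q * m))) + E m" if m: "m \<ge> 2" for m
  proof -
    define r where "r = c * of_nat (q * m) powr (1 - s) / (1 - s)"
    have "norm (f s - (partial chi t (real (q * m)) - r)) \<le> E m"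
      using periodic_partial_sum_approx[OF q per a1 f _ m, of s]
      unfolding F c_def [symmetric] r_def [symmetric] E_def norms by (simp add: s_def)
    moreover have "norm r = R m"
      unfolding r_def R_def norm_divide norm_mult norms
      by (subst norm_powr_real_powr) (simp_all add: s_def powr_half_sqrt)
    moreover have "norm (f s - partial chi t (real (q * m))) \<le> norm (f s - (partial chi t (real (q * m)) - r)) + norm r"
      using norm_triangle_ineq4[of "f s - (partial chi t (real (q * m)) - r)" r] by (simp add: algebra_simps)
    moreover have "norm r \<le> norm (f s - partial chi t (real (q * m))) + norm (f s - (partial chi t (real (q * m)) - r))"
      using norm_triangle_ineq4[of "f s - (partial chi t (real (q * m)) - r)" "f s - partial chi t (real (q * m))"]
      by (simp add: algebra_simps)
    ultimately show ?thesis by linarith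
  qed
  have "norm (f s) \<le> (real q * \<bar>t\<bar>) powr (1/6) * Z_fun q B (ln (real q * \<bar>t\<bar>)) + W_fun q B1 (ln (real q * \<bar>t\<bar>))"
  proof (cases "t > 0")
    case True
    have "norm (f s) \<le> (real q * t) powr (1/6) * Z_fun q B (ln (real q * t)) + W_fun q B1 (ln (real q * t))"
    proof (rule main_bound[where chi = chi and Lt = Lt and ?L0.0 = L0 and L = L and kappa = "norm c"])
      show "norm (f s - partial chi t (real (q * m)))
        \<le> 2 * sqrt (t\<^sup>2 + 1/4) * sqrt (real q) / sqrt (real (m - 1)) + norm c * sqrt (real (q * m)) / sqrt (t\<^sup>2 + 1/4)"
        "norm c * sqrt (real (q * m)) / sqrt (t\<^sup>2 + 1/4)
        \<le> norm (f s - partial chi t (real (q * m))) + 2 * sqrt (t\<^sup>2 + 1/4) * sqrt (real q) / sqrt (real (m - 1))"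
        if "2 \<le> m" for m using approx[OF that] unfolding E_def R_def sg_def by blast+
    qed (use assms True c1 in auto)
    thus ?thesis using True by simp
  next
    case False
    \<comment> \<open>Conjugation negates \<open>t\<close> and the parameters \<open>Lt\<close>,
      \<open>L0\<close> and \<open>L\<close>; the gcds \<open>B1\<close> and \<open>B\<close> ignore
      the sign.\<close>
    define chi' where "chi' = (\<lambda>n. cnj (chi n))"
    have chi': "dirichlet_character q chi'" using chi by (simp add: dirichlet_character_def chi'_def)
    have tw: "twist chi' (- t) n = cnj (twist chi t n)" for n
      by (simp add: twist_def chi'_def flip: ee_uminus)
    have pc: "partial chi' (- t) x = cnj (partial chi t x)" for x
      unfolding partial_def tw by simp
    have nc: "norm (cnj (f s) - partial chi' (- t) x) = norm (f s - partial chi t x)" for x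
      unfolding pc by (metis complex_cnj_diff complex_mod_cnj)
    have ph1: "chi' (1 + int (C1_of q) * x) = exp (2 * of_real pi * \<i> * of_int (- Lt) * of_int x / of_nat (D1_of q))" for x
      unfolding chi'_def assms(4) by (simp add: exp_cnj)
    have ph2: "chi' (1 + int (C_of q) * x) = exp (4 * of_real pi * \<i> * of_int (- L0) * of_int x / of_nat (C_of q * D_of q)
                  + 2 * of_real pi * \<i> * of_int (- L) * of_int x ^ 2 / of_nat (D_of q))" for x
      unfolding chi'_def assms(6) by (simp add: exp_cnj)
    have "norm (cnj (f s)) \<le> (real q * - t) powr (1/6) * Z_fun q B (ln (real q * - t)) + W_fun q B1 (ln (real q * - t))"
    proof (rule main_bound[where chi = chi' and Lt = "- Lt" and ?L0.0 = "- L0" and L = "- L" and kappa = "norm c"])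
      show "norm (cnj (f s) - partial chi' (- t) (real (q * m)))
        \<le> 2 * sqrt ((- t)\<^sup>2 + 1/4) * sqrt (real q) / sqrt (real (m - 1)) + norm c * sqrt (real (q * m)) / sqrt ((- t)\<^sup>2 + 1/4)"
        "norm c * sqrt (real (q * m)) / sqrt ((- t)\<^sup>2 + 1/4)
        \<le> norm (cnj (f s) - partial chi' (- t) (real (q * m))) + 2 * sqrt ((- t)\<^sup>2 + 1/4) * sqrt (real q) / sqrt (real (m - 1))"
        if "2 \<le> m" for m using approx[OF that] unfolding nc E_def R_def sg_def by simp_all
    qed (use assms(1,3,5,7) chi' False c1 ph1 ph2 in auto)
    thus ?thesis using False by simp
  qed
  thus ?thesis unfolding Let_def s_def [symmetric] Lf .
qed

end
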